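(* Let $(M^3,g,f,\rho)$ be a static vacuum space with non-null cosmological constant, with harmonic curvature and boundary $\partial M=f^{-1}(c)$, where $c$ is a regular value of $f$. There is no compact two-sided free boundary stable minimal surface $\Sigma^2$ in $M^3$ with positive Gauss curvature.
   Context: A static vacuum space with non-null cosmological constant (dimension 3) is a Riemannian manifold $(M^3,g)$ with constant scalar curvature $R\neq 0$ and a smooth function $f>0$ satisfying $$f\,Ric=\nabla^2 f+\frac{R}{2}f\,g,\qquad \Delta f+\frac{R}{2}f=0;$$ this is the case $\mu=-\rho=R/2$ of the static perfect fluid equations $f\,Ric=\nabla^2 f+\frac{\mu-\rho}{2}fg$, $\Delta f=\frac{\mu+3\rho}{2}f$, $\mu=R/2$. Harmonic curvature means the Riemann curvature tensor is divergence free. The outward unit normal of $\partial M=f^{-1}(c)$ is $X=-\nabla f/|\nabla f|$. A surface $\Sigma$ immersed in $M$ with $\Sigma\cap\partial M=\partial\Sigma$ is free boundary if it meets $\partial M$ orthogonally, i.e. its outward conormal $\nu$ along $\partial\Sigma$ equals $X$; it is two-sided if it has a global unit normal field $N$. A free boundary minimal $\Sigma$ is stable if for all $\phi\in C^\infty(\Sigma)$ $$-\int_\Sigma\phi\{\Delta_\Sigma\phi+(Ric(N,N)+|A_\Sigma|^2)\phi\}\,d\sigma+\int_{\partial\Sigma}\phi\left\{\frac{\partial\phi}{\partial\nu}-II(N,N)\phi\right\}da\ge 0,$$ where $A_\Sigma$ is the second fundamental form of $\Sigma$ and $II(W,W)=\langle\nabla_W X,W\rangle$ that of $\partial M$.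
   Formalization: The free boundary surface Σ is required to have nonempty boundary; closed surfaces are excluded, since slices {t}×S² of [a,π−a]×S² with f = sin t would be counterexamples. *)

theory Defs
  imports "HOL-Analysis.Analysis"
begin

section \<open>Smooth functions on half-spaces\<close>

definition half_space :: "(real ^ 'n::{finite,one}) set"
  where "half_space = {x. 0 \<le> x $ 1}"

primrec Ck_on :: "nat \<Rightarrow> (real ^ 'n) set \<Rightarrow> (real ^ 'n \<Rightarrow> 'b::real_normed_vector) \<Rightarrow> bool"
  where
    "Ck_on 0 U u \<longleftrightarrow> continuous_on U u"
  | "Ck_on (Suc k) U u \<longleftrightarrow> (\<forall>x\<in>U. u differentiable (at x)) \<and>
       (\<forall>i. Ck_on k U (\<lambda>x. frechet_derivative u (at x) (axis i 1)))"

text \<open>Smoothness on a set that need not be open means that there are local smooth extensions.\<close>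

definition smooth_on :: "(real ^ 'n) set \<Rightarrow> (real ^ 'n \<Rightarrow> 'b::real_normed_vector) \<Rightarrow> bool"
  where "smooth_on S u \<longleftrightarrow>
    (\<forall>x\<in>S. \<exists>U u'. open U \<and> x \<in> U \<and> (\<forall>k. Ck_on k U u') \<and> (\<forall>y\<in>U \<inter> S. u' y = u y))"

text \<open>Below, \<open>S\<close> is always a relatively open subset of the half-space, so that the derivative
  within \<open>S\<close> is unique, also at the boundary points.\<close>

definition pd :: "(real ^ 'n) set \<Rightarrow> 'n \<Rightarrow> (real ^ 'n \<Rightarrow> 'b::real_normed_vector) \<Rightarrow> real ^ 'n \<Rightarrow> 'b"
  where "pd S i u x = frechet_derivative u (at x within S) (axis i 1)"


section \<open>Riemannian geometry in a coordinate domain\<close>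

text \<open>Here \<open>g\<close> is the matrix of components of a metric, as a function on the coordinate domain \<open>S\<close>.\<close>

definition metric_prod :: "real ^ 'n ^ 'n \<Rightarrow> real ^ 'n \<Rightarrow> real ^ 'n \<Rightarrow> real"
  where "metric_prod h v w = v \<bullet> (h *v w)"

text \<open>\<open>christoffel S g k i j\<close> is the symbol with upper index \<open>k\<close> and lower indices \<open>i\<close>, \<open>j\<close>.\<close>

definition christoffel ::
    "(real ^ 'n) set \<Rightarrow> (real ^ 'n \<Rightarrow> real ^ 'n ^ 'n) \<Rightarrow> 'n \<Rightarrow> 'n \<Rightarrow> 'n \<Rightarrow> real ^ 'n \<Rightarrow> real"
  where "christoffel S g k i j x =
    (\<Sum>l\<in>UNIV. matrix_inv (g x) $ k $ l *
       (pd S i (\<lambda>y. g y $ j $ l) x + pd S j (\<lambda>y. g y $ i $ l) x - pd S l (\<lambda>y. g y $ i $ j) x)) / 2"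

text \<open>\<open>riem S g l k i j\<close> is the component along the \<open>l\<close>-th coordinate field of
  \<open>R(\<partial>\<^sub>i, \<partial>\<^sub>j) \<partial>\<^sub>k = \<nabla>\<^sub>i \<nabla>\<^sub>j \<partial>\<^sub>k - \<nabla>\<^sub>j \<nabla>\<^sub>i \<partial>\<^sub>k\<close>, and
  \<open>riem4 S g i j k l = \<langle>R(\<partial>\<^sub>i, \<partial>\<^sub>j) \<partial>\<^sub>k, \<partial>\<^sub>l\<rangle>\<close>. With these
  conventions the Ricci and Gauss curvatures of round spheres are positive.\<close>

definition riem ::
    "(real ^ 'n) set \<Rightarrow> (real ^ 'n \<Rightarrow> real ^ 'n ^ 'n) \<Rightarrow> 'n \<Rightarrow> 'n \<Rightarrow> 'n \<Rightarrow> 'n \<Rightarrow> real ^ 'n \<Rightarrow> real"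
  where "riem S g l k i j x =
    pd S i (christoffel S g l j k) x - pd S j (christoffel S g l i k) x
    + (\<Sum>m\<in>UNIV. christoffel S g l i m x * christoffel S g m j k x
                 - christoffel S g l j m x * christoffel S g m i k x)"

definition riem4 ::
    "(real ^ 'n) set \<Rightarrow> (real ^ 'n \<Rightarrow> real ^ 'n ^ 'n) \<Rightarrow> 'n \<Rightarrow> 'n \<Rightarrow> 'n \<Rightarrow> 'n \<Rightarrow> real ^ 'n \<Rightarrow> real"
  where "riem4 S g i j k l x = (\<Sum>m\<in>UNIV. g x $ l $ m * riem S g m k i j x)"

definition ricci ::
    "(real ^ 'n) set \<Rightarrow> (real ^ 'n \<Rightarrow> real ^ 'n ^ 'n) \<Rightarrow> 'n \<Rightarrow> 'n \<Rightarrow> real ^ 'n \<Rightarrow> real"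
  where "ricci S g j k x = (\<Sum>i\<in>UNIV. riem S g i k i j x)"

definition scalar_curv :: "(real ^ 'n) set \<Rightarrow> (real ^ 'n \<Rightarrow> real ^ 'n ^ 'n) \<Rightarrow> real ^ 'n \<Rightarrow> real"
  where "scalar_curv S g x =
    (\<Sum>j\<in>UNIV. \<Sum>k\<in>UNIV. matrix_inv (g x) $ j $ k * ricci S g j k x)"

definition gauss_curv :: "(real ^ 2) set \<Rightarrow> (real ^ 2 \<Rightarrow> real ^ 2 ^ 2) \<Rightarrow> real ^ 2 \<Rightarrow> real"
  where "gauss_curv S g x = riem4 S g 1 2 2 1 x / det (g x)"

definition nabla_riem4 ::
    "(real ^ 'n) set \<Rightarrow> (real ^ 'n \<Rightarrow> real ^ 'n ^ 'n) \<Rightarrow> 'n \<Rightarrow> 'n \<Rightarrow> 'n \<Rightarrow> 'n \<Rightarrow> 'n \<Rightarrow> real ^ 'n \<Rightarrow> real"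
  where "nabla_riem4 S g a i j k l x =
    pd S a (riem4 S g i j k l) x
    - (\<Sum>m\<in>UNIV. christoffel S g m a i x * riem4 S g m j k l x
                 + christoffel S g m a j x * riem4 S g i m k l x
                 + christoffel S g m a k x * riem4 S g i j m l x
                 + christoffel S g m a l x * riem4 S g i j k m x)"

definition div_riem ::
    "(real ^ 'n) set \<Rightarrow> (real ^ 'n \<Rightarrow> real ^ 'n ^ 'n) \<Rightarrow> 'n \<Rightarrow> 'n \<Rightarrow> 'n \<Rightarrow> real ^ 'n \<Rightarrow> real"
  where "div_riem S g j k l x =
    (\<Sum>a\<in>UNIV. \<Sum>i\<in>UNIV. matrix_inv (g x) $ a $ i * nabla_riem4 S g a i j k l x)"

definition grad ::
    "(real ^ 'n) set \<Rightarrow> (real ^ 'n \<Rightarrow> real ^ 'n ^ 'n) \<Rightarrow> (real ^ 'n \<Rightarrow> real) \<Rightarrow> real ^ 'n \<Rightarrow> real ^ 'n"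
  where "grad S g u x = matrix_inv (g x) *v (\<chi> i. pd S i u x)"

definition hessian ::
    "(real ^ 'n) set \<Rightarrow> (real ^ 'n \<Rightarrow> real ^ 'n ^ 'n) \<Rightarrow> (real ^ 'n \<Rightarrow> real) \<Rightarrow> 'n \<Rightarrow> 'n \<Rightarrow> real ^ 'n \<Rightarrow> real"
  where "hessian S g u i j x =
    pd S i (pd S j u) x - (\<Sum>k\<in>UNIV. christoffel S g k i j x * pd S k u x)"

definition laplacian ::
    "(real ^ 'n) set \<Rightarrow> (real ^ 'n \<Rightarrow> real ^ 'n ^ 'n) \<Rightarrow> (real ^ 'n \<Rightarrow> real) \<Rightarrow> real ^ 'n \<Rightarrow> real"
  where "laplacian S g u x =
    (\<Sum>i\<in>UNIV. \<Sum>j\<in>UNIV. matrix_inv (g x) $ i $ j * hessian S g u i j x)"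

definition cov_deriv ::
    "(real ^ 'n) set \<Rightarrow> (real ^ 'n \<Rightarrow> real ^ 'n ^ 'n) \<Rightarrow> real ^ 'n \<Rightarrow> (real ^ 'n \<Rightarrow> real ^ 'n) \<Rightarrow> real ^ 'n \<Rightarrow> real ^ 'n"
  where "cov_deriv S g w Y x =
    (\<chi> k. \<Sum>a\<in>UNIV. w $ a *
       (pd S a (\<lambda>y. Y y $ k) x + (\<Sum>b\<in>UNIV. christoffel S g k a b x * Y x $ b)))"


section \<open>Manifolds with boundary\<close>

text \<open>A chart is a pair of its domain and its coordinate map, whose values matter on the domain only.\<close>

type_synonym ('a, 'n) chart = "'a set \<times> ('a \<Rightarrow> real ^ 'n)"

abbreviation cdom :: "('a, 'n::finite) chart \<Rightarrow> 'a set"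
  where "cdom c \<equiv> fst c"

abbreviation coord :: "('a, 'n::finite) chart \<Rightarrow> 'a \<Rightarrow> real ^ 'n"
  where "coord c \<equiv> snd c"

definition cimg :: "('a, 'n::finite) chart \<Rightarrow> (real ^ 'n) set"
  where "cimg c = coord c ` cdom c"

definition param :: "('a, 'n::finite) chart \<Rightarrow> real ^ 'n \<Rightarrow> 'a"
  where "param c = inv_into (cdom c) (coord c)"

definition manifold_chart :: "'a topology \<Rightarrow> ('a, 'n::{finite,one}) chart \<Rightarrow> bool"
  where "manifold_chart T c \<longleftrightarrow>
    openin T (cdom c) \<and> openin (top_of_set half_space) (cimg c) \<and>
    homeomorphic_map (subtopology T (cdom c)) (top_of_set (cimg c)) (coord c)"

text \<open>The atlas need not be maximal: all notions below are independent of the choice of an atlas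
  of the smooth structure.\<close>

definition smooth_manifold :: "'a topology \<Rightarrow> ('a, 'n::{finite,one}) chart set \<Rightarrow> bool"
  where "smooth_manifold T A \<longleftrightarrow>
    Hausdorff_space T \<and> second_countable T \<and>
    (\<forall>c\<in>A. manifold_chart T c) \<and> (\<Union>c\<in>A. cdom c) = topspace T \<and>
    (\<forall>c\<in>A. \<forall>c'\<in>A. smooth_on (coord c ` (cdom c \<inter> cdom c')) (coord c' \<circ> param c))"

definition mboundary :: "('a, 'n::{finite,one}) chart set \<Rightarrow> 'a set"
  where "mboundary A = {p. \<exists>c\<in>A. p \<in> cdom c \<and> coord c p $ 1 = 0}"

definition chart_at :: "('a, 'n::finite) chart set \<Rightarrow> 'a \<Rightarrow> ('a, 'n) chart"
  where "chart_at A p = (SOME c. c \<in> A \<and> p \<in> cdom c)"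

definition smooth_fun :: "('a, 'n::finite) chart set \<Rightarrow> ('a \<Rightarrow> real) \<Rightarrow> bool"
  where "smooth_fun A u \<longleftrightarrow> (\<forall>c\<in>A. smooth_on (cimg c) (u \<circ> param c))"

text \<open>A tangent vector at \<open>p\<close> is given by its components in the charts around \<open>p\<close>;
  \<open>change_vec c c' p\<close> turns components in \<open>c\<close> into components in \<open>c'\<close>.\<close>

definition change_vec ::
    "('a, 'n::finite) chart \<Rightarrow> ('a, 'n) chart \<Rightarrow> 'a \<Rightarrow> real ^ 'n \<Rightarrow> real ^ 'n"
  where "change_vec c c' p =
    frechet_derivative (coord c' \<circ> param c) (at (coord c p) within coord c ` (cdom c \<inter> cdom c'))"

text \<open>A Riemannian metric assigns to each chart \<open>c\<close> its matrix of components \<open>G c\<close>, as a function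
  of the coordinates.\<close>

definition riemannian_metric ::
    "('a, 'n::finite) chart set \<Rightarrow> (('a, 'n) chart \<Rightarrow> real ^ 'n \<Rightarrow> real ^ 'n ^ 'n) \<Rightarrow> bool"
  where "riemannian_metric A G \<longleftrightarrow>
    (\<forall>c\<in>A. smooth_on (cimg c) (G c)) \<and>
    (\<forall>c\<in>A. \<forall>x\<in>cimg c. transpose (G c x) = G c x \<and> (\<forall>v. v \<noteq> 0 \<longrightarrow> metric_prod (G c x) v v > 0)) \<and>
    (\<forall>c\<in>A. \<forall>c'\<in>A. \<forall>p\<in>cdom c \<inter> cdom c'. \<forall>v w.
       metric_prod (G c (coord c p)) v w
       = metric_prod (G c' (coord c' p)) (change_vec c c' p v) (change_vec c c' p w))"

definition riemannian_manifold ::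
    "'a topology \<Rightarrow> ('a, 'n::{finite,one}) chart set \<Rightarrow> (('a, 'n) chart \<Rightarrow> (real, 'n) vec \<Rightarrow> ((real, 'n) vec, 'n) vec) \<Rightarrow> bool"
  where "riemannian_manifold T A G \<longleftrightarrow> smooth_manifold T A \<and> riemannian_metric A G"


section \<open>Static vacuum spaces\<close>

text \<open>The energy density is \<open>\<mu> = R / 2\<close> and the pressure is \<open>\<rho> = - \<mu>\<close>, that is,
  \<open>R = - 2 * \<rho>\<close>.\<close>

definition static_vacuum_space ::
    "'a topology \<Rightarrow> ('a, 3) chart set \<Rightarrow> (('a, 3) chart \<Rightarrow> real ^ 3 \<Rightarrow> real ^ 3 ^ 3) \<Rightarrow> ('a \<Rightarrow> real) \<Rightarrow> real \<Rightarrow> bool"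
  where "static_vacuum_space T A G f \<rho> \<longleftrightarrow>
    riemannian_manifold T A G \<and> smooth_fun A f \<and> (\<forall>p\<in>topspace T. f p > 0) \<and>
    (\<exists>R. R \<noteq> 0 \<and> \<rho> = - R / 2 \<and>
      (\<forall>c\<in>A. \<forall>x\<in>cimg c.
         scalar_curv (cimg c) (G c) x = R \<and>
         (\<forall>i j. f (param c x) * ricci (cimg c) (G c) i j x
            = hessian (cimg c) (G c) (f \<circ> param c) i j x + R / 2 * f (param c x) * G c x $ i $ j) \<and>
         laplacian (cimg c) (G c) (f \<circ> param c) x + R / 2 * f (param c x) = 0))"

definition harmonic_curvature ::
    "('a, 'n::finite) chart set \<Rightarrow> (('a, 'n) chart \<Rightarrow> real ^ 'n \<Rightarrow> real ^ 'n ^ 'n) \<Rightarrow> bool"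
  where "harmonic_curvature A G \<longleftrightarrow>
    (\<forall>c\<in>A. \<forall>x\<in>cimg c. \<forall>j k l. div_riem (cimg c) (G c) j k l x = 0)"

definition minus_unit_grad ::
    "(('a, 'n::finite) chart \<Rightarrow> real ^ 'n \<Rightarrow> real ^ 'n ^ 'n) \<Rightarrow> ('a \<Rightarrow> real) \<Rightarrow> ('a, 'n) chart \<Rightarrow> real ^ 'n \<Rightarrow> real ^ 'n"
  where "minus_unit_grad G f c x =
    (let v = grad (cimg c) (G c) (f \<circ> param c) x in - (1 / sqrt (metric_prod (G c x) v v)) *\<^sub>R v)"

text \<open>The boundary is the level set of the regular value \<open>c\<close>, and the unit normal
  \<open>- \<nabla>f / |\<nabla>f|\<close> of it points outward.\<close>

definition level_boundary ::
    "'a topology \<Rightarrow> ('a, 3) chart set \<Rightarrow> (('a, 3) chart \<Rightarrow> real ^ 3 \<Rightarrow> real ^ 3 ^ 3) \<Rightarrow> ('a \<Rightarrow> real) \<Rightarrow> real \<Rightarrow> bool"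
  where "level_boundary T A G f c \<longleftrightarrow>
    mboundary A = {p \<in> topspace T. f p = c} \<and>
    (\<forall>a\<in>A. \<forall>p\<in>cdom a. f p = c \<longrightarrow>
       grad (cimg a) (G a) (f \<circ> param a) (coord a p) \<noteq> 0 \<and>
       minus_unit_grad G f a (coord a p) $ 1 < 0)"

text \<open>\<open>II(W, W) = \<langle>\<nabla>\<^sub>W X, W\<rangle>\<close>, where \<open>X = - \<nabla>f / |\<nabla>f|\<close>.\<close>

definition boundary_II ::
    "(('a, 3) chart \<Rightarrow> real ^ 3 \<Rightarrow> real ^ 3 ^ 3) \<Rightarrow> ('a \<Rightarrow> real) \<Rightarrow> ('a, 3) chart \<Rightarrow> real ^ 3 \<Rightarrow> real ^ 3 \<Rightarrow> real"
  where "boundary_II G f c x w =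
    metric_prod (G c x) (cov_deriv (cimg c) (G c) w (minus_unit_grad G f c) x) w"


section \<open>Immersed surfaces\<close>

text \<open>The surface is an abstract 2-manifold with an atlas \<open>B\<close> and an immersion \<open>F\<close>. In a chart \<open>b\<close>
  of the surface and a chart \<open>c\<close> of the ambient manifold, \<open>F\<close> becomes \<open>loc_map F b c\<close> on
  \<open>loc_dom F b c\<close>.\<close>

definition loc_dom :: "('b \<Rightarrow> 'a) \<Rightarrow> ('b, 2) chart \<Rightarrow> ('a, 3) chart \<Rightarrow> (real ^ 2) set"
  where "loc_dom F b c = coord b ` {q \<in> cdom b. F q \<in> cdom c}"

definition loc_map :: "('b \<Rightarrow> 'a) \<Rightarrow> ('b, 2) chart \<Rightarrow> ('a, 3) chart \<Rightarrow> real ^ 2 \<Rightarrow> real ^ 3"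
  where "loc_map F b c = coord c \<circ> F \<circ> param b"

definition push :: "('b \<Rightarrow> 'a) \<Rightarrow> ('b, 2) chart \<Rightarrow> ('a, 3) chart \<Rightarrow> real ^ 2 \<Rightarrow> real ^ 2 \<Rightarrow> real ^ 3"
  where "push F b c y = frechet_derivative (loc_map F b c) (at y within loc_dom F b c)"

definition immersion ::
    "'b topology \<Rightarrow> ('b, 2) chart set \<Rightarrow> 'a topology \<Rightarrow> ('a, 3) chart set \<Rightarrow> ('b \<Rightarrow> 'a) \<Rightarrow> bool"
  where "immersion TS B T A F \<longleftrightarrow>
    continuous_map TS T F \<and>
    (\<forall>b\<in>B. \<forall>c\<in>A. smooth_on (loc_dom F b c) (loc_map F b c) \<and>
       (\<forall>y\<in>loc_dom F b c. inj (push F b c y)))"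

definition induced_metric ::
    "('a, 3) chart set \<Rightarrow> (('a, 3) chart \<Rightarrow> real ^ 3 \<Rightarrow> real ^ 3 ^ 3) \<Rightarrow> ('b \<Rightarrow> 'a)
      \<Rightarrow> ('b, 2) chart \<Rightarrow> real ^ 2 \<Rightarrow> real ^ 2 ^ 2"
  where "induced_metric A G F b y =
    (let c = chart_at A (F (param b y)) in
      \<chi> i j. metric_prod (G c (loc_map F b c y)) (push F b c y (axis i 1)) (push F b c y (axis j 1)))"

definition unit_normal_field ::
    "'b topology \<Rightarrow> ('b, 2) chart set \<Rightarrow> ('a, 3) chart set \<Rightarrow> (('a, 3) chart \<Rightarrow> real ^ 3 \<Rightarrow> real ^ 3 ^ 3)
      \<Rightarrow> ('b \<Rightarrow> 'a) \<Rightarrow> (('a, 3) chart \<Rightarrow> 'b \<Rightarrow> real ^ 3) \<Rightarrow> bool"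
  where "unit_normal_field TS B A G F N \<longleftrightarrow>
    (\<forall>c\<in>A. \<forall>c'\<in>A. \<forall>q\<in>topspace TS. F q \<in> cdom c \<inter> cdom c' \<longrightarrow>
       N c' q = change_vec c c' (F q) (N c q)) \<and>
    (\<forall>b\<in>B. \<forall>c\<in>A. smooth_on (loc_dom F b c) (N c \<circ> param b) \<and>
       (\<forall>y\<in>loc_dom F b c.
          metric_prod (G c (loc_map F b c y)) (N c (param b y)) (N c (param b y)) = 1 \<and>
          (\<forall>v. metric_prod (G c (loc_map F b c y)) (push F b c y v) (N c (param b y)) = 0)))"

text \<open>\<open>A(\<partial>\<^sub>i, \<partial>\<^sub>j) = \<langle>\<nabla>\<^sub>i \<partial>\<^sub>j F, N\<rangle>\<close> at the point with coordinates \<open>y\<close> in the chart \<open>b\<close>,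
  with \<open>\<nabla>\<close> the connection along \<open>F\<close>.\<close>

definition second_ff ::
    "('a, 3) chart set \<Rightarrow> (('a, 3) chart \<Rightarrow> real ^ 3 \<Rightarrow> real ^ 3 ^ 3) \<Rightarrow> ('b \<Rightarrow> 'a)
      \<Rightarrow> (('a, 3) chart \<Rightarrow> 'b \<Rightarrow> real ^ 3) \<Rightarrow> ('b, 2) chart \<Rightarrow> 2 \<Rightarrow> 2 \<Rightarrow> real ^ 2 \<Rightarrow> real"
  where "second_ff A G F N b i j y =
    (let c = chart_at A (F (param b y)); D = loc_dom F b c; u = loc_map F b c in
      metric_prod (G c (u y))
        (pd D i (pd D j u) y +
          (\<chi> k. \<Sum>m\<in>UNIV. \<Sum>n\<in>UNIV.
             christoffel (cimg c) (G c) k m n (u y) * pd D i u y $ m * pd D j u y $ n))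
        (N c (param b y)))"

definition minimal ::
    "('b, 2) chart set \<Rightarrow> ('a, 3) chart set \<Rightarrow> (('a, 3) chart \<Rightarrow> real ^ 3 \<Rightarrow> real ^ 3 ^ 3) \<Rightarrow> ('b \<Rightarrow> 'a)
      \<Rightarrow> (('a, 3) chart \<Rightarrow> 'b \<Rightarrow> real ^ 3) \<Rightarrow> bool"
  where "minimal B A G F N \<longleftrightarrow>
    (\<forall>b\<in>B. \<forall>y\<in>cimg b.
       (\<Sum>i\<in>UNIV. \<Sum>j\<in>UNIV. matrix_inv (induced_metric A G F b y) $ i $ j * second_ff A G F N b i j y) = 0)"

definition positive_gauss_curvature ::
    "('b, 2) chart set \<Rightarrow> ('a, 3) chart set \<Rightarrow> (('a, 3) chart \<Rightarrow> real ^ 3 \<Rightarrow> real ^ 3 ^ 3) \<Rightarrow> ('b \<Rightarrow> 'a) \<Rightarrow> bool"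
  where "positive_gauss_curvature B A G F \<longleftrightarrow>
    (\<forall>b\<in>B. \<forall>y\<in>cimg b. gauss_curv (cimg b) (induced_metric A G F b) y > 0)"

definition norm2_second_ff ::
    "('b, 2) chart set \<Rightarrow> ('a, 3) chart set \<Rightarrow> (('a, 3) chart \<Rightarrow> real ^ 3 \<Rightarrow> real ^ 3 ^ 3) \<Rightarrow> ('b \<Rightarrow> 'a)
      \<Rightarrow> (('a, 3) chart \<Rightarrow> 'b \<Rightarrow> real ^ 3) \<Rightarrow> 'b \<Rightarrow> real"
  where "norm2_second_ff B A G F N q =
    (let b = chart_at B q; y = coord b q; h = matrix_inv (induced_metric A G F b y) in
      \<Sum>i\<in>UNIV. \<Sum>j\<in>UNIV. \<Sum>k\<in>UNIV. \<Sum>l\<in>UNIV.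
        h $ i $ k * h $ j $ l * second_ff A G F N b i j y * second_ff A G F N b k l y)"

definition ricci_normal ::
    "('a, 3) chart set \<Rightarrow> (('a, 3) chart \<Rightarrow> real ^ 3 \<Rightarrow> real ^ 3 ^ 3) \<Rightarrow> ('b \<Rightarrow> 'a)
      \<Rightarrow> (('a, 3) chart \<Rightarrow> 'b \<Rightarrow> real ^ 3) \<Rightarrow> 'b \<Rightarrow> real"
  where "ricci_normal A G F N q =
    (let c = chart_at A (F q) in
      \<Sum>i\<in>UNIV. \<Sum>j\<in>UNIV. ricci (cimg c) (G c) i j (coord c (F q)) * N c q $ i * N c q $ j)"

definition II_normal ::
    "('a, 3) chart set \<Rightarrow> (('a, 3) chart \<Rightarrow> real ^ 3 \<Rightarrow> real ^ 3 ^ 3) \<Rightarrow> ('a \<Rightarrow> real) \<Rightarrow> ('b \<Rightarrow> 'a)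
      \<Rightarrow> (('a, 3) chart \<Rightarrow> 'b \<Rightarrow> real ^ 3) \<Rightarrow> 'b \<Rightarrow> real"
  where "II_normal A G f F N q =
    (let c = chart_at A (F q) in boundary_II G f c (coord c (F q)) (N c q))"

definition surface_laplacian ::
    "('b, 2) chart set \<Rightarrow> ('a, 3) chart set \<Rightarrow> (('a, 3) chart \<Rightarrow> real ^ 3 \<Rightarrow> real ^ 3 ^ 3) \<Rightarrow> ('b \<Rightarrow> 'a)
      \<Rightarrow> ('b \<Rightarrow> real) \<Rightarrow> 'b \<Rightarrow> real"
  where "surface_laplacian B A G F \<phi> q =
    (let b = chart_at B q in
      laplacian (cimg b) (induced_metric A G F b) (\<phi> \<circ> param b) (coord b q))"

text \<open>Components of the outward unit conormal at a boundary point, where \<open>h\<close> is the matrix of the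
  metric at this point in a chart with values in the half-space.\<close>

definition outward_conormal :: "real ^ 2 ^ 2 \<Rightarrow> real ^ 2"
  where "outward_conormal h =
    (THE v. metric_prod h v v = 1 \<and> (\<forall>w. w $ 1 = 0 \<longrightarrow> metric_prod h v w = 0) \<and> v $ 1 < 0)"

definition conormal_deriv ::
    "('b, 2) chart set \<Rightarrow> ('a, 3) chart set \<Rightarrow> (('a, 3) chart \<Rightarrow> real ^ 3 \<Rightarrow> real ^ 3 ^ 3) \<Rightarrow> ('b \<Rightarrow> 'a)
      \<Rightarrow> ('b \<Rightarrow> real) \<Rightarrow> 'b \<Rightarrow> real"
  where "conormal_deriv B A G F \<phi> q =
    (let b = chart_at B q; y = coord b q in
      frechet_derivative (\<phi> \<circ> param b) (at y within cimg b) (outward_conormal (induced_metric A G F b y)))"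

text \<open>The boundary of a free boundary surface is nonempty by convention. Closed surfaces have to be
  excluded here: the metric \<open>dt\<^sup>2 + g\<^bsub>S\<^sup>2\<^esub>\<close> with \<open>f = sin t\<close> is a static vacuum space with harmonic
  curvature, and its slices of constant \<open>t\<close> are stable closed totally geodesic spheres.\<close>

definition free_boundary ::
    "'b topology \<Rightarrow> ('b, 2) chart set \<Rightarrow> ('a, 3) chart set \<Rightarrow> (('a, 3) chart \<Rightarrow> real ^ 3 \<Rightarrow> real ^ 3 ^ 3)
      \<Rightarrow> ('a \<Rightarrow> real) \<Rightarrow> ('b \<Rightarrow> 'a) \<Rightarrow> bool"
  where "free_boundary TS B A G f F \<longleftrightarrow>
    mboundary B \<noteq> {} \<and>
    (\<forall>q\<in>topspace TS. F q \<in> mboundary A \<longleftrightarrow> q \<in> mboundary B) \<and>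
    (\<forall>b\<in>B. \<forall>c\<in>A. \<forall>q\<in>cdom b \<inter> mboundary B. F q \<in> cdom c \<longrightarrow>
       push F b c (coord b q) (outward_conormal (induced_metric A G F b (coord b q)))
       = minus_unit_grad G f c (coord c (F q)))"


section \<open>Stability\<close>

text \<open>The area measure on the Borel sets of the surface and the length measure on the Borel sets of
  its boundary. By the change of variables formula they exist and are uniquely determined.\<close>

definition area_measure ::
    "'b topology \<Rightarrow> ('b, 2) chart set \<Rightarrow> (('b, 2) chart \<Rightarrow> real ^ 2 \<Rightarrow> real ^ 2 ^ 2) \<Rightarrow> 'b measure \<Rightarrow> bool"
  where "area_measure TS B H \<sigma> \<longleftrightarrow>
    space \<sigma> = topspace TS \<and> sets \<sigma> = sigma_sets (topspace TS) {U. openin TS U} \<and>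
    (\<forall>b\<in>B. \<forall>E\<in>sets \<sigma>. E \<subseteq> cdom b \<longrightarrow>
       emeasure \<sigma> E = (\<integral>\<^sup>+ y. ennreal (sqrt (det (H b y))) * indicator (coord b ` E) y \<partial>lborel))"

definition boundary_length_measure ::
    "'b topology \<Rightarrow> ('b, 2) chart set \<Rightarrow> (('b, 2) chart \<Rightarrow> real ^ 2 \<Rightarrow> real ^ 2 ^ 2) \<Rightarrow> 'b measure \<Rightarrow> bool"
  where "boundary_length_measure TS B H \<tau> \<longleftrightarrow>
    space \<tau> = mboundary B \<and> sets \<tau> = sigma_sets (mboundary B) {U \<inter> mboundary B |U. openin TS U} \<and>
    (\<forall>b\<in>B. \<forall>E\<in>sets \<tau>. E \<subseteq> cdom b \<longrightarrow>
       emeasure \<tau> E = (\<integral>\<^sup>+ s. ennreal (sqrt (H b (vector [0, s]) $ 2 $ 2))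
                              * indicator (coord b ` E) (vector [0, s]) \<partial>lborel))"

definition stable ::
    "('b, 2) chart set \<Rightarrow> ('a, 3) chart set \<Rightarrow> (('a, 3) chart \<Rightarrow> real ^ 3 \<Rightarrow> real ^ 3 ^ 3) \<Rightarrow> ('a \<Rightarrow> real)
      \<Rightarrow> ('b \<Rightarrow> 'a) \<Rightarrow> (('a, 3) chart \<Rightarrow> 'b \<Rightarrow> real ^ 3) \<Rightarrow> 'b measure \<Rightarrow> 'b measure \<Rightarrow> bool"
  where "stable B A G f F N \<sigma> \<tau> \<longleftrightarrow>
    (\<forall>\<phi>. smooth_fun B \<phi> \<longrightarrow>
      - (\<integral>q. \<phi> q * (surface_laplacian B A G F \<phi> q
                   + (ricci_normal A G F N q + norm2_second_ff B A G F N q) * \<phi> q) \<partial>\<sigma>)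
      + (\<integral>q. \<phi> q * (conormal_deriv B A G F \<phi> q - II_normal A G f F N q * \<phi> q) \<partial>\<tau>) \<ge> 0)"

end

theory Submission
  imports Defs
begin

text \<open>The stability inequality is tested with \<open>\<phi> = f \<circ> F\<close>. Tracing the static equation over a minimal
  surface gives \<open>\<Delta>\<^sub>\<Sigma> f = - f Ric(N, N)\<close>, so that the interior term of the inequality is
  \<open>- \<integral> f\<^sup>2 |A|\<^sup>2\<close>. On the boundary the conormal is \<open>- \<nabla>f / |\<nabla>f|\<close>, hence \<open>\<partial>f/\<partial>\<nu> = - |\<nabla>f|\<close> and
  \<open>II(N, N) = - \<nabla>\<^sup>2f(N, N) / |\<nabla>f|\<close>, where the static equation and the Gauss equation give
  \<open>\<nabla>\<^sup>2f(N, N) = f (Ric(N, N) - R/2) = - f (K + |A|\<^sup>2/2)\<close>. So the boundary integrand is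
  \<open>- f (|\<nabla>f| + f\<^sup>2 (K + |A|\<^sup>2/2) / |\<nabla>f|)\<close>, which is negative for \<open>K > 0\<close>.\<close>


section \<open>Calculus on half-spaces\<close>

text \<open>The test function is dictated by the static equation: on a minimal surface f lies in the
  kernel of the Laplacian plus Ric(N, N), so that R cancels in the interior term. The strict
  inequality comes from the boundary alone, and this shapes the measure theory. A Bochner integral
  of a non-integrable function is 0, so the sign of the boundary integrand decides nothing until it
  is known to be integrable and the boundary to have finite, positive length. For the interior a
  non-negative integrand is enough. The other obstacle is that the geometric quantities are
  coordinate formulas in charts which \<open>chart_at\<close> selects anew at each point. For the
  algebra they become multilinear functions of vectors at a single point; for differentiation and
  continuity they have to be moved to a fixed chart. Charts take values in a half-space, so every
  derivative must also make sense at boundary points, where smoothness means the existence of a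
  local extension.\<close>

lemma Ck_on_cong:
  assumes "open U" "Ck_on k U u" "\<And>x. x \<in> U \<Longrightarrow> u x = v x"
  shows "Ck_on k U v"
  using assms(2,3)
proof (induction k arbitrary: u v)
  case 0
  then show ?case using continuous_on_cong by fastforce
next
  case (Suc k)
  have d: "u differentiable (at x)" if "x \<in> U" for x
    using Suc.prems(1) that by simp
  have eq: "frechet_derivative u (at x) = frechet_derivative v (at x)" if "x \<in> U" for x
    using frechet_derivative_transform_within_open[OF d[OF that] assms(1) that] Suc.prems(2) by blast
  have "v differentiable (at x)" if "x \<in> U" for x
    using d[OF that] Suc.prems(2) assms(1) that
    by (meson differentiable_def has_derivative_transform_within_open)
  moreover have "Ck_on k U (\<lambda>x. frechet_derivative v (at x) (axis i 1))" for i
    by (rule Suc.IH[of "\<lambda>x. frechet_derivative u (at x) (axis i 1)"]) (use Suc.prems(1) eq in auto)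
  ultimately show ?case by simp
qed

lemma Ck_on_subset:
  assumes "Ck_on k U u" "V \<subseteq> U"
  shows "Ck_on k V u"
  using assms(1)
proof (induction k arbitrary: u)
  case 0
  then show ?case using assms(2) continuous_on_subset by auto
qed (use assms(2) in auto)

lemma Ck_on_SucD: "Ck_on (Suc k) U u \<Longrightarrow> Ck_on k U u"
proof (induction k arbitrary: u)
  case 0
  then show ?case
    by (simp add: continuous_at_imp_continuous_on differentiable_imp_continuous_within)
next
  case (Suc k)
  then have "u differentiable (at x)" if "x \<in> U" for x using that by simp
  moreover have "Ck_on (Suc k) U (\<lambda>x. frechet_derivative u (at x) (axis i 1))" for i
    using Suc.prems Ck_on.simps(2) by blast
  ultimately show ?case using Suc.IH Ck_on.simps(2) by blast
qed

text \<open>The inductions below produce derivatives as explicit formulas. Such a formula is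
  \<open>frechet_derivative\<close> by uniqueness, and on the open set \<open>U\<close> the property
  \<open>Ck_on\<close> passes from one function to the other.\<close>

lemma Ck_on_SucI:
  assumes "open U" "\<And>x. x \<in> U \<Longrightarrow> (u has_derivative u' x) (at x)"
    "\<And>i. Ck_on k U (\<lambda>x. u' x (axis i 1))"
  shows "Ck_on (Suc k) U u"
proof -
  have "frechet_derivative u (at x) = u' x" if "x \<in> U" for x
    using assms(2)[OF that] frechet_derivative_at by metis
  then have "Ck_on k U (\<lambda>x. frechet_derivative u (at x) (axis i 1))" for i
    by (intro Ck_on_cong[OF assms(1) assms(3)[of i]]) auto
  then show ?thesis using assms(2) by (auto simp: differentiable_def)
qed

lemma Ck_on_has_derivative:
  "Ck_on (Suc k) U u \<Longrightarrow> x \<in> U \<Longrightarrow> (u has_derivative frechet_derivative u (at x)) (at x)"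
  using frechet_derivative_works by auto

lemma Ck_on_add:
  assumes "open U" "Ck_on k U u" "Ck_on k U v"
  shows "Ck_on k U (\<lambda>x. u x + v x)"
  using assms(2,3)
proof (induction k arbitrary: u v)
  case 0
  then show ?case by (simp add: continuous_on_add)
next
  case (Suc k)
  show ?case
  proof (rule Ck_on_SucI[OF assms(1)])
    show "((\<lambda>x. u x + v x) has_derivative
        (\<lambda>h. frechet_derivative u (at x) h + frechet_derivative v (at x) h)) (at x)" if "x \<in> U" for x
      by (intro has_derivative_add Ck_on_has_derivative[OF Suc.prems(1) that]
          Ck_on_has_derivative[OF Suc.prems(2) that])
    show "Ck_on k U (\<lambda>x. frechet_derivative u (at x) (axis i 1) + frechet_derivative v (at x) (axis i 1))" for i
      using Suc by (intro Suc.IH) auto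
  qed
qed

lemma Ck_on_const: "open U \<Longrightarrow> Ck_on k U (\<lambda>x. c)"
proof (induction k arbitrary: c)
  case (Suc k)
  then show ?case by simp
qed simp

lemma Ck_on_sum:
  assumes "open U" "finite I" "\<And>i. i \<in> I \<Longrightarrow> Ck_on k U (u i)"
  shows "Ck_on k U (\<lambda>x. \<Sum>i\<in>I. u i x)"
  using assms(2,3)
proof (induction I)
  case empty
  show ?case using Ck_on_const[OF assms(1), of k 0] by simp
next
  case (insert i I)
  then have "Ck_on k U (\<lambda>x. u i x + (\<Sum>i\<in>I. u i x))" by (intro Ck_on_add[OF assms(1)]) auto
  then show ?case using insert.hyps by simp
qed

text \<open>Induction on \<open>k\<close> with the Leibniz rule: both summands of the derivative are
  again products of \<open>Ck_on k\<close> functions. An arbitrary bounded bilinear map covers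
  scalar multiples, inner products and matrix-vector products at once.\<close>

lemma Ck_on_bilinear:
  assumes "open U" "bounded_bilinear mul" "Ck_on k U u" "Ck_on k U v"
  shows "Ck_on k U (\<lambda>x. mul (u x) (v x))"
  using assms(3,4)
proof (induction k arbitrary: u v)
  case 0
  then show ?case using bounded_bilinear.continuous_on[OF assms(2)] by auto
next
  case (Suc k)
  show ?case
  proof (rule Ck_on_SucI[OF assms(1)])
    show "((\<lambda>x. mul (u x) (v x)) has_derivative
        (\<lambda>h. mul (u x) (frechet_derivative v (at x) h) + mul (frechet_derivative u (at x) h) (v x))) (at x)"
      if "x \<in> U" for x
      by (intro bounded_bilinear.FDERIV[OF assms(2)] Ck_on_has_derivative[OF Suc.prems(1) that]
          Ck_on_has_derivative[OF Suc.prems(2) that])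
    show "Ck_on k U (\<lambda>x. mul (u x) (frechet_derivative v (at x) (axis i 1))
        + mul (frechet_derivative u (at x) (axis i 1)) (v x))" for i
      using Suc.prems Ck_on_SucD[OF Suc.prems(1)] Ck_on_SucD[OF Suc.prems(2)]
      by (intro Ck_on_add[OF assms(1)] Suc.IH) auto
  qed
qed

lemma Ck_on_linear:
  assumes "open U" "bounded_linear T" "Ck_on k U u"
  shows "Ck_on k U (\<lambda>x. T (u x))"
  using assms(3)
proof (induction k arbitrary: u)
  case 0
  then show ?case using bounded_linear.continuous_on[OF assms(2)] by auto
next
  case (Suc k)
  show ?case
  proof (rule Ck_on_SucI[OF assms(1)])
    show "((\<lambda>x. T (u x)) has_derivative (\<lambda>h. T (frechet_derivative u (at x) h))) (at x)"
      if "x \<in> U" for x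
      by (intro bounded_linear.has_derivative[OF assms(2)] Ck_on_has_derivative[OF Suc.prems that])
    show "Ck_on k U (\<lambda>x. T (frechet_derivative u (at x) (axis i 1)))" for i
      using Suc.prems by (intro Suc.IH) auto
  qed
qed

lemma linear_axis_sum:
  fixes T :: "real ^ 'n \<Rightarrow> 'b::real_vector"
  assumes "linear T"
  shows "T v = (\<Sum>i\<in>UNIV. v $ i *\<^sub>R T (axis i 1))"
proof -
  have "T v = T (\<Sum>i\<in>UNIV. v $ i *\<^sub>R axis i 1)"
    using basis_expansion[of v] by (simp add: scalar_mult_eq_scaleR)
  then show ?thesis using assms by (simp add: linear_sum linear_scale)
qed

text \<open>Expanded over the coordinate axes, the chain rule gives a sum of products of first
  partials of \<open>u\<close> with first partials of \<open>v\<close> taken at \<open>u x\<close>.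
  The induction hypothesis, general in \<open>v\<close>, handles the latter.\<close>

lemma Ck_on_compose:
  fixes u :: "real ^ 'n \<Rightarrow> real ^ 'm"
  assumes "open U" "open V" "u ` U \<subseteq> V" "Ck_on k U u" "Ck_on k V v"
  shows "Ck_on k U (\<lambda>x. v (u x))"
  using assms(4,5)
proof (induction k arbitrary: v)
  case 0
  then show ?case using assms(3) continuous_on_compose2 by auto
next
  case (Suc k)
  let ?u' = "\<lambda>x. frechet_derivative u (at x)"
  let ?v' = "\<lambda>x. frechet_derivative v (at x)"
  show ?case
  proof (rule Ck_on_SucI[OF assms(1)])
    fix x assume x: "x \<in> U"
    have u: "(u has_derivative ?u' x) (at x)"
      by (rule Ck_on_has_derivative[OF Suc.prems(1) x])
    have v: "(v has_derivative ?v' (u x)) (at (u x))"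
      by (rule Ck_on_has_derivative[OF Suc.prems(2)]) (use x assms(3) in auto)
    have "linear (?v' (u x))" using v has_derivative_linear by blast
    then have "(\<lambda>h. ?v' (u x) (?u' x h)) = (\<lambda>h. \<Sum>j\<in>UNIV. ?u' x h $ j *\<^sub>R ?v' (u x) (axis j 1))"
      by (intro ext linear_axis_sum)
    moreover have "((\<lambda>x. v (u x)) has_derivative (\<lambda>h. ?v' (u x) (?u' x h))) (at x)"
      using diff_chain_at[OF u v] unfolding o_def .
    ultimately show "((\<lambda>x. v (u x)) has_derivative (\<lambda>h. \<Sum>j\<in>UNIV. ?u' x h $ j *\<^sub>R ?v' (u x) (axis j 1))) (at x)"
      by simp
  next
    fix i
    have "Ck_on k U (\<lambda>x. ?u' x (axis i 1) $ j)" for j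
      by (rule Ck_on_linear[OF assms(1) bounded_linear_vec_nth]) (use Suc.prems(1) in auto)
    moreover have "Ck_on k U (\<lambda>x. ?v' (u x) (axis j 1))" for j
      by (rule Suc.IH[of "\<lambda>y. ?v' y (axis j 1)"]) (use Suc.prems Ck_on_SucD in auto)
    ultimately show "Ck_on k U (\<lambda>x. \<Sum>j\<in>UNIV. ?u' x (axis i 1) $ j *\<^sub>R ?v' (u x) (axis j 1))"
      by (intro Ck_on_sum[OF assms(1)] Ck_on_bilinear[OF assms(1) bounded_bilinear_scaleR]) auto
  qed
qed

lemma smooth_onE:
  assumes "smooth_on S u" "x \<in> S"
  obtains U u' where "open U" "x \<in> U" "\<And>k. Ck_on k U u'" "\<And>y. y \<in> U \<inter> S \<Longrightarrow> u' y = u y"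
proof -
  have "\<exists>U u'. open U \<and> x \<in> U \<and> (\<forall>k. Ck_on k U u') \<and> (\<forall>y\<in>U \<inter> S. u' y = u y)"
    using assms unfolding smooth_on_def by (rule bspec)
  then show ?thesis using that by metis
qed

lemma smooth_onI:
  assumes "\<And>x. x \<in> S \<Longrightarrow> \<exists>U u'. open U \<and> x \<in> U \<and> (\<forall>k. Ck_on k U u') \<and> (\<forall>y\<in>U \<inter> S. u' y = u y)"
  shows "smooth_on S u"
  using assms unfolding smooth_on_def by (rule ballI)

lemma smooth_extensionI:
  assumes "open U" "x \<in> U" "\<And>k. Ck_on k U u'" "\<And>y. y \<in> U \<Longrightarrow> y \<in> S \<Longrightarrow> u' y = u y"
  shows "\<exists>U u'. open U \<and> x \<in> U \<and> (\<forall>k. Ck_on k U u') \<and> (\<forall>y\<in>U \<inter> S. u' y = u y)"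
  by (rule exI[of _ U], rule exI[of _ u']) (simp add: assms)

lemma smooth_on_cong:
  assumes "smooth_on S u" "\<And>x. x \<in> S \<Longrightarrow> u x = v x"
  shows "smooth_on S v"
proof (rule smooth_onI)
  fix x assume x: "x \<in> S"
  obtain U u' where U: "open U" "x \<in> U" "\<And>k. Ck_on k U u'" "\<And>y. y \<in> U \<inter> S \<Longrightarrow> u' y = u y"
    using smooth_onE[OF assms(1) x] by metis
  show "\<exists>U u'. open U \<and> x \<in> U \<and> (\<forall>k. Ck_on k U u') \<and> (\<forall>y\<in>U \<inter> S. u' y = v y)"
    by (rule smooth_extensionI[OF U(1-3)]) (use U(4) assms(2) in auto)
qed

lemma smooth_on_local:
  assumes "\<And>x. x \<in> S \<Longrightarrow> \<exists>U. open U \<and> x \<in> U \<and> smooth_on (S \<inter> U) u"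
  shows "smooth_on S u"
proof (rule smooth_onI)
  fix x assume x: "x \<in> S"
  then obtain U where U: "open U" "x \<in> U" "smooth_on (S \<inter> U) u" using assms by metis
  then have "x \<in> S \<inter> U" using x by simp
  then obtain V u' where V: "open V" "x \<in> V" "\<And>k. Ck_on k V u'" "\<And>y. y \<in> V \<inter> (S \<inter> U) \<Longrightarrow> u' y = u y"
    using smooth_onE[OF U(3)] by metis
  show "\<exists>U u'. open U \<and> x \<in> U \<and> (\<forall>k. Ck_on k U u') \<and> (\<forall>y\<in>U \<inter> S. u' y = u y)"
    by (rule smooth_extensionI[of "V \<inter> U" _ u']) (use U V Ck_on_subset[OF V(3)] in auto)
qed

lemma smooth_on_const: "smooth_on S (\<lambda>x. c)"
  by (rule smooth_onI, rule smooth_extensionI[of UNIV _ "\<lambda>x. c"]) (auto intro: Ck_on_const)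

lemma smooth_on_linear:
  assumes "bounded_linear T" "smooth_on S u"
  shows "smooth_on S (\<lambda>x. T (u x))"
proof (rule smooth_onI)
  fix x assume x: "x \<in> S"
  obtain U u' where U: "open U" "x \<in> U" "\<And>k. Ck_on k U u'" "\<And>y. y \<in> U \<inter> S \<Longrightarrow> u' y = u y"
    using smooth_onE[OF assms(2) x] by metis
  show "\<exists>U u'. open U \<and> x \<in> U \<and> (\<forall>k. Ck_on k U u') \<and> (\<forall>y\<in>U \<inter> S. u' y = T (u y))"
    by (rule smooth_extensionI[OF U(1,2) Ck_on_linear[OF U(1) assms(1) U(3)]]) (use U(4) in auto)
qed

lemma smooth_on_bilinear:
  assumes "bounded_bilinear mul" "smooth_on S u" "smooth_on S v"
  shows "smooth_on S (\<lambda>x. mul (u x) (v x))"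
proof (rule smooth_onI)
  fix x assume x: "x \<in> S"
  obtain U u' where U: "open U" "x \<in> U" "\<And>k. Ck_on k U u'" "\<And>y. y \<in> U \<inter> S \<Longrightarrow> u' y = u y"
    using smooth_onE[OF assms(2) x] by metis
  obtain V v' where V: "open V" "x \<in> V" "\<And>k. Ck_on k V v'" "\<And>y. y \<in> V \<inter> S \<Longrightarrow> v' y = v y"
    using smooth_onE[OF assms(3) x] by metis
  have "Ck_on k (U \<inter> V) (\<lambda>x. mul (u' x) (v' x))" for k
    by (rule Ck_on_bilinear[OF open_Int[OF U(1) V(1)] assms(1) Ck_on_subset[OF U(3)] Ck_on_subset[OF V(3)]]) auto
  from smooth_extensionI[OF open_Int[OF U(1) V(1)] _ this]
  show "\<exists>U u'. open U \<and> x \<in> U \<and> (\<forall>k. Ck_on k U u') \<and> (\<forall>y\<in>U \<inter> S. u' y = mul (u y) (v y))"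
    using U(2,4) V(2,4) by simp
qed

lemma smooth_on_add:
  assumes "smooth_on S u" "smooth_on S v"
  shows "smooth_on S (\<lambda>x. u x + v x)"
proof (rule smooth_onI)
  fix x assume x: "x \<in> S"
  obtain U u' where U: "open U" "x \<in> U" "\<And>k. Ck_on k U u'" "\<And>y. y \<in> U \<inter> S \<Longrightarrow> u' y = u y"
    using smooth_onE[OF assms(1) x] by metis
  obtain V v' where V: "open V" "x \<in> V" "\<And>k. Ck_on k V v'" "\<And>y. y \<in> V \<inter> S \<Longrightarrow> v' y = v y"
    using smooth_onE[OF assms(2) x] by metis
  have "Ck_on k (U \<inter> V) (\<lambda>x. u' x + v' x)" for k
    by (rule Ck_on_add[OF open_Int[OF U(1) V(1)] Ck_on_subset[OF U(3)] Ck_on_subset[OF V(3)]]) auto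
  from smooth_extensionI[OF open_Int[OF U(1) V(1)] _ this]
  show "\<exists>U u'. open U \<and> x \<in> U \<and> (\<forall>k. Ck_on k U u') \<and> (\<forall>y\<in>U \<inter> S. u' y = u y + v y)"
    using U(2,4) V(2,4) by simp
qed

lemma smooth_on_sum:
  assumes "finite I" "\<And>i. i \<in> I \<Longrightarrow> smooth_on S (u i)"
  shows "smooth_on S (\<lambda>x. \<Sum>i\<in>I. u i x)"
  using assms
proof (induction I)
  case empty
  show ?case using smooth_on_const[of S 0] by simp
next
  case (insert i I)
  then have "smooth_on S (\<lambda>x. u i x + (\<Sum>i\<in>I. u i x))" by (intro smooth_on_add) auto
  then show ?case using insert.hyps by simp
qed

lemma smooth_on_compose:
  fixes u :: "real ^ 'n \<Rightarrow> real ^ 'm"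
  assumes "smooth_on S u" "smooth_on S' v" "u ` S \<subseteq> S'"
  shows "smooth_on S (\<lambda>x. v (u x))"
proof (rule smooth_onI)
  fix x assume x: "x \<in> S"
  obtain U u' where U: "open U" "x \<in> U" "\<And>k. Ck_on k U u'" "\<And>y. y \<in> U \<inter> S \<Longrightarrow> u' y = u y"
    using smooth_onE[OF assms(1) x] by metis
  have "u x \<in> S'" using x assms(3) by auto
  then obtain V v' where
    V: "open V" "u x \<in> V" "\<And>k. Ck_on k V v'" "\<And>y. y \<in> V \<inter> S' \<Longrightarrow> v' y = v y"
    using smooth_onE[OF assms(2)] by metis
  let ?W = "U \<inter> u' -` V"
  have "continuous_on U u'" using U(3)[of 0] by simp
  then have W: "open ?W" using U(1) V(1) by (rule continuous_open_preimage)
  have C: "Ck_on k ?W (\<lambda>x. v' (u' x))" for k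
    by (rule Ck_on_compose[OF W V(1) _ Ck_on_subset[OF U(3)] V(3)]) auto
  have x': "x \<in> ?W" using U(2) U(4)[of x] V(2) x by simp
  have eq: "v' (u' y) = v (u y)" if "y \<in> ?W" "y \<in> S" for y
  proof -
    have "u' y = u y" "u' y \<in> V" "u y \<in> S'" using that U(4)[of y] assms(3) by auto
    then show ?thesis using V(4)[of "u y"] by simp
  qed
  show "\<exists>U u'. open U \<and> x \<in> U \<and> (\<forall>k. Ck_on k U u') \<and> (\<forall>y\<in>U \<inter> S. u' y = v (u y))"
    by (rule smooth_extensionI[OF W x' C eq])
qed

text \<open>A vector is the sum of its components placed on the axes, so the rules for sums and
  linear maps suffice. Components in an arbitrary Euclidean space let the rule be applied twice to a
  matrix-valued function.\<close>

lemma smooth_on_vec: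
  fixes u :: "real ^ 'n \<Rightarrow> 'b::euclidean_space ^ 'm"
  assumes "\<And>i. smooth_on S (\<lambda>x. u x $ i)"
  shows "smooth_on S u"
proof -
  have "linear (axis i :: 'b \<Rightarrow> 'b ^ 'm)" for i
    by (rule linearI) (simp_all add: axis_def vec_eq_iff)
  then have ax: "bounded_linear (axis i :: 'b \<Rightarrow> 'b ^ 'm)" for i
    by (rule linear_conv_bounded_linear[THEN iffD1])
  have "smooth_on S (\<lambda>x. \<Sum>i\<in>UNIV. (axis i (u x $ i)))"
    by (rule smooth_on_sum[OF finite smooth_on_linear[OF ax assms]])
  moreover have "(\<Sum>i\<in>UNIV. (axis i (u x $ i))) = u x" for x
    by (simp add: vec_eq_iff axis_def sum.delta)
  ultimately show ?thesis by (rule smooth_on_cong)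
qed


text \<open>The directional form of \<open>pd\<close>. A vector in place of an index lets tensors be
  treated as multilinear functions, into which a tangent vector \<open>dd D u v y\<close> of the
  surface can be inserted directly.\<close>

definition dd :: "(real ^ 'n) set \<Rightarrow> (real ^ 'n \<Rightarrow> 'b::real_normed_vector) \<Rightarrow> real ^ 'n \<Rightarrow> real ^ 'n \<Rightarrow> 'b"
  where "dd S u v x = frechet_derivative u (at x within S) v"

lemma pd_dd: "pd S i u = dd S u (axis i 1)"
  by (intro ext) (simp add: pd_def dd_def)

text \<open>Adding a small positive multiple of a coordinate axis never leaves the half-space, not
  even at boundary points, and the values on the axes determine a linear map.\<close>

lemma half_space_derivative_unique:
  fixes u :: "real ^ 'n::{finite,one} \<Rightarrow> 'b::real_normed_vector"
  assumes "openin (top_of_set half_space) S" "x \<in> S"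
    "(u has_derivative D) (at x within S)" "(u has_derivative D') (at x within S)"
  shows "D = D'"
proof (rule frechet_derivative_unique_within[OF assms(3,4)])
  fix i :: "(real, 'n) vec" and e :: real
  assume i: "i \<in> Basis" and e: "e > 0"
  obtain O' where O: "open O'" "S = half_space \<inter> O'" using assms(1) openin_open by blast
  then obtain d where d: "d > 0" "ball x d \<subseteq> O'" using assms(2) openE by blast
  obtain j where j: "i = axis j 1" using i by (auto simp: Basis_vec_def)
  let ?t = "min d e / 2"
  have "x + ?t *\<^sub>R i \<in> ball x d" using i d e by (auto simp: dist_norm)
  moreover have "x + ?t *\<^sub>R i \<in> half_space"
    using assms(2) O d e by (auto simp: half_space_def j axis_def)
  ultimately have "x + ?t *\<^sub>R i \<in> S" using d O by auto
  then show "\<exists>t. 0 < \<bar>t\<bar> \<and> \<bar>t\<bar> < e \<and> x + t *\<^sub>R i \<in> S" using d e by (intro exI[of _ ?t]) auto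
qed

lemma dd_eqI:
  fixes u :: "real ^ 'n::{finite,one} \<Rightarrow> 'b::real_normed_vector"
  assumes "openin (top_of_set half_space) S" "x \<in> S" "(u has_derivative D) (at x within S)"
  shows "dd S u v x = D v"
proof -
  have "(u has_derivative frechet_derivative u (at x within S)) (at x within S)"
    using assms(3) frechet_derivative_works differentiable_def by blast
  then show ?thesis using half_space_derivative_unique[OF assms(1,2)] assms(3) unfolding dd_def by metis
qed

lemma has_derivative_dd:
  "u differentiable (at x within S) \<Longrightarrow> (u has_derivative (\<lambda>v. dd S u v x)) (at x within S)"
  unfolding dd_def frechet_derivative_works by simp

lemma linear_dd: "u differentiable (at x within S) \<Longrightarrow> linear (\<lambda>v. dd S u v x)"
  using has_derivative_dd has_derivative_linear by blast

lemma dd_pd: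
  "u differentiable (at x within S) \<Longrightarrow> dd S u v x = (\<Sum>i\<in>UNIV. v $ i *\<^sub>R pd S i u x)"
  using linear_axis_sum[OF linear_dd] by (simp add: pd_dd)

lemma dd_cong:
  assumes "open O'" "x \<in> O'" "x \<in> S" "S \<inter> O' = S' \<inter> O'" "\<And>y. y \<in> S \<inter> O' \<Longrightarrow> u y = w y"
  shows "dd S u v x = dd S' w v x"
proof -
  have "at x within S = at x within S'"
    by (rule at_within_nhd[OF assms(2,1)]) (use assms(4) in blast)
  moreover have "(u has_derivative D) (at x within S) \<longleftrightarrow> (w has_derivative D) (at x within S)" for D
  proof -
    obtain e where e: "e > 0" "ball x e \<subseteq> O'" using assms(1,2) openE by blast
    have eq: "u y = w y" if "y \<in> S" "dist y x < e" for y
      using that e assms(5) by (auto simp: dist_commute subset_iff)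
    show ?thesis
      using has_derivative_transform_within[OF _ e(1) assms(3), of u D w]
        has_derivative_transform_within[OF _ e(1) assms(3), of w D u] eq by metis
  qed
  ultimately show ?thesis unfolding dd_def frechet_derivative_def by simp
qed

lemma dd_cong_on: "x \<in> S \<Longrightarrow> (\<And>y. y \<in> S \<Longrightarrow> u y = w y) \<Longrightarrow> dd S u v x = dd S w v x"
  by (rule dd_cong[of UNIV]) auto

text \<open>By uniqueness the derivative within \<open>S\<close> agrees with that of every local
  smooth extension. This reduces facts about derivatives at boundary points to ordinary derivatives
  on an open set.\<close>

lemma smooth_on_dd_extension:
  fixes u :: "real ^ 'n::{finite,one} \<Rightarrow> 'b::real_normed_vector"
  assumes "openin (top_of_set half_space) S" "open U" "Ck_on (Suc k) U u'"
    "\<And>y. y \<in> U \<inter> S \<Longrightarrow> u' y = u y" "y \<in> U \<inter> S"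
  shows "(u has_derivative frechet_derivative u' (at y)) (at y within S)"
    and "dd S u v y = frechet_derivative u' (at y) v"
proof -
  have u': "(u' has_derivative frechet_derivative u' (at y)) (at y within S)"
    using Ck_on_has_derivative[OF assms(3)] assms(5) has_derivative_at_withinI by blast
  obtain e where e: "e > 0" "ball y e \<subseteq> U"
    using openE[OF assms(2)] IntD1[OF assms(5)] by metis
  show 1: "(u has_derivative frechet_derivative u' (at y)) (at y within S)"
    by (rule has_derivative_transform_within[OF u' e(1)])
      (use assms(4,5) e(2) in \<open>auto simp: dist_commute subset_iff\<close>)
  show "dd S u v y = frechet_derivative u' (at y) v"
    by (rule dd_eqI[OF assms(1) IntD2[OF assms(5)] 1])
qed

lemma smooth_on_differentiable:
  fixes u :: "real ^ 'n::{finite,one} \<Rightarrow> 'b::real_normed_vector"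
  assumes "openin (top_of_set half_space) S" "smooth_on S u" "x \<in> S"
  shows "u differentiable (at x within S)"
proof -
  obtain U u' where U: "open U" "x \<in> U" "\<And>k. Ck_on k U u'" "\<And>y. y \<in> U \<inter> S \<Longrightarrow> u' y = u y"
    using smooth_onE[OF assms(2,3)] by metis
  have "x \<in> U \<inter> S" using U assms by auto
  from smooth_on_dd_extension(1)[OF assms(1) U(1) U(3)[of 1, unfolded One_nat_def] U(4) this]
  show ?thesis using differentiable_def by blast
qed

lemma smooth_on_continuous:
  fixes u :: "real ^ 'n::{finite,one} \<Rightarrow> 'b::real_normed_vector"
  assumes "openin (top_of_set half_space) S" "smooth_on S u"
  shows "continuous_on S u"
  using smooth_on_differentiable[OF assms] differentiable_imp_continuous_on
  by (auto simp: differentiable_on_def)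

lemma smooth_on_pd:
  fixes u :: "real ^ 'n::{finite,one} \<Rightarrow> 'b::real_normed_vector"
  assumes "openin (top_of_set half_space) S" "smooth_on S u"
  shows "smooth_on S (pd S i u)"
proof (rule smooth_onI)
  fix x assume x: "x \<in> S"
  obtain U u' where U: "open U" "x \<in> U" "\<And>k. Ck_on k U u'" "\<And>y. y \<in> U \<inter> S \<Longrightarrow> u' y = u y"
    using smooth_onE[OF assms(2) x] by metis
  have 1: "Ck_on k U (\<lambda>x. frechet_derivative u' (at x) (axis i 1))" for k
    using U(3)[of "Suc k"] by simp
  have 2: "frechet_derivative u' (at y) (axis i 1) = pd S i u y" if "y \<in> U" "y \<in> S" for y
    using smooth_on_dd_extension(2)[OF assms(1) U(1) U(3)[of 1, unfolded One_nat_def] U(4)] that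
    by (simp add: pd_dd)
  show "\<exists>U u'. open U \<and> x \<in> U \<and> (\<forall>k. Ck_on k U u') \<and> (\<forall>y\<in>U \<inter> S. u' y = pd S i u y)"
    by (rule smooth_extensionI[OF U(1,2) 1 2])
qed

lemma smooth_on_dd:
  fixes u :: "real ^ 'n::{finite,one} \<Rightarrow> 'b::real_normed_vector"
  assumes "openin (top_of_set half_space) S" "smooth_on S u"
  shows "smooth_on S (dd S u v)"
proof -
  have "smooth_on S (\<lambda>x. \<Sum>i\<in>UNIV. v $ i *\<^sub>R pd S i u x)"
    by (rule smooth_on_sum[OF finite smooth_on_linear[OF bounded_linear_scaleR_right smooth_on_pd[OF assms]]])
  then show ?thesis
    by (rule smooth_on_cong) (simp add: dd_pd smooth_on_differentiable[OF assms])
qed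


section \<open>Symmetry of second derivatives\<close>

lemma second_difference_mean_value:
  fixes u :: "real ^ 'n \<Rightarrow> real"
  assumes U: "open U" "Ck_on 2 U u" and h: "h > 0"
    and box: "\<And>s t. 0 \<le> s \<Longrightarrow> s \<le> h \<Longrightarrow> 0 \<le> t \<Longrightarrow> t \<le> h \<Longrightarrow> x + s *\<^sub>R a + t *\<^sub>R b \<in> U"
    and ab: "a = axis i 1" "b = axis j 1"
  shows "\<exists>s t. 0 \<le> s \<and> s \<le> h \<and> 0 \<le> t \<and> t \<le> h \<and>
    u (x + h *\<^sub>R a + h *\<^sub>R b) - u (x + h *\<^sub>R a) - u (x + h *\<^sub>R b) + u x
    = h * h * frechet_derivative (\<lambda>y. frechet_derivative u (at y) a) (at (x + s *\<^sub>R a + t *\<^sub>R b)) b"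
proof -
  let ?ua = "\<lambda>y. frechet_derivative u (at y) a"
  let ?uab = "\<lambda>y. frechet_derivative ?ua (at y) b"
  have C: "Ck_on (Suc (Suc 0)) U u" using U(2) by (simp add: numeral_2_eq_2)
  have C': "Ck_on (Suc 0) U ?ua" using C ab Ck_on.simps(2) by blast
  have line: "((\<lambda>s. y + s *\<^sub>R v) has_derivative (\<lambda>r. r *\<^sub>R v)) (at s)" for y v :: "real ^ 'n" and s
    by (auto intro!: derivative_eq_intros)
  \<comment> \<open>The second difference is the increment of \<phi> from 0 to \<open>h\<close>. The
    mean value theorem for \<phi>, and once more for the difference of first derivatives that
    results, turns it into a mixed derivative.\<close>
  define \<phi> where "\<phi> s = u (x + h *\<^sub>R b + s *\<^sub>R a) - u (x + s *\<^sub>R a)" for s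
  have du: "((\<lambda>s. u (y + s *\<^sub>R a)) has_real_derivative ?ua (y + s *\<^sub>R a)) (at s)"
    if "y + s *\<^sub>R a \<in> U" for y s
  proof -
    note d = Ck_on_has_derivative[OF C that]
    from diff_chain_at[OF line[of y a s] d]
    have "((\<lambda>s. u (y + s *\<^sub>R a)) has_derivative (\<lambda>r. frechet_derivative u (at (y + s *\<^sub>R a)) (r *\<^sub>R a))) (at s)"
      by (simp add: o_def)
    moreover have "(\<lambda>r. frechet_derivative u (at (y + s *\<^sub>R a)) (r *\<^sub>R a)) = (*) (?ua (y + s *\<^sub>R a))"
      using linear_scale[OF has_derivative_linear[OF d]] by (auto simp: mult.commute)
    ultimately show ?thesis unfolding has_field_derivative_def by simp
  qed
  have dua: "((\<lambda>t. ?ua (y + t *\<^sub>R b)) has_real_derivative ?uab (y + t *\<^sub>R b)) (at t)"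
    if "y + t *\<^sub>R b \<in> U" for y t
  proof -
    note d = Ck_on_has_derivative[OF C' that]
    from diff_chain_at[OF line[of y b t] d]
    have "((\<lambda>t. ?ua (y + t *\<^sub>R b)) has_derivative (\<lambda>r. frechet_derivative ?ua (at (y + t *\<^sub>R b)) (r *\<^sub>R b))) (at t)"
      by (simp add: o_def)
    moreover have "(\<lambda>r. frechet_derivative ?ua (at (y + t *\<^sub>R b)) (r *\<^sub>R b)) = (*) (?uab (y + t *\<^sub>R b))"
      using linear_scale[OF has_derivative_linear[OF d]] by (auto simp: mult.commute)
    ultimately show ?thesis unfolding has_field_derivative_def by simp
  qed
  have "(\<phi> has_real_derivative ?ua (x + h *\<^sub>R b + s *\<^sub>R a) - ?ua (x + s *\<^sub>R a)) (at s)"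
    if "0 \<le> s" "s \<le> h" for s
    unfolding \<phi>_def using box[OF that, of h] box[OF that, of 0] h
    by (intro DERIV_diff du) (auto simp: algebra_simps)
  from MVT2[OF h this] obtain s where s: "0 < s" "s < h"
    "\<phi> h - \<phi> 0 = h * (?ua (x + h *\<^sub>R b + s *\<^sub>R a) - ?ua (x + s *\<^sub>R a))" by auto
  have "((\<lambda>t. ?ua (x + s *\<^sub>R a + t *\<^sub>R b)) has_real_derivative ?uab (x + s *\<^sub>R a + t *\<^sub>R b)) (at t)"
    if "0 \<le> t" "t \<le> h" for t
    using box[of s t] that s by (intro dua) auto
  from MVT2[OF h this] obtain t where t: "0 < t" "t < h"
    "?ua (x + s *\<^sub>R a + h *\<^sub>R b) - ?ua (x + s *\<^sub>R a) = h * ?uab (x + s *\<^sub>R a + t *\<^sub>R b)" by auto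
  have "u (x + h *\<^sub>R a + h *\<^sub>R b) - u (x + h *\<^sub>R a) - u (x + h *\<^sub>R b) + u x = \<phi> h - \<phi> 0"
    by (simp add: \<phi>_def algebra_simps)
  also have "\<dots> = h * h * ?uab (x + s *\<^sub>R a + t *\<^sub>R b)"
    using s(3) t(3) by (simp add: add_ac)
  finally show ?thesis using s t by (intro exI[of _ s] exI[of _ t]) auto
qed

text \<open>The second difference over a small square is symmetric in the two directions and equals
  the squared side times either mixed derivative at some point of the square. Continuity of both
  lets the square shrink to \<open>x\<close>.\<close>

lemma mixed_partials_commute:
  fixes u :: "real ^ 'n \<Rightarrow> real"
  assumes U: "open U" "Ck_on 2 U u" "x \<in> U"
  shows "frechet_derivative (\<lambda>y. frechet_derivative u (at y) (axis i 1)) (at x) (axis j 1)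
    = frechet_derivative (\<lambda>y. frechet_derivative u (at y) (axis j 1)) (at x) (axis i 1)"
proof -
  let ?a = "axis i 1 :: real ^ 'n" and ?b = "axis j 1 :: real ^ 'n"
  let ?p = "\<lambda>y. frechet_derivative (\<lambda>y. frechet_derivative u (at y) ?a) (at y) ?b"
  let ?q = "\<lambda>y. frechet_derivative (\<lambda>y. frechet_derivative u (at y) ?b) (at y) ?a"
  have "continuous_on U ?p" "continuous_on U ?q"
    using U(2) by (simp_all add: numeral_2_eq_2)
  then have cp: "isCont ?p x" and cq: "isCont ?q x"
    using U continuous_on_eq_continuous_at by blast+
  have "\<bar>?p x - ?q x\<bar> < e" if e: "e > 0" for e
  proof -
    obtain d1 where d1: "d1 > 0" "\<And>y. dist y x < d1 \<Longrightarrow> dist (?p y) (?p x) < e / 2"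
      using cp e unfolding continuous_at_eps_delta by (meson half_gt_zero)
    obtain d2 where d2: "d2 > 0" "\<And>y. dist y x < d2 \<Longrightarrow> dist (?q y) (?q x) < e / 2"
      using cq e unfolding continuous_at_eps_delta by (meson half_gt_zero)
    obtain d3 where d3: "d3 > 0" "ball x d3 \<subseteq> U" using U openE by blast
    \<comment> \<open>A point of the square of side \<open>h\<close> has distance at most 2h from
      \<open>x\<close>; the divisor 3 keeps this strictly below all three radii.\<close>
    define h where "h = min d1 (min d2 d3) / 3"
    have h: "h > 0" using d1 d2 d3 by (simp add: h_def)
    have near: "dist (x + s *\<^sub>R axis k 1 + t *\<^sub>R axis l 1) x < min d1 (min d2 d3)"
      if "0 \<le> s" "s \<le> h" "0 \<le> t" "t \<le> h" for s t and k l :: 'n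
    proof -
      have "norm (s *\<^sub>R axis k 1 + t *\<^sub>R axis l 1 :: real ^ 'n) \<le> s + t"
        using norm_triangle_ineq[of "s *\<^sub>R axis k 1 :: real ^ 'n" "t *\<^sub>R axis l 1"] that
        by (simp add: norm_axis_1)
      also have "\<dots> < min d1 (min d2 d3)" using that h unfolding h_def by linarith
      finally show ?thesis by (simp add: dist_norm add.assoc)
    qed
    have box: "x + s *\<^sub>R axis k 1 + t *\<^sub>R axis l 1 \<in> U"
      if "0 \<le> s" "s \<le> h" "0 \<le> t" "t \<le> h" for s t and k l :: 'n
      using near[OF that, of k l] d3 by (auto simp: dist_commute subset_iff)
    obtain s t where st: "0 \<le> s" "s \<le> h" "0 \<le> t" "t \<le> h"
      "u (x + h *\<^sub>R ?a + h *\<^sub>R ?b) - u (x + h *\<^sub>R ?a) - u (x + h *\<^sub>R ?b) + u x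
        = h * h * ?p (x + s *\<^sub>R ?a + t *\<^sub>R ?b)"
      using second_difference_mean_value[OF U(1,2) h box refl refl, of i j] by blast
    obtain s' t' where st': "0 \<le> s'" "s' \<le> h" "0 \<le> t'" "t' \<le> h"
      "u (x + h *\<^sub>R ?b + h *\<^sub>R ?a) - u (x + h *\<^sub>R ?b) - u (x + h *\<^sub>R ?a) + u x
        = h * h * ?q (x + s' *\<^sub>R ?b + t' *\<^sub>R ?a)"
      using second_difference_mean_value[OF U(1,2) h box refl refl, of j i] by blast
    have "h * h * ?p (x + s *\<^sub>R ?a + t *\<^sub>R ?b) = h * h * ?q (x + s' *\<^sub>R ?b + t' *\<^sub>R ?a)"
      using st(5) st'(5) by (simp add: algebra_simps)
    then have "?p (x + s *\<^sub>R ?a + t *\<^sub>R ?b) = ?q (x + s' *\<^sub>R ?b + t' *\<^sub>R ?a)" using h by simp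
    moreover have "dist (?p (x + s *\<^sub>R ?a + t *\<^sub>R ?b)) (?p x) < e / 2"
      using near[OF st(1-4)] by (intro d1) simp
    moreover have "dist (?q (x + s' *\<^sub>R ?b + t' *\<^sub>R ?a)) (?q x) < e / 2"
      using near[OF st'(1-4)] by (intro d2) simp
    ultimately show ?thesis unfolding dist_real_def by linarith
  qed
  then have "\<bar>?p x - ?q x\<bar> \<le> 0" by (meson field_le_epsilon add_pos_pos less_eq_real_def not_le)
  then show ?thesis by simp
qed

lemma dd_linear_image:
  fixes u :: "real ^ 'n::{finite,one} \<Rightarrow> 'b::real_normed_vector"
  assumes "openin (top_of_set half_space) S" "x \<in> S" "u differentiable (at x within S)" "bounded_linear T"
  shows "dd S (\<lambda>y. T (u y)) v x = T (dd S u v x)"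
  by (rule dd_eqI[OF assms(1,2) bounded_linear.has_derivative[OF assms(4) has_derivative_dd[OF assms(3)]]])

lemma pd_commute_real:
  fixes u :: "real ^ 'n::{finite,one} \<Rightarrow> real"
  assumes "openin (top_of_set half_space) S" "smooth_on S u" "x \<in> S"
  shows "pd S j (pd S i u) x = pd S i (pd S j u) x"
proof -
  obtain U u' where U: "open U" "x \<in> U" "\<And>k. Ck_on k U u'" "\<And>y. y \<in> U \<inter> S \<Longrightarrow> u' y = u y"
    using smooth_onE[OF assms(2,3)] by metis
  have 1: "frechet_derivative u' (at y) (axis i 1) = pd S i u y" if "y \<in> U \<inter> S" for y i
    using smooth_on_dd_extension(2)[OF assms(1) U(1) U(3)[of 1, unfolded One_nat_def] U(4) that]
    by (simp add: pd_dd)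
  have C: "Ck_on (Suc 0) U (\<lambda>x. frechet_derivative u' (at x) (axis i 1))" for i
    using U(3)[of "Suc (Suc 0)"] Ck_on.simps(2) by metis
  have xU: "x \<in> U \<inter> S" using U(2) assms(3) by simp
  have "pd S j (pd S i u) x = frechet_derivative (\<lambda>x. frechet_derivative u' (at x) (axis i 1)) (at x) (axis j 1)"
    for i j
    unfolding pd_dd[of S j] by (rule smooth_on_dd_extension(2)[OF assms(1) U(1) C 1 xU])
  then show ?thesis using mixed_partials_commute[OF U(1) U(3) U(2)] by simp
qed

lemma pd_commute:
  fixes u :: "real ^ 'n::{finite,one} \<Rightarrow> 'b::euclidean_space"
  assumes "openin (top_of_set half_space) S" "smooth_on S u" "x \<in> S"
  shows "pd S j (pd S i u) x = pd S i (pd S j u) x"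
proof (rule euclidean_eqI)
  fix b :: 'b
  note L = bounded_linear_inner_left[of b]
  have 1: "pd S i (\<lambda>y. u y \<bullet> b) y = pd S i u y \<bullet> b" if "y \<in> S" for y i
    unfolding pd_dd by (rule dd_linear_image[OF assms(1) that smooth_on_differentiable[OF assms(1,2) that] L])
  have 2: "pd S j (pd S i u) x \<bullet> b = pd S j (pd S i (\<lambda>y. u y \<bullet> b)) x" for i j
  proof -
    have "pd S j (pd S i (\<lambda>y. u y \<bullet> b)) x = pd S j (\<lambda>y. pd S i u y \<bullet> b) x"
      unfolding pd_dd[of S j] by (rule dd_cong_on[OF assms(3)]) (rule 1)
    also have "\<dots> = pd S j (pd S i u) x \<bullet> b"
      unfolding pd_dd[of S j]
      by (rule dd_linear_image[OF assms(1,3) smooth_on_differentiable[OF assms(1) smooth_on_pd[OF assms(1,2)] assms(3)] L])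
    finally show ?thesis ..
  qed
  show "pd S j (pd S i u) x \<bullet> b = pd S i (pd S j u) x \<bullet> b"
    unfolding 2 by (rule pd_commute_real[OF assms(1) smooth_on_linear[OF L assms(2)] assms(3)])
qed

lemma dd_dd_pd:
  fixes u :: "real ^ 'n::{finite,one} \<Rightarrow> 'b::euclidean_space"
  assumes S: "openin (top_of_set half_space) S" and u: "smooth_on S u" and x: "x \<in> S"
  shows "dd S (dd S u v) w x = (\<Sum>j\<in>UNIV. \<Sum>i\<in>UNIV. (w $ j * v $ i) *\<^sub>R pd S j (pd S i u) x)"
proof -
  have "dd S (dd S u v) w x = dd S (\<lambda>y. \<Sum>i\<in>UNIV. v $ i *\<^sub>R pd S i u y) w x"
    by (rule dd_cong_on[OF x]) (rule dd_pd[OF smooth_on_differentiable[OF S u]])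
  also have "\<dots> = (\<Sum>i\<in>UNIV. v $ i *\<^sub>R dd S (pd S i u) w x)"
    by (rule dd_eqI[OF S x])
      (intro has_derivative_sum has_derivative_scaleR_right has_derivative_dd
        smooth_on_differentiable[OF S _ x] smooth_on_pd S u)
  also have "\<dots> = (\<Sum>i\<in>UNIV. \<Sum>j\<in>UNIV. (w $ j * v $ i) *\<^sub>R pd S j (pd S i u) x)"
    using dd_pd[OF smooth_on_differentiable[OF S smooth_on_pd[OF S u] x]]
    by (simp add: scaleR_sum_right mult.commute)
  also have "\<dots> = (\<Sum>j\<in>UNIV. \<Sum>i\<in>UNIV. (w $ j * v $ i) *\<^sub>R pd S j (pd S i u) x)"
    by (rule sum.swap)
  finally show ?thesis .
qed

lemma dd_commute:
  fixes u :: "real ^ 'n::{finite,one} \<Rightarrow> 'b::euclidean_space"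
  assumes "openin (top_of_set half_space) S" "smooth_on S u" "x \<in> S"
  shows "dd S (dd S u v) w x = dd S (dd S u w) v x"
proof -
  have eq: "(w $ j * v $ i) *\<^sub>R pd S j (pd S i u) x = (v $ i * w $ j) *\<^sub>R pd S i (pd S j u) x" for i j
    by (simp only: pd_commute[OF assms, of j i] mult.commute)
  have "(\<Sum>j\<in>UNIV. \<Sum>i\<in>UNIV. (w $ j * v $ i) *\<^sub>R pd S j (pd S i u) x)
    = (\<Sum>i\<in>UNIV. \<Sum>j\<in>UNIV. (w $ j * v $ i) *\<^sub>R pd S j (pd S i u) x)"
    by (rule sum.swap)
  then show ?thesis unfolding dd_dd_pd[OF assms] eq .
qed

lemma dd_chain:
  fixes u :: "real ^ 'n::{finite,one} \<Rightarrow> real ^ 'm"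
  assumes S: "openin (top_of_set half_space) S" "y \<in> S" and u: "u differentiable (at y within S)"
    and w: "w differentiable (at (u y) within S')" and sub: "u ` S \<subseteq> S'"
  shows "dd S (\<lambda>z. w (u z)) v y = dd S' w (dd S u v y) (u y)"
    and "((\<lambda>z. w (u z)) has_derivative (\<lambda>v. dd S' w (dd S u v y) (u y))) (at y within S)"
proof -
  have "(w has_derivative (\<lambda>v. dd S' w v (u y))) (at (u y) within u ` S)"
    using has_derivative_dd[OF w] sub has_derivative_subset by blast
  from diff_chain_within[OF has_derivative_dd[OF u] this]
  show *: "((\<lambda>z. w (u z)) has_derivative (\<lambda>v. dd S' w (dd S u v y) (u y))) (at y within S)"
    unfolding o_def .
  show "dd S (\<lambda>z. w (u z)) v y = dd S' w (dd S u v y) (u y)"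
    by (rule dd_eqI[OF S *])
qed


section \<open>Riemannian metrics on coordinate domains\<close>

lemma metric_prod_sum: "metric_prod h v w = (\<Sum>i\<in>UNIV. \<Sum>j\<in>UNIV. h $ i $ j * v $ i * w $ j)"
  by (simp add: metric_prod_def inner_vec_def matrix_vector_mult_def sum_distrib_left mult_ac)

lemma metric_prod_axis [simp]: "metric_prod h (axis i 1) (axis j 1) = h $ i $ j"
  by (simp add: metric_prod_def matrix_vector_mult_basis column_def inner_axis')

lemma metric_prod_simps:
  "metric_prod (h + h') v w = metric_prod h v w + metric_prod h' v w"
  "metric_prod (h - h') v w = metric_prod h v w - metric_prod h' v w"
  "metric_prod (r *\<^sub>R h) v w = r * metric_prod h v w"
  "metric_prod 0 v w = 0"
  "metric_prod h (v + v') w = metric_prod h v w + metric_prod h v' w"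
  "metric_prod h (v - v') w = metric_prod h v w - metric_prod h v' w"
  "metric_prod h (r *\<^sub>R v) w = r * metric_prod h v w"
  "metric_prod h (- v) w = - metric_prod h v w"
  "metric_prod h 0 w = 0"
  "metric_prod h v (w + w') = metric_prod h v w + metric_prod h v w'"
  "metric_prod h v (w - w') = metric_prod h v w - metric_prod h v w'"
  "metric_prod h v (r *\<^sub>R w) = r * metric_prod h v w"
  "metric_prod h v (- w) = - metric_prod h v w"
  "metric_prod h v 0 = 0"
  by (simp_all add: metric_prod_sum sum.distrib sum_subtractf sum_distrib_left sum_negf algebra_simps)

lemma metric_prod_sym:
  assumes "transpose h = h"
  shows "metric_prod h v w = metric_prod h w v"
proof -
  have "h $ i $ j = h $ j $ i" for i j using assms by (metis transpose_def vec_lambda_beta)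
  then show ?thesis
    unfolding metric_prod_sum by (subst sum.swap) (simp add: mult_ac)
qed

lemma linear_metric_prod:
  "linear (\<lambda>h. metric_prod h v w)" "linear (\<lambda>v. metric_prod h v w)" "linear (\<lambda>w. metric_prod h v w)"
  by (auto intro!: linearI simp: metric_prod_simps)

lemma bounded_bilinear_matrix_vector_mult:
  "bounded_bilinear (\<lambda>(h :: real ^ 'n ^ 'm) v. h *v v)"
  by (rule bilinear_conv_bounded_bilinear[THEN iffD1])
    (auto intro!: linearI simp: bilinear_def matrix_vector_mult_def vec_eq_iff sum.distrib sum_distrib_left algebra_simps)

lemma has_derivative_metric_prod:
  assumes "(M has_derivative M') (at y within S)" "(V has_derivative V') (at y within S)"
    "(W has_derivative W') (at y within S)"
  shows "((\<lambda>z. metric_prod (M z) (V z) (W z)) has_derivative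
    (\<lambda>v. metric_prod (M' v) (V y) (W y) + metric_prod (M y) (V' v) (W y) + metric_prod (M y) (V y) (W' v)))
    (at y within S)"
proof -
  have "((\<lambda>z. V z \<bullet> (M z *v W z)) has_derivative
     (\<lambda>v. V y \<bullet> (M y *v W' v + M' v *v W y) + V' v \<bullet> (M y *v W y))) (at y within S)"
    by (rule has_derivative_inner[OF assms(2)
      bounded_bilinear.FDERIV[OF bounded_bilinear_matrix_vector_mult assms(1) assms(3)]])
  then show ?thesis by (simp add: metric_prod_def inner_add_right add_ac)
qed

lemma smooth_on_metric_prod:
  "smooth_on S M \<Longrightarrow> smooth_on S V \<Longrightarrow> smooth_on S W \<Longrightarrow> smooth_on S (\<lambda>z. metric_prod (M z) (V z) (W z))"
  unfolding metric_prod_def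
  by (rule smooth_on_bilinear[OF bounded_bilinear_inner _
        smooth_on_bilinear[OF bounded_bilinear_matrix_vector_mult]])

lemma bilinear_sum_sum:
  fixes \<beta> :: "real ^ 'n \<Rightarrow> real ^ 'm \<Rightarrow> 'b::real_vector"
  assumes "\<And>w. linear (\<lambda>v. \<beta> v w)" "\<And>v. linear (\<beta> v)"
  shows "\<beta> v w = (\<Sum>i\<in>UNIV. \<Sum>j\<in>UNIV. (v $ i * w $ j) *\<^sub>R \<beta> (axis i 1) (axis j 1))"
proof -
  have "\<beta> v w = (\<Sum>i\<in>UNIV. v $ i *\<^sub>R \<beta> (axis i 1) w)"
    by (rule linear_axis_sum[OF assms(1)])
  moreover have "\<beta> (axis i 1) w = (\<Sum>j\<in>UNIV. w $ j *\<^sub>R \<beta> (axis i 1) (axis j 1))" for i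
    by (rule linear_axis_sum[OF assms(2)])
  ultimately show ?thesis by (simp add: scaleR_sum_right)
qed

section \<open>Inverses of positive definite matrices\<close>

lemma matrix_inv_posdef:
  fixes h :: "real ^ 'n ^ 'n"
  assumes "\<And>v. v \<noteq> 0 \<Longrightarrow> metric_prod h v v > 0"
  shows "h ** matrix_inv h = mat 1" "matrix_inv h ** h = mat 1" "det h \<noteq> 0"
proof -
  have "v = 0" if "h *v v = 0" for v
    using assms[of v] that by (force simp: metric_prod_def)
  then have inv: "invertible h"
    unfolding invertible_left_inverse matrix_left_invertible_ker by blast
  then show "det h \<noteq> 0" by (simp add: invertible_det_nz)
  have "h ** matrix_inv h = mat 1 \<and> matrix_inv h ** h = mat 1"
    using inv unfolding invertible_def matrix_inv_def by (rule someI_ex)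
  then show "h ** matrix_inv h = mat 1" "matrix_inv h ** h = mat 1" by auto
qed

text \<open>\<open>matrix_inv\<close> is defined by a choice, which says nothing about its
  dependence on \<open>h\<close>. Cramer's rule makes the entries rational functions of those of
  \<open>h\<close>; both differentiability and the explicit inverse in dimension 2 are read off from
  it.\<close>

lemma matrix_inv_cramer:
  fixes h :: "real ^ 'n ^ 'n"
  assumes "\<And>v. v \<noteq> 0 \<Longrightarrow> metric_prod h v v > 0"
  shows "matrix_inv h $ k $ j = det (\<chi> i l. if l = k then axis j 1 $ i else h $ i $ l) / det h"
proof -
  note inv = matrix_inv_posdef[OF assms]
  have "h *v (matrix_inv h *v axis j 1) = axis j 1"
    by (simp add: matrix_vector_mul_assoc inv)
  then have "matrix_inv h *v axis j 1
    = (\<chi> k. det (\<chi> i l. if l = k then axis j 1 $ i else h $ i $ l) / det h)"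
    using cramer[OF inv(3)] by blast
  moreover have "matrix_inv h $ k $ j = (matrix_inv h *v axis j 1) $ k"
    by (simp add: matrix_vector_mult_basis column_def)
  ultimately show ?thesis by simp
qed

lemma differentiable_det:
  fixes M :: "'a::real_normed_vector \<Rightarrow> real ^ 'n ^ 'n"
  assumes "\<And>i j. (\<lambda>y. M y $ i $ j) differentiable (at x within S)"
  shows "(\<lambda>y. det (M y)) differentiable (at x within S)"
proof -
  obtain D where D: "\<And>i j. ((\<lambda>y. M y $ i $ j) has_derivative D i j) (at x within S)"
    using assms unfolding differentiable_def by metis
  have "(\<lambda>y. \<Prod>i\<in>UNIV. M y $ i $ p i) differentiable (at x within S)" for p
    using has_derivative_prod[of UNIV "\<lambda>i y. M y $ i $ p i", OF D] unfolding differentiable_def by blast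
  then show ?thesis unfolding det_def by (intro differentiable_sum differentiable_mult) auto
qed

lemma differentiable_matrix_inv:
  fixes g :: "real ^ 'n \<Rightarrow> real ^ 'n ^ 'n"
  assumes g: "g differentiable (at x within S)" and x: "x \<in> S"
    and pos: "\<And>y v. y \<in> S \<Longrightarrow> v \<noteq> 0 \<Longrightarrow> metric_prod (g y) v v > 0"
  shows "(\<lambda>y. matrix_inv (g y) $ k $ j) differentiable (at x within S)"
proof -
  have gij: "(\<lambda>y. g y $ i $ l) differentiable (at x within S)" for i l
  proof -
    obtain D where "(g has_derivative D) (at x within S)" using g differentiable_def by blast
    from bounded_linear.has_derivative[OF bounded_linear_vec_nth
        bounded_linear.has_derivative[OF bounded_linear_vec_nth this]]
    show ?thesis using differentiable_def by blast
  qed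
  have "(\<lambda>y. det (\<chi> i l. if l = k then axis j 1 $ i else g y $ i $ l)) differentiable (at x within S)"
  proof (rule differentiable_det)
    show "(\<lambda>y. (\<chi> i l. if l = k then axis j 1 $ i else g y $ i $ l) $ i $ l) differentiable (at x within S)" for i l
      by (cases "l = k") (simp_all add: gij)
  qed
  moreover have "(\<lambda>y. det (g y)) differentiable (at x within S)"
    by (rule differentiable_det) (rule gij)
  ultimately have "(\<lambda>y. det (\<chi> i l. if l = k then axis j 1 $ i else g y $ i $ l) / det (g y)) differentiable (at x within S)"
    by (rule differentiable_divide) (use matrix_inv_posdef(3)[OF pos[OF x]] in simp)
  then obtain D where D: "((\<lambda>y. det (\<chi> i l. if l = k then axis j 1 $ i else g y $ i $ l) / det (g y)) has_derivative D) (at x within S)"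
    unfolding differentiable_def by blast
  have eq: "matrix_inv (g y) $ k $ j = det (\<chi> i l. if l = k then axis j 1 $ i else g y $ i $ l) / det (g y)"
    if "y \<in> S" for y
    by (rule matrix_inv_cramer) (rule pos[OF that])
  have "((\<lambda>y. matrix_inv (g y) $ k $ j) has_derivative D) (at x within S)"
    by (rule has_derivative_transform[OF x eq D])
  then show ?thesis unfolding differentiable_def by blast
qed


text \<open>Serves three times: for a chart of the ambient manifold, for a patch of the surface
  mapped into a single ambient chart, and for a whole chart of the surface.\<close>

locale metric_domain =
  fixes S :: "(real ^ 'n::{finite,one}) set" and g :: "(real, 'n) vec \<Rightarrow> ((real, 'n) vec, 'n) vec"
  assumes S: "openin (top_of_set half_space) S"
    and smooth_g: "smooth_on S g"
    and sym_g: "x \<in> S \<Longrightarrow> transpose (g x) = g x"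
    and pos_g: "x \<in> S \<Longrightarrow> v \<noteq> 0 \<Longrightarrow> metric_prod (g x) v v > 0"
begin

text \<open>The first argument is the base point. \<open>L\<close> and \<open>Gam\<close> are the Christoffel symbols of the first and of
  the second kind as multilinear functions, \<open>DL x v\<close> is the derivative of \<open>L\<close> in the direction \<open>v\<close>. The
  curvature tensor is written in terms of \<open>DL\<close>, so that no derivative of the inverse metric occurs.\<close>

definition L :: "(real, 'n) vec \<Rightarrow> (real, 'n) vec \<Rightarrow> (real, 'n) vec \<Rightarrow> (real, 'n) vec \<Rightarrow> real" where
  "L x a b c = (metric_prod (dd S g b x) c a + metric_prod (dd S g c x) b a - metric_prod (dd S g a x) b c) / 2"

definition Gam :: "(real, 'n) vec \<Rightarrow> (real, 'n) vec \<Rightarrow> (real, 'n) vec \<Rightarrow> (real, 'n) vec" where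
  "Gam x b c = matrix_inv (g x) *v (\<chi> l. L x (axis l 1) b c)"

definition DL :: "(real, 'n) vec \<Rightarrow> (real, 'n) vec \<Rightarrow> (real, 'n) vec \<Rightarrow> (real, 'n) vec \<Rightarrow> (real, 'n) vec \<Rightarrow> real" where
  "DL x v a b c = (metric_prod (dd S (dd S g b) v x) c a + metric_prod (dd S (dd S g c) v x) b a
     - metric_prod (dd S (dd S g a) v x) b c) / 2"

definition Rm :: "(real, 'n) vec \<Rightarrow> (real, 'n) vec \<Rightarrow> (real, 'n) vec \<Rightarrow> (real, 'n) vec \<Rightarrow> (real, 'n) vec \<Rightarrow> real" where
  "Rm x a b c d = DL x a d b c - DL x b d a c
     - metric_prod (g x) (Gam x a d) (Gam x b c) + metric_prod (g x) (Gam x b d) (Gam x a c)"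

definition tr :: "(real, 'n) vec \<Rightarrow> ((real, 'n) vec \<Rightarrow> (real, 'n) vec \<Rightarrow> real) \<Rightarrow> real" where
  "tr x \<beta> = (\<Sum>i\<in>UNIV. \<Sum>j\<in>UNIV. matrix_inv (g x) $ i $ j * \<beta> (axis i 1) (axis j 1))"

definition Ric :: "(real, 'n) vec \<Rightarrow> (real, 'n) vec \<Rightarrow> (real, 'n) vec \<Rightarrow> real" where
  "Ric x b c = tr x (\<lambda>a d. Rm x a b c d)"

text \<open>This is a(b u) - (nabla_a b) u, where \<open>a\<close> and \<open>b\<close> are extended
  to constant coordinate fields.\<close>

definition Hs :: "((real, 'n) vec \<Rightarrow> real) \<Rightarrow> (real, 'n) vec \<Rightarrow> (real, 'n) vec \<Rightarrow> (real, 'n) vec \<Rightarrow> real" where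
  "Hs u x a b = dd S (dd S u b) a x - dd S u (Gam x a b) x"

lemma diff_g: "x \<in> S \<Longrightarrow> g differentiable (at x within S)"
  by (rule smooth_on_differentiable[OF S smooth_g])

lemma diff_dg: "x \<in> S \<Longrightarrow> dd S g v differentiable (at x within S)"
  by (rule smooth_on_differentiable[OF S smooth_on_dd[OF S smooth_g]])

lemma g_inv: "x \<in> S \<Longrightarrow> g x ** matrix_inv (g x) = mat 1" "x \<in> S \<Longrightarrow> matrix_inv (g x) ** g x = mat 1"
  using matrix_inv_posdef[OF pos_g] by auto

lemma ip_sym: "x \<in> S \<Longrightarrow> metric_prod (g x) v w = metric_prod (g x) w v"
  by (rule metric_prod_sym[OF sym_g])

lemma dg_sym:
  assumes "x \<in> S"
  shows "metric_prod (dd S g b x) v w = metric_prod (dd S g b x) w v"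
proof -
  have 1: "dd S (\<lambda>y. metric_prod (g y) v w) b x = metric_prod (dd S g b x) v w" for v w
    by (rule dd_linear_image[OF S assms diff_g[OF assms]
          linear_conv_bounded_linear[THEN iffD1, OF linear_metric_prod(1)]])
  have "dd S (\<lambda>y. metric_prod (g y) v w) b x = dd S (\<lambda>y. metric_prod (g y) w v) b x"
    by (rule dd_cong_on[OF assms ip_sym])
  then show ?thesis unfolding 1 .
qed

lemma ddg_sym:
  assumes "x \<in> S"
  shows "metric_prod (dd S (dd S g b) a x) v w = metric_prod (dd S (dd S g b) a x) w v"
proof -
  have 1: "dd S (\<lambda>y. metric_prod (dd S g b y) v w) a x = metric_prod (dd S (dd S g b) a x) v w" for v w
    by (rule dd_linear_image[OF S assms diff_dg[OF assms]
          linear_conv_bounded_linear[THEN iffD1, OF linear_metric_prod(1)]])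
  have "dd S (\<lambda>y. metric_prod (dd S g b y) v w) a x = dd S (\<lambda>y. metric_prod (dd S g b y) w v) a x"
    by (rule dd_cong_on[OF assms dg_sym])
  then show ?thesis unfolding 1 .
qed

lemma dd_g_simps:
  assumes "x \<in> S"
  shows "dd S g (v + w) x = dd S g v x + dd S g w x" "dd S g (r *\<^sub>R v) x = r *\<^sub>R dd S g v x"
  using linear_add[OF linear_dd[OF diff_g[OF assms]]] linear_scale[OF linear_dd[OF diff_g[OF assms]]] by auto

lemma ddg_commute: "x \<in> S \<Longrightarrow> dd S (dd S g v) w x = dd S (dd S g w) v x"
  by (rule dd_commute[OF S smooth_g])

lemma ddg_simps:
  assumes "x \<in> S"
  shows "dd S (dd S g u) (v + w) x = dd S (dd S g u) v x + dd S (dd S g u) w x"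
    "dd S (dd S g u) (r *\<^sub>R v) x = r *\<^sub>R dd S (dd S g u) v x"
    "dd S (dd S g (v + w)) u x = dd S (dd S g v) u x + dd S (dd S g w) u x"
    "dd S (dd S g (r *\<^sub>R v)) u x = r *\<^sub>R dd S (dd S g v) u x"
proof -
  note l = linear_dd[OF diff_dg[OF assms]]
  show 1: "dd S (dd S g u) (v + w) x = dd S (dd S g u) v x + dd S (dd S g u) w x"
    and 2: "dd S (dd S g u) (r *\<^sub>R v) x = r *\<^sub>R dd S (dd S g u) v x" for u v w r
    using linear_add[OF l] linear_scale[OF l] by auto
  show "dd S (dd S g (v + w)) u x = dd S (dd S g v) u x + dd S (dd S g w) u x"
    "dd S (dd S g (r *\<^sub>R v)) u x = r *\<^sub>R dd S (dd S g v) u x"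
    using 1[of u v w] 2[of u r v] by (simp_all only: ddg_commute[OF assms, of _ u])
qed

lemma L_sym: "x \<in> S \<Longrightarrow> L x a b c = L x a c b"
  unfolding L_def using dg_sym[of x a b c] by simp

text \<open>Compatibility of the Levi-Civita connection with the metric, written with lowered
  indices.\<close>

lemma dg_L: "x \<in> S \<Longrightarrow> metric_prod (dd S g b x) a c = L x a b c + L x c b a"
  unfolding L_def
  using dg_sym[of x b a c] dg_sym[of x c b a] dg_sym[of x a b c] by (simp add: field_simps)

lemma L_simps:
  assumes "x \<in> S"
  shows "L x (v + w) b c = L x v b c + L x w b c" "L x (r *\<^sub>R v) b c = r * L x v b c"
    "L x b (v + w) c = L x b v c + L x b w c" "L x b (r *\<^sub>R v) c = r * L x b v c"
    "L x b c (v + w) = L x b c v + L x b c w" "L x b c (r *\<^sub>R v) = r * L x b c v"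
  unfolding L_def by (simp_all add: metric_prod_simps dd_g_simps[OF assms] field_simps)

lemma linear_L: "x \<in> S \<Longrightarrow> linear (\<lambda>a. L x a b c)"
  by (intro linearI) (simp_all add: L_simps)

lemma ip_Gam:
  assumes "x \<in> S"
  shows "metric_prod (g x) a (Gam x b c) = L x a b c"
proof -
  have "metric_prod (g x) a (Gam x b c) = a \<bullet> (\<chi> l. L x (axis l 1) b c)"
    by (simp add: metric_prod_def Gam_def matrix_vector_mul_assoc g_inv[OF assms])
  also have "\<dots> = (\<Sum>l\<in>UNIV. a $ l *\<^sub>R L x (axis l 1) b c)"
    by (simp add: inner_vec_def)
  finally show ?thesis using linear_axis_sum[OF linear_L[OF assms]] by metis
qed

lemma Gam_simps:
  assumes "x \<in> S"
  shows "Gam x (v + w) c = Gam x v c + Gam x w c" "Gam x (r *\<^sub>R v) c = r *\<^sub>R Gam x v c"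
    "Gam x c (v + w) = Gam x c v + Gam x c w" "Gam x c (r *\<^sub>R v) = r *\<^sub>R Gam x c v"
proof -
  have a: "(\<chi> l. p l + q l) = (\<chi> l. p l) + (\<chi> l. q l)" "(\<chi> l. r * q l) = r *\<^sub>R (\<chi> l. q l)"
    for p q :: "'n \<Rightarrow> real" and r
    by (simp_all add: vec_eq_iff)
  show "Gam x (v + w) c = Gam x v c + Gam x w c" "Gam x (r *\<^sub>R v) c = r *\<^sub>R Gam x v c"
    "Gam x c (v + w) = Gam x c v + Gam x c w" "Gam x c (r *\<^sub>R v) = r *\<^sub>R Gam x c v"
    unfolding Gam_def L_simps[OF assms] a
    by (simp_all add: matrix_vector_right_distrib matrix_vector_mult_scaleR)
qed

lemma linear_Gam: "x \<in> S \<Longrightarrow> linear (\<lambda>v. Gam x v c)" "x \<in> S \<Longrightarrow> linear (Gam x c)"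
  by (auto intro!: linearI simp: Gam_simps)

lemma Gam_sym: "x \<in> S \<Longrightarrow> Gam x a b = Gam x b a"
  unfolding Gam_def using L_sym[of x _ a b] by simp

lemma DL_simps:
  assumes "x \<in> S"
  shows "DL x (v + w) a b c = DL x v a b c + DL x w a b c" "DL x (r *\<^sub>R v) a b c = r * DL x v a b c"
    "DL x a (v + w) b c = DL x a v b c + DL x a w b c" "DL x a (r *\<^sub>R v) b c = r * DL x a v b c"
    "DL x a b (v + w) c = DL x a b v c + DL x a b w c" "DL x a b (r *\<^sub>R v) c = r * DL x a b v c"
    "DL x a b c (v + w) = DL x a b c v + DL x a b c w" "DL x a b c (r *\<^sub>R v) = r * DL x a b c v"
  unfolding DL_def by (simp_all add: metric_prod_simps ddg_simps[OF assms] field_simps)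

lemma Rm_simps:
  assumes "x \<in> S"
  shows "Rm x (v + w) a b c = Rm x v a b c + Rm x w a b c" "Rm x (r *\<^sub>R v) a b c = r * Rm x v a b c"
    "Rm x a (v + w) b c = Rm x a v b c + Rm x a w b c" "Rm x a (r *\<^sub>R v) b c = r * Rm x a v b c"
    "Rm x a b (v + w) c = Rm x a b v c + Rm x a b w c" "Rm x a b (r *\<^sub>R v) c = r * Rm x a b v c"
    "Rm x a b c (v + w) = Rm x a b c v + Rm x a b c w" "Rm x a b c (r *\<^sub>R v) = r * Rm x a b c v"
  unfolding Rm_def by (simp_all add: metric_prod_simps DL_simps[OF assms] Gam_simps[OF assms] algebra_simps)

lemma Rm_antisym1: "x \<in> S \<Longrightarrow> Rm x b a c d = - Rm x a b c d"
  by (simp add: Rm_def)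

text \<open>By \<open>dg_L\<close>, the sum of \<open>DL\<close> over the two orders of
  \<open>c\<close> and \<open>d\<close> is the second derivative of the metric component for
  \<open>c\<close> and \<open>d\<close> in the directions \<open>a\<close> and \<open>b\<close>, and
  second derivatives commute. The terms in \<open>Gam\<close> only exchange places.\<close>

lemma Rm_antisym2:
  assumes "x \<in> S"
  shows "Rm x a b d c = - Rm x a b c d"
proof -
  have "DL x a d b c + DL x a c b d = DL x b d a c + DL x b c a d"
    unfolding DL_def
    by (simp add: ddg_commute[OF assms, of b a] ddg_sym[OF assms, of _ _ d c] ddg_sym[OF assms, of _ _ b _]
        ddg_sym[OF assms, of _ _ a _] field_simps)
  then show ?thesis
    unfolding Rm_def by (simp add: ip_sym[OF assms, of "Gam x b d"] ip_sym[OF assms, of "Gam x a d"])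
qed

lemma has_derivative_L:
  assumes "x \<in> S"
  shows "((\<lambda>y. L y a b c) has_derivative (\<lambda>v. DL x v a b c)) (at x within S)"
proof -
  have "((\<lambda>y. metric_prod (dd S g p y) q r) has_derivative (\<lambda>v. metric_prod (dd S (dd S g p) v x) q r)) (at x within S)"
    for p q r
    by (rule bounded_linear.has_derivative[OF linear_conv_bounded_linear[THEN iffD1, OF linear_metric_prod(1)]
          has_derivative_dd[OF diff_dg[OF assms]]])
  note d = this
  show ?thesis unfolding L_def DL_def divide_inverse
    by (intro has_derivative_mult_left has_derivative_diff has_derivative_add d)
qed

lemma differentiable_Gam:
  assumes "x \<in> S"
  shows "(\<lambda>y. Gam y b c) differentiable (at x within S)"
proof -
  have inv: "(\<lambda>y. matrix_inv (g y) $ k $ l) differentiable (at x within S)" for k l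
    by (rule differentiable_matrix_inv[OF diff_g[OF assms] assms pos_g])
  have L: "(\<lambda>y. L y a b c) differentiable (at x within S)" for a
    using has_derivative_L[OF assms] differentiable_def by blast
  have "(\<lambda>y. Gam y b c $ k) differentiable (at x within S)" for k
    unfolding Gam_def matrix_vector_mult_def by (simp add: inv L differentiable_mult differentiable_sum)
  then show ?thesis
    unfolding differentiable_componentwise_within[of "\<lambda>y. Gam y b c"]
    by (auto simp: Basis_vec_def inner_axis)
qed

section \<open>Translation of the index expressions into multilinear functions\<close>

lemma christoffel_Gam: "x \<in> S \<Longrightarrow> christoffel S g k i j x = Gam x (axis i 1) (axis j 1) $ k"
proof -
  assume x: "x \<in> S"
  have "pd S i (\<lambda>y. g y $ j $ l) x = metric_prod (dd S g (axis i 1) x) (axis j 1) (axis l 1)" for i j l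
    unfolding metric_prod_axis pd_dd
    by (rule dd_linear_image[OF S x diff_g[OF x], where T = "\<lambda>h. h $ j $ l"])
      (intro bounded_linear_compose[OF bounded_linear_vec_nth bounded_linear_vec_nth, unfolded o_def])
  then show ?thesis
    unfolding christoffel_def Gam_def matrix_vector_mult_def L_def
    by (simp add: sum_divide_distrib)
qed

text \<open>The coordinate definition differentiates symbols of the second kind. Pairing them with
  the metric before differentiating moves the derivative to symbols of the first kind, which is
  where \<open>DL\<close> comes from.\<close>

lemma riem4_Rm:
  assumes x: "x \<in> S"
  shows "riem4 S g i j k l x = Rm x (axis i 1) (axis j 1) (axis k 1) (axis l 1)"
proof -
  let ?e = "\<lambda>i. axis i 1 :: (real, 'n) vec"
  let ?R = "dd S (\<lambda>y. Gam y (?e j) (?e k)) (?e i) x - dd S (\<lambda>y. Gam y (?e i) (?e k)) (?e j) x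
    + (Gam x (?e i) (Gam x (?e j) (?e k)) - Gam x (?e j) (Gam x (?e i) (?e k)))"
  have d: "pd S i (christoffel S g m j k) x = dd S (\<lambda>y. Gam y (?e j) (?e k)) (?e i) x $ m" for i j m
  proof -
    have "dd S (christoffel S g m j k) (?e i) x = dd S (\<lambda>y. Gam y (?e j) (?e k) $ m) (?e i) x"
      by (rule dd_cong_on[OF x christoffel_Gam])
    also have "\<dots> = dd S (\<lambda>y. Gam y (?e j) (?e k)) (?e i) x $ m"
      by (rule dd_linear_image[OF S x differentiable_Gam[OF x] bounded_linear_vec_nth])
    finally show ?thesis by (simp add: pd_dd)
  qed
  have q: "(\<Sum>p\<in>UNIV. christoffel S g m i p x * christoffel S g p j k x) = Gam x (?e i) (Gam x (?e j) (?e k)) $ m"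
    for i j m
    unfolding linear_axis_sum[OF linear_Gam(2)[OF x], of "?e i" "Gam x (?e j) (?e k)"]
    by (simp add: christoffel_Gam[OF x] mult.commute)
  have "riem S g m k i j x = ?R $ m" for m
    unfolding riem_def sum_subtractf q d by simp
  then have r: "riem4 S g i j k l x = metric_prod (g x) (?e l) ?R"
    unfolding riem4_def metric_prod_def inner_axis' matrix_vector_mult_def by simp
  \<comment> \<open>This is the derivative of \<open>ip_Gam\<close>. By \<open>dg_L\<close> the
    derivative of \<open>g\<close> splits into two products of connection terms: one stays with the
    derivative of \<open>Gam\<close>, the other goes to the right.\<close>
  have dL: "metric_prod (g x) (?e l) (dd S (\<lambda>y. Gam y b c) a x) + metric_prod (g x) (?e l) (Gam x a (Gam x b c))
      = DL x a (?e l) b c - metric_prod (g x) (Gam x a (?e l)) (Gam x b c)" for a b c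
  proof -
    have "((\<lambda>y. metric_prod (g y) (?e l) (Gam y b c)) has_derivative (\<lambda>v. metric_prod (dd S g v x) (?e l) (Gam x b c)
        + metric_prod (g x) 0 (Gam x b c) + metric_prod (g x) (?e l) (dd S (\<lambda>y. Gam y b c) v x))) (at x within S)"
      by (rule has_derivative_metric_prod[OF has_derivative_dd[OF diff_g[OF x]] has_derivative_const
            has_derivative_dd[OF differentiable_Gam[OF x]]])
    then have "dd S (\<lambda>y. metric_prod (g y) (?e l) (Gam y b c)) a x
      = metric_prod (dd S g a x) (?e l) (Gam x b c) + metric_prod (g x) (?e l) (dd S (\<lambda>y. Gam y b c) a x)"
      using dd_eqI[OF S x] by (simp add: metric_prod_simps)
    moreover have "dd S (\<lambda>y. metric_prod (g y) (?e l) (Gam y b c)) a x = dd S (\<lambda>y. L y (?e l) b c) a x"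
      by (rule dd_cong_on[OF x ip_Gam])
    moreover have "dd S (\<lambda>y. L y (?e l) b c) a x = DL x a (?e l) b c"
      by (rule dd_eqI[OF S x has_derivative_L[OF x]])
    moreover have "metric_prod (dd S g a x) (?e l) (Gam x b c)
      = metric_prod (g x) (?e l) (Gam x a (Gam x b c)) + metric_prod (g x) (Gam x a (?e l)) (Gam x b c)"
      unfolding dg_L[OF x] ip_Gam[OF x, symmetric] by (simp add: ip_sym[OF x, of "Gam x b c"])
    ultimately show ?thesis by simp
  qed
  show ?thesis
    using dL[of "?e j" "?e k" "?e i"] dL[of "?e i" "?e k" "?e j"]
    unfolding r Rm_def metric_prod_simps by linarith
qed

lemma ricci_Ric:
  assumes x: "x \<in> S"
  shows "ricci S g j k x = Ric x (axis j 1) (axis k 1)"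
proof -
  have "riem S g i k i' j x = (\<Sum>l\<in>UNIV. matrix_inv (g x) $ i $ l * riem4 S g i' j k l x)" for i i'
  proof -
    have "(\<chi> m. riem S g m k i' j x) = matrix_inv (g x) *v (g x *v (\<chi> m. riem S g m k i' j x))"
      by (simp add: matrix_vector_mul_assoc g_inv[OF x])
    then have "riem S g i k i' j x = (matrix_inv (g x) *v (g x *v (\<chi> m. riem S g m k i' j x))) $ i"
      by (metis vec_lambda_beta)
    then show ?thesis by (simp add: matrix_vector_mult_def riem4_def)
  qed
  then show ?thesis unfolding ricci_def Ric_def tr_def by (simp add: riem4_Rm[OF x])
qed

lemma Ric_simps:
  assumes "x \<in> S"
  shows "Ric x (v + w) c = Ric x v c + Ric x w c" "Ric x (r *\<^sub>R v) c = r * Ric x v c"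
    "Ric x c (v + w) = Ric x c v + Ric x c w" "Ric x c (r *\<^sub>R v) = r * Ric x c v"
  unfolding Ric_def tr_def
  by (simp_all add: Rm_simps[OF assms] sum.distrib sum_distrib_left algebra_simps)

lemma ricci_quadratic:
  assumes "x \<in> S"
  shows "(\<Sum>i\<in>UNIV. \<Sum>j\<in>UNIV. ricci S g i j x * n $ i * n $ j) = Ric x n n"
proof -
  have "Ric x n n = (\<Sum>i\<in>UNIV. \<Sum>j\<in>UNIV. (n $ i * n $ j) *\<^sub>R Ric x (axis i 1) (axis j 1))"
    by (rule bilinear_sum_sum) (auto intro!: linearI simp: Ric_simps[OF assms])
  then show ?thesis by (simp add: ricci_Ric[OF assms] mult_ac)
qed

lemma scalar_curv_Ric: "x \<in> S \<Longrightarrow> scalar_curv S g x = tr x (Ric x)"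
  unfolding scalar_curv_def tr_def by (simp add: ricci_Ric)

lemma hessian_Hs:
  assumes x: "x \<in> S" and u: "smooth_on S u"
  shows "hessian S g u i j x = Hs u x (axis i 1) (axis j 1)"
  unfolding hessian_def Hs_def dd_pd[OF smooth_on_differentiable[OF S u x], of "Gam x _ _"]
  by (simp add: christoffel_Gam[OF x]) (simp add: pd_dd)

lemma laplacian_Hs: "x \<in> S \<Longrightarrow> smooth_on S u \<Longrightarrow> laplacian S g u x = tr x (Hs u x)"
  unfolding laplacian_def tr_def by (simp add: hessian_Hs)

lemma Hs_simps:
  assumes x: "x \<in> S" and u: "smooth_on S u"
  shows "Hs u x (v + w) c = Hs u x v c + Hs u x w c" "Hs u x (r *\<^sub>R v) c = r * Hs u x v c"
    "Hs u x c (v + w) = Hs u x c v + Hs u x c w" "Hs u x c (r *\<^sub>R v) = r * Hs u x c v"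
proof -
  have l1: "linear (\<lambda>v. dd S (dd S u b) v x)" for b
    by (rule linear_dd[OF smooth_on_differentiable[OF S smooth_on_dd[OF S u] x]])
  have l2: "linear (\<lambda>v. dd S u v x)"
    by (rule linear_dd[OF smooth_on_differentiable[OF S u x]])
  have c: "dd S (dd S u v) w x = dd S (dd S u w) v x" for v w by (rule dd_commute[OF S u x])
  show 1: "Hs u x (v + w) c = Hs u x v c + Hs u x w c" "Hs u x (r *\<^sub>R v) c = r * Hs u x v c" for v w r
    unfolding Hs_def Gam_simps[OF x] linear_add[OF l1] linear_add[OF l2] linear_scale[OF l1] linear_scale[OF l2]
    by (simp_all add: algebra_simps)
  have sym: "Hs u x a b = Hs u x b a" for a b
    unfolding Hs_def by (simp only: c[of b a] Gam_sym[OF x, of a b])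
  show "Hs u x c (v + w) = Hs u x c v + Hs u x c w" "Hs u x c (r *\<^sub>R v) = r * Hs u x c v"
    unfolding sym[of c] by (rule 1)+
qed

end


section \<open>Immersions and the Gauss equation\<close>

text \<open>Here both the direction and the base point of the derivative of \<open>g\<close> vary.
  Expanding the direction over the axes separates the two dependences into a sum of
  products.\<close>

lemma (in metric_domain) has_derivative_dd_g_along:
  fixes u :: "real ^ 'm::{finite,one} \<Rightarrow> (real, 'n) vec"
  assumes D: "openin (top_of_set half_space) D" and y: "y \<in> D"
    and u: "u differentiable (at y within D)" and V: "V differentiable (at y within D)" and sub: "u ` D \<subseteq> S"
  shows "((\<lambda>z. dd S g (V z) (u z)) has_derivative
    (\<lambda>v. dd S g (dd D V v y) (u y) + dd S (dd S g (V y)) (dd D u v y) (u y))) (at y within D)"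
proof -
  have uy: "u y \<in> S" using y sub by auto
  have pd: "((\<lambda>z. pd S i g (u z)) has_derivative (\<lambda>v. dd S (pd S i g) (dd D u v y) (u y))) (at y within D)" for i
    unfolding pd_dd by (rule dd_chain(2)[OF D y u diff_dg[OF uy] sub])
  have Vi: "((\<lambda>z. V z $ i) has_derivative (\<lambda>v. dd D V v y $ i)) (at y within D)" for i
    by (rule bounded_linear.has_derivative[OF bounded_linear_vec_nth has_derivative_dd[OF V]])
  have "((\<lambda>z. \<Sum>i\<in>UNIV. V z $ i *\<^sub>R pd S i g (u z)) has_derivative
    (\<lambda>v. \<Sum>i\<in>UNIV. V y $ i *\<^sub>R dd S (pd S i g) (dd D u v y) (u y) + dd D V v y $ i *\<^sub>R pd S i g (u y))) (at y within D)"
    by (intro has_derivative_sum has_derivative_scaleR Vi pd)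
  moreover have "(\<Sum>i\<in>UNIV. V z $ i *\<^sub>R pd S i g (u z)) = dd S g (V z) (u z)" if "z \<in> D" for z
    using dd_pd[OF diff_g, of "u z" "V z"] that sub by auto
  moreover have "(\<Sum>i\<in>UNIV. w $ i *\<^sub>R pd S i g (u y)) = dd S g w (u y)" for w
    using dd_pd[OF diff_g[OF uy]] by simp
  moreover have "(\<Sum>i\<in>UNIV. V y $ i *\<^sub>R dd S (pd S i g) w (u y)) = dd S (dd S g (V y)) w (u y)" for w
  proof -
    have "linear (\<lambda>v. dd S (dd S g v) w (u y))"
      by (intro linearI) (simp_all add: ddg_simps[OF uy])
    from linear_axis_sum[OF this, of "V y"] show ?thesis by (simp add: pd_dd)
  qed
  ultimately have "((\<lambda>z. \<Sum>i\<in>UNIV. V z $ i *\<^sub>R pd S i g (u z)) has_derivative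
    (\<lambda>v. dd S g (dd D V v y) (u y) + dd S (dd S g (V y)) (dd D u v y) (u y))) (at y within D)"
    by (simp add: sum.distrib add.commute)
  then show ?thesis
    by (rule has_derivative_transform[OF y, rotated]) (use dd_pd[OF diff_g] sub in auto)
qed

locale immersed_patch = amb: metric_domain S g
  for S :: "(real ^ 'n::{finite,one}) set" and g :: "(real, 'n) vec \<Rightarrow> ((real, 'n) vec, 'n) vec" +
  fixes D :: "(real ^ 'm::{finite,one}) set" and u :: "(real, 'm) vec \<Rightarrow> (real, 'n) vec"
  assumes D: "openin (top_of_set half_space) D"
    and smooth_u: "smooth_on D u"
    and sub: "u ` D \<subseteq> S"
    and inj_du: "y \<in> D \<Longrightarrow> inj (\<lambda>v. dd D u v y)"
begin

definition h :: "(real, 'm) vec \<Rightarrow> ((real, 'm) vec, 'm) vec" where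
  "h y = (\<chi> i j. metric_prod (g (u y)) (dd D u (axis i 1) y) (dd D u (axis j 1) y))"

text \<open>\<open>K y a b\<close> is \<open>\<nabla>\<^sub>a (du b)\<close> for the connection along \<open>u\<close>. Its tangential part is the Levi-Civita
  connection of the induced metric, its normal part the second fundamental form.\<close>

definition K :: "(real, 'm) vec \<Rightarrow> (real, 'm) vec \<Rightarrow> (real, 'm) vec \<Rightarrow> (real, 'n) vec" where
  "K y a b = dd D (dd D u a) b y + amb.Gam (u y) (dd D u a y) (dd D u b y)"

lemma uS: "y \<in> D \<Longrightarrow> u y \<in> S"
  using sub by auto

lemma diff_u: "y \<in> D \<Longrightarrow> u differentiable (at y within D)"
  by (rule smooth_on_differentiable[OF D smooth_u])

lemma diff_du: "y \<in> D \<Longrightarrow> dd D u v differentiable (at y within D)"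
  by (rule smooth_on_differentiable[OF D smooth_on_dd[OF D smooth_u]])

lemma diff_ddu: "y \<in> D \<Longrightarrow> dd D (dd D u v) w differentiable (at y within D)"
  by (rule smooth_on_differentiable[OF D smooth_on_dd[OF D smooth_on_dd[OF D smooth_u]]])

lemma ddu_commute: "y \<in> D \<Longrightarrow> dd D (dd D u v) w y = dd D (dd D u w) v y"
  by (rule dd_commute[OF D smooth_u])

lemma du_simps:
  assumes "y \<in> D"
  shows "dd D u (v + w) y = dd D u v y + dd D u w y" "dd D u (r *\<^sub>R v) y = r *\<^sub>R dd D u v y"
  using linear_add[OF linear_dd[OF diff_u[OF assms]]] linear_scale[OF linear_dd[OF diff_u[OF assms]]] by auto

lemma h_prod:
  assumes y: "y \<in> D"
  shows "metric_prod (h y) v w = metric_prod (g (u y)) (dd D u v y) (dd D u w y)"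
proof -
  have "metric_prod (g (u y)) (dd D u v y) (dd D u w y) =
    (\<Sum>i\<in>UNIV. \<Sum>j\<in>UNIV. (v $ i * w $ j) *\<^sub>R metric_prod (g (u y)) (dd D u (axis i 1) y) (dd D u (axis j 1) y))"
    by (rule bilinear_sum_sum) (auto intro!: linearI simp: du_simps[OF y] metric_prod_simps)
  then show ?thesis unfolding metric_prod_sum[of "h y"] by (simp add: h_def mult_ac)
qed

lemma smooth_gu: "smooth_on D (\<lambda>y. g (u y))"
  by (rule smooth_on_compose[OF smooth_u amb.smooth_g sub])

lemma smooth_h: "smooth_on D h"
proof (rule smooth_on_vec, rule smooth_on_vec)
  fix i j :: 'm
  show "smooth_on D (\<lambda>x. h x $ i $ j)"
    unfolding h_def vec_lambda_beta
    by (rule smooth_on_metric_prod[OF smooth_gu smooth_on_dd[OF D smooth_u] smooth_on_dd[OF D smooth_u]])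
qed

text \<open>Injectivity of the differential makes the pulled-back metric positive definite. From
  here on connection, curvature and Hessian exist side by side for the patch (\<open>sf\<close>) and
  for the ambient space (\<open>amb\<close>).\<close>

sublocale sf: metric_domain D h
proof
  show "openin (top_of_set half_space) D" by (rule D)
  show "smooth_on D h" by (rule smooth_h)
  show "transpose (h y) = h y" if "y \<in> D" for y
    using amb.ip_sym[OF uS[OF that]] by (simp add: transpose_def h_def vec_eq_iff)
  show "metric_prod (h y) v v > 0" if "y \<in> D" "v \<noteq> 0" for y v
  proof -
    have "dd D u 0 y = 0" using linear_0[OF linear_dd[OF diff_u[OF that(1)]]] by simp
    then have "dd D u v y \<noteq> 0" using injD[OF inj_du[OF that(1)], of v 0] that(2) by auto
    then show ?thesis unfolding h_prod[OF that(1)] by (rule amb.pos_g[OF uS[OF that(1)]])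
  qed
qed

lemma dh:
  assumes y: "y \<in> D"
  shows "metric_prod (dd D h v y) a b = metric_prod (dd S g (dd D u v y) (u y)) (dd D u a y) (dd D u b y)
    + metric_prod (g (u y)) (dd D (dd D u a) v y) (dd D u b y)
    + metric_prod (g (u y)) (dd D u a y) (dd D (dd D u b) v y)"
proof -
  have "metric_prod (dd D h v y) a b = dd D (\<lambda>z. metric_prod (h z) a b) v y"
    by (rule dd_linear_image[OF D y sf.diff_g[OF y]
          linear_conv_bounded_linear[THEN iffD1, OF linear_metric_prod(1)], symmetric])
  also have "\<dots> = dd D (\<lambda>z. metric_prod (g (u z)) (dd D u a z) (dd D u b z)) v y"
    by (rule dd_cong_on[OF y h_prod])
  also have "\<dots> = metric_prod (dd S g (dd D u v y) (u y)) (dd D u a y) (dd D u b y)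
    + metric_prod (g (u y)) (dd D (dd D u a) v y) (dd D u b y)
    + metric_prod (g (u y)) (dd D u a y) (dd D (dd D u b) v y)"
    by (rule dd_eqI[OF D y has_derivative_metric_prod[OF dd_chain(2)[OF D y diff_u[OF y] amb.diff_g[OF uS[OF y]] sub]
          has_derivative_dd[OF diff_du[OF y]] has_derivative_dd[OF diff_du[OF y]]]])
  finally show ?thesis .
qed

text \<open>The three derivatives of \<open>h\<close> contain six terms with second derivatives of
  \<open>u\<close>. By their symmetry four of these cancel, and the other two combine into the first
  summand.\<close>

lemma h_L:
  assumes y: "y \<in> D"
  shows "sf.L y k i j = metric_prod (g (u y)) (dd D u k y) (dd D (dd D u i) j y)
    + amb.L (u y) (dd D u k y) (dd D u i y) (dd D u j y)"
  unfolding sf.L_def amb.L_def dh[OF y]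
  using amb.ip_sym[OF uS[OF y]] ddu_commute[OF y, of i j] ddu_commute[OF y, of i k] ddu_commute[OF y, of j k]
  by (simp add: field_simps)

text \<open>Both sides are the symbol \<open>sf.L y k a b\<close>: the left by \<open>h_L\<close>,
  the right by the definition of \<open>sf.Gam\<close>. So the tangential part of the ambient
  connection is the Levi-Civita connection of \<open>h\<close>.\<close>

lemma ip_K_du:
  assumes y: "y \<in> D"
  shows "metric_prod (g (u y)) (dd D u k y) (K y a b) = metric_prod (g (u y)) (dd D u k y) (dd D u (sf.Gam y a b) y)"
  unfolding K_def metric_prod_simps h_prod[OF y, symmetric] sf.ip_Gam[OF y] amb.ip_Gam[OF uS[OF y]] h_L[OF y] ..

lemma has_derivative_L_along:
  assumes y: "y \<in> D"
  shows "((\<lambda>z. amb.L (u z) (dd D u k z) (dd D u i z) (dd D u j z)) has_derivative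
    (\<lambda>v. amb.DL (u y) (dd D u v y) (dd D u k y) (dd D u i y) (dd D u j y)
      + amb.L (u y) (dd D (dd D u k) v y) (dd D u i y) (dd D u j y)
      + amb.L (u y) (dd D u k y) (dd D (dd D u i) v y) (dd D u j y)
      + amb.L (u y) (dd D u k y) (dd D u i y) (dd D (dd D u j) v y))) (at y within D)"
proof -
  have d: "((\<lambda>z. metric_prod (dd S g (dd D u a z) (u z)) (dd D u b z) (dd D u c z)) has_derivative
    (\<lambda>v. metric_prod (dd S g (dd D (dd D u a) v y) (u y) + dd S (dd S g (dd D u a y)) (dd D u v y) (u y)) (dd D u b y) (dd D u c y)
      + metric_prod (dd S g (dd D u a y) (u y)) (dd D (dd D u b) v y) (dd D u c y)
      + metric_prod (dd S g (dd D u a y) (u y)) (dd D u b y) (dd D (dd D u c) v y))) (at y within D)" for a b c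
    by (rule has_derivative_metric_prod[OF amb.has_derivative_dd_g_along[OF D y diff_u[OF y] diff_du[OF y] sub]
          has_derivative_dd[OF diff_du[OF y]] has_derivative_dd[OF diff_du[OF y]]])
  note d3 = has_derivative_mult_left[OF has_derivative_diff[OF has_derivative_add[OF d[of i j k] d[of j i k]] d[of k i j]],
      of "inverse 2"]
  show ?thesis
    unfolding amb.L_def amb.DL_def divide_inverse
    by (rule has_derivative_eq_rhs[OF d3]) (simp add: fun_eq_iff metric_prod_simps field_simps)
qed

text \<open>The derivative of \<open>h_L\<close>. The bracket has four terms because
  \<open>amb.L\<close> varies with its base point and with each of its three arguments.\<close>

lemma h_DL:
  assumes y: "y \<in> D"
  shows "sf.DL y v k i j = metric_prod (dd S g (dd D u v y) (u y)) (dd D u k y) (dd D (dd D u i) j y)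
    + metric_prod (g (u y)) (dd D (dd D u k) v y) (dd D (dd D u i) j y)
    + metric_prod (g (u y)) (dd D u k y) (dd D (dd D (dd D u i) j) v y)
    + (amb.DL (u y) (dd D u v y) (dd D u k y) (dd D u i y) (dd D u j y)
      + amb.L (u y) (dd D (dd D u k) v y) (dd D u i y) (dd D u j y)
      + amb.L (u y) (dd D u k y) (dd D (dd D u i) v y) (dd D u j y)
      + amb.L (u y) (dd D u k y) (dd D u i y) (dd D (dd D u j) v y))"
proof -
  have "sf.DL y v k i j = dd D (\<lambda>z. sf.L z k i j) v y"
    by (rule dd_eqI[OF D y sf.has_derivative_L[OF y], symmetric])
  also have "\<dots> = dd D (\<lambda>z. metric_prod (g (u z)) (dd D u k z) (dd D (dd D u i) j z)
    + amb.L (u z) (dd D u k z) (dd D u i z) (dd D u j z)) v y"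
    by (rule dd_cong_on[OF y h_L])
  finally show ?thesis
    using dd_eqI[OF D y has_derivative_add[OF has_derivative_metric_prod[OF dd_chain(2)[OF D y diff_u[OF y] amb.diff_g[OF uS[OF y]] sub]
          has_derivative_dd[OF diff_du[OF y]] has_derivative_dd[OF diff_ddu[OF y]]] has_derivative_L_along[OF y]]]
    by simp
qed

text \<open>Stated for the arguments of a sectional curvature. No normal vector is available yet, so
  the products of \<open>K\<close> include tangential parts; the two products of
  \<open>sf.Gam\<close>, which come from the definition of \<open>sf.Rm\<close>, compensate for
  them.\<close>

lemma Gauss_equation:
  assumes y: "y \<in> D"
  shows "sf.Rm y a b b a = amb.Rm (u y) (dd D u a y) (dd D u b y) (dd D u b y) (dd D u a y)
    + metric_prod (g (u y)) (K y a a) (K y b b) - metric_prod (g (u y)) (K y a b) (K y a b)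
    - metric_prod (h y) (sf.Gam y a a) (sf.Gam y b b) + metric_prod (h y) (sf.Gam y a b) (sf.Gam y a b)"
proof -
  let ?p = "dd D u a y" and ?q = "dd D u b y"
  let ?aa = "dd D (dd D u a) a y" and ?bb = "dd D (dd D u b) b y" and ?ab = "dd D (dd D u a) b y"
  have x: "u y \<in> S" by (rule uS[OF y])
  have ba: "dd D (dd D u b) a y = ?ab" by (rule ddu_commute[OF y])
  \<comment> \<open>The two \<open>DL\<close> terms of the curvature contain third derivatives of
    \<open>u\<close> in different orders. They coincide, so only second derivatives survive in the
    difference.\<close>
  have "dd D (dd D (dd D u b) b) a y = dd D (dd D (dd D u b) a) b y"
    by (rule dd_commute[OF D smooth_on_dd[OF D smooth_u] y])
  also have "\<dots> = dd D (dd D (dd D u a) b) b y"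
    by (rule dd_cong_on[OF y ddu_commute])
  finally have third: "dd D (dd D (dd D u b) b) a y = dd D (dd D (dd D u a) b) b y" .
  have DL: "sf.DL y a a b b - sf.DL y b a a b =
    amb.DL (u y) ?p ?p ?q ?q - amb.DL (u y) ?q ?p ?p ?q
    + metric_prod (g (u y)) ?aa ?bb - metric_prod (g (u y)) ?ab ?ab
    + amb.L (u y) ?bb ?p ?p + amb.L (u y) ?aa ?q ?q - 2 * amb.L (u y) ?ab ?p ?q"
    unfolding h_DL[OF y] third ba amb.dg_L[OF x] using amb.L_sym[OF x] by simp
  have KK: "metric_prod (g (u y)) (K y a a) (K y b b) = metric_prod (g (u y)) ?aa ?bb
      + amb.L (u y) ?aa ?q ?q + amb.L (u y) ?bb ?p ?p + metric_prod (g (u y)) (amb.Gam (u y) ?p ?p) (amb.Gam (u y) ?q ?q)"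
    unfolding K_def metric_prod_simps amb.ip_Gam[OF x, symmetric]
    by (simp add: amb.ip_sym[OF x, of "amb.Gam (u y) ?p ?p" ?bb])
  have KK': "metric_prod (g (u y)) (K y a b) (K y a b) = metric_prod (g (u y)) ?ab ?ab
      + 2 * amb.L (u y) ?ab ?p ?q + metric_prod (g (u y)) (amb.Gam (u y) ?p ?q) (amb.Gam (u y) ?p ?q)"
    unfolding K_def metric_prod_simps amb.ip_Gam[OF x, symmetric]
    by (simp add: amb.ip_sym[OF x, of "amb.Gam (u y) ?p ?q" ?ab])
  show ?thesis
    unfolding sf.Rm_def amb.Rm_def KK KK' sf.Gam_sym[OF y, of b a] amb.Gam_sym[OF x, of ?q ?p]
    using DL by linarith
qed

text \<open>The chain rule for second derivatives produces the second derivative of \<open>u\<close>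
  instead of \<open>K\<close>. The ambient connection term completes it to \<open>K\<close>, the
  intrinsic one subtracts the tangential part, and df is left applied to the normal part of
  \<open>K\<close>.\<close>

lemma Hs_comp:
  assumes y: "y \<in> D" and f: "smooth_on S f"
  shows "sf.Hs (\<lambda>z. f (u z)) y a b = amb.Hs f (u y) (dd D u a y) (dd D u b y)
    + dd S f (K y a b - dd D u (sf.Gam y a b) y) (u y)"
proof -
  have x: "u y \<in> S" by (rule uS[OF y])
  have df: "f differentiable (at z within S)" if "z \<in> S" for z by (rule smooth_on_differentiable[OF amb.S f that])
  have ddf: "dd S f v differentiable (at z within S)" if "z \<in> S" for v z
    by (rule smooth_on_differentiable[OF amb.S smooth_on_dd[OF amb.S f] that])
  have pdf: "pd S i f differentiable (at (u y) within S)" for i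
    unfolding pd_dd by (rule ddf[OF x])
  have d1: "dd D (\<lambda>z. f (u z)) v z = dd S f (dd D u v z) (u z)" if "z \<in> D" for v z
    by (rule dd_chain(1)[OF D that diff_u[OF that] df[OF uS[OF that]] sub])
  have "dd D (dd D (\<lambda>z. f (u z)) b) a y = dd D (\<lambda>z. \<Sum>i\<in>UNIV. dd D u b z $ i *\<^sub>R pd S i f (u z)) a y"
    by (rule dd_cong_on[OF y]) (simp add: d1 dd_pd[OF df[OF uS]])
  also have "\<dots> = (\<Sum>i\<in>UNIV. dd D u b y $ i *\<^sub>R dd S (pd S i f) (dd D u a y) (u y)
      + dd D (dd D u b) a y $ i *\<^sub>R pd S i f (u y))"
    by (rule dd_eqI[OF D y])
      (intro has_derivative_sum has_derivative_scaleR dd_chain(2)[OF D y diff_u[OF y] pdf sub]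
        bounded_linear.has_derivative[OF bounded_linear_vec_nth has_derivative_dd[OF diff_du[OF y]]])
  also have "\<dots> = dd S (dd S f (dd D u b y)) (dd D u a y) (u y) + dd S f (dd D (dd D u b) a y) (u y)"
  proof -
    have "(\<lambda>v. dd S (dd S f v) w (u y)) = (\<lambda>v. dd S (dd S f w) v (u y))" for w
      by (intro ext dd_commute[OF amb.S f x])
    then have lin: "linear (\<lambda>v. dd S (dd S f v) w (u y))" for w
      using linear_dd[OF ddf[OF x]] by simp
    from linear_axis_sum[OF lin[of "dd D u a y"], of "dd D u b y"]
    show ?thesis by (simp add: dd_pd[OF df[OF x], of "dd D (dd D u b) a y"] sum.distrib pd_dd)
  qed
  finally have "dd D (dd D (\<lambda>z. f (u z)) b) a y
    = dd S (dd S f (dd D u b y)) (dd D u a y) (u y) + dd S f (dd D (dd D u b) a y) (u y)" .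
  then show ?thesis
    unfolding sf.Hs_def amb.Hs_def K_def d1[OF y] ddu_commute[OF y, of a b]
    using linear_add[OF linear_dd[OF df[OF x]]] linear_diff[OF linear_dd[OF df[OF x]]] by simp
qed

end

text \<open>The normal enters only through its value \<open>n\<close> at the one point
  \<open>y\<close>: the second fundamental form pairs \<open>n\<close> with second derivatives of
  the immersion, so no derivative of a normal field is taken.\<close>

locale surface_point = immersed_patch S g D u
  for S :: "(real ^ 3) set" and g :: "real ^ 3 \<Rightarrow> real ^ 3 ^ 3" and D :: "(real ^ 2) set" and u :: "real ^ 2 \<Rightarrow> real ^ 3" +
  fixes y :: "real ^ 2" and n :: "real ^ 3"
  assumes y: "y \<in> D" and unit_n: "metric_prod (g (u y)) n n = 1"
    and normal_n: "metric_prod (g (u y)) (dd D u v y) n = 0"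
begin

abbreviation "ip \<equiv> metric_prod (g (u y))"
abbreviation "du v \<equiv> dd D u v y"

definition A :: "real ^ 2 \<Rightarrow> real ^ 2 \<Rightarrow> real" where
  "A a b = ip (K y a b) n"

lemma x: "u y \<in> S"
  by (rule uS[OF y])

lemma normal_n': "ip n (du v) = 0"
  using normal_n amb.ip_sym[OF x] by simp

text \<open>The two tangent vectors and the normal define a linear map between spaces of dimension
  3. Orthogonality and the injective differential make it injective, hence surjective.\<close>

lemma frame: "\<exists>v c. w = du v + c *\<^sub>R n"
proof -
  define T :: "real ^ 3 \<Rightarrow> real ^ 3" where "T p = du (p $ 1 *\<^sub>R axis 1 1 + p $ 2 *\<^sub>R axis 2 1) + p $ 3 *\<^sub>R n" for p
  have lin: "linear T"
    unfolding T_def by (intro linearI) (simp_all add: du_simps[OF y] algebra_simps)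
  have du0: "v = 0" if "du v = 0" for v
  proof -
    have "du 0 = 0" using linear_0[OF linear_dd[OF diff_u[OF y]]] by simp
    then show ?thesis using injD[OF inj_du[OF y], of v 0] that by simp
  qed
  have "p = 0" if "T p = 0" for p
  proof -
    have "ip n (T p) = p $ 3" unfolding T_def metric_prod_simps normal_n' unit_n by simp
    then have p3: "p $ 3 = 0" using that by (simp add: metric_prod_simps)
    then have "p $ 1 *\<^sub>R axis 1 1 + p $ 2 *\<^sub>R axis 2 1 = (0 :: real ^ 2)"
      using that du0 unfolding T_def by simp
    then have "p $ 1 = 0" "p $ 2 = 0" by (auto simp: vec_eq_iff axis_def forall_2)
    with p3 show ?thesis by (simp add: vec_eq_iff forall_3)
  qed
  then have "inj T" using lin linear_injective_0 by blast
  then have "surj T" using lin linear_injective_imp_surjective by blast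
  then obtain p where "w = T p" by blast
  then show ?thesis unfolding T_def by blast
qed

text \<open>The difference of the two sides is orthogonal to the tangent plane by
  \<open>ip_K_du\<close> and to \<open>n\<close> by the definition of \<open>A\<close>. By
  \<open>frame\<close> it is then orthogonal to itself.\<close>

lemma K_decomp: "K y a b = du (sf.Gam y a b) + A a b *\<^sub>R n"
proof -
  let ?w = "K y a b - (du (sf.Gam y a b) + A a b *\<^sub>R n)"
  obtain v c where vc: "?w = du v + c *\<^sub>R n" using frame by blast
  have a: "ip (du v) ?w = 0"
    unfolding metric_prod_simps ip_K_du[OF y] normal_n by simp
  have b: "ip n ?w = 0"
    unfolding metric_prod_simps normal_n' unit_n A_def by (simp add: amb.ip_sym[OF x, of n])
  have "ip (du v + c *\<^sub>R n) ?w = 0" by (simp only: metric_prod_simps(5,7) a b)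
  then have ww: "ip ?w ?w = 0" unfolding vc .
  have "?w = 0"
  proof (rule ccontr)
    assume "?w \<noteq> 0"
    from amb.pos_g[OF x this] show False unfolding ww by (rule less_irrefl[THEN notE])
  qed
  then show ?thesis by simp
qed

lemma A_sym: "A a b = A b a"
  unfolding A_def K_def by (simp add: ddu_commute[OF y, of a b] amb.Gam_sym[OF x, of "du a"])

text \<open>After \<open>K_decomp\<close> the tangential parts cancel against the products of
  \<open>sf.Gam\<close>, and only products of \<open>A\<close> remain.\<close>

lemma Gauss: "sf.Rm y a b b a = amb.Rm (u y) (du a) (du b) (du b) (du a) + A a a * A b b - (A a b)\<^sup>2"
  unfolding Gauss_equation[OF y] K_decomp metric_prod_simps normal_n normal_n' unit_n h_prod[OF y]
  by (simp add: power2_eq_square)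

text \<open>The matrix \<open>P\<close> is the inverse metric assembled from the inverse of
  \<open>h\<close> on the tangent plane and from \<open>n\<close>. That it inverts \<open>g\<close>
  is tested on the vectors provided by \<open>frame\<close>.\<close>

lemma trace_split:
  assumes "\<And>w. linear (\<lambda>v. \<beta> v w)" "\<And>v. linear (\<beta> v)"
  shows "amb.tr (u y) \<beta> = sf.tr y (\<lambda>a b. \<beta> (du a) (du b)) + \<beta> n n"
proof -
  let ?hi = "matrix_inv (h y)" and ?e = "\<lambda>i. axis i 1"
  define P :: "real ^ 3 ^ 3" where
    "P = (\<chi> i l. (\<Sum>a\<in>UNIV. \<Sum>b\<in>UNIV. ?hi $ a $ b * (du (?e a) $ i * du (?e b) $ l)) + n $ i * n $ l)"
  have P: "P *v w = (\<Sum>a\<in>UNIV. (\<Sum>b\<in>UNIV. ?hi $ a $ b * (du (?e b) \<bullet> w)) *\<^sub>R du (?e a)) + (n \<bullet> w) *\<^sub>R n" for w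
    by (simp add: P_def vec_eq_iff matrix_vector_mult_def inner_vec_def sum_2 sum_3 algebra_simps)
  have "P *v (g (u y) *v w) = w" for w
  proof -
    obtain v c where w: "w = du v + c *\<^sub>R n" using frame by blast
    have "du (?e b) \<bullet> (g (u y) *v w) = (h y *v v) $ b" for b
    proof -
      have "du (?e b) \<bullet> (g (u y) *v w) = ip (du (?e b)) w" by (simp add: metric_prod_def)
      also have "\<dots> = metric_prod (h y) (?e b) v" unfolding w metric_prod_simps normal_n h_prod[OF y] by simp
      also have "\<dots> = (h y *v v) $ b" by (simp add: metric_prod_def inner_axis')
      finally show ?thesis .
    qed
    moreover have "n \<bullet> (g (u y) *v w) = c"
      using unit_n normal_n' unfolding w by (simp add: metric_prod_def[symmetric] metric_prod_simps)
    moreover have "(\<Sum>b\<in>UNIV. ?hi $ a $ b * (h y *v v) $ b) = v $ a" for a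
    proof -
      have "(?hi *v (h y *v v)) $ a = v $ a" by (simp add: matrix_vector_mul_assoc sf.g_inv[OF y])
      then show ?thesis by (simp add: matrix_vector_mult_def)
    qed
    moreover have "(\<Sum>a\<in>UNIV. v $ a *\<^sub>R du (?e a)) = du v"
      using linear_axis_sum[OF linear_dd[OF diff_u[OF y]]] by metis
    ultimately show ?thesis unfolding P w by simp
  qed
  then have "P ** g (u y) = mat 1"
    by (simp add: matrix_eq matrix_vector_mul_assoc)
  then have "matrix_inv (g (u y)) = P"
    by (metis amb.g_inv(1)[OF x] matrix_mul_assoc matrix_mul_lid matrix_mul_rid)
  then have "amb.tr (u y) \<beta> = (\<Sum>i\<in>UNIV. \<Sum>j\<in>UNIV. P $ i $ j * \<beta> (?e i) (?e j))"
    unfolding amb.tr_def by simp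
  also have "\<dots> = sf.tr y (\<lambda>a b. \<beta> (du a) (du b)) + \<beta> n n"
    unfolding sf.tr_def bilinear_sum_sum[of \<beta>, OF assms, of "du _" "du _"] bilinear_sum_sum[of \<beta>, OF assms, of n n]
    by (simp add: P_def sum_2 sum_3 algebra_simps)
  finally show ?thesis .
qed

lemma h_sym: "h y $ 2 $ 1 = h y $ 1 $ 2"
  unfolding h_def vec_lambda_beta by (rule amb.ip_sym[OF x])

lemma inv_h:
  "matrix_inv (h y) $ 1 $ 1 = h y $ 2 $ 2 / det (h y)" "matrix_inv (h y) $ 2 $ 2 = h y $ 1 $ 1 / det (h y)"
  "matrix_inv (h y) $ 1 $ 2 = - h y $ 1 $ 2 / det (h y)" "matrix_inv (h y) $ 2 $ 1 = - h y $ 1 $ 2 / det (h y)"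
proof -
  have "axis 1 1 $ (2::2) = (0::real)" "axis 2 1 $ (1::2) = (0::real)" "axis 1 1 $ (1::2) = (1::real)"
    "axis 2 1 $ (2::2) = (1::real)" "(1::2) \<noteq> 2" "(2::2) \<noteq> 1"
    by (simp_all add: axis_def)
  note e = this
  note c = matrix_inv_cramer[OF sf.pos_g[OF y]]
  show "matrix_inv (h y) $ 1 $ 1 = h y $ 2 $ 2 / det (h y)" "matrix_inv (h y) $ 2 $ 2 = h y $ 1 $ 1 / det (h y)"
    "matrix_inv (h y) $ 1 $ 2 = - h y $ 1 $ 2 / det (h y)" "matrix_inv (h y) $ 2 $ 1 = - h y $ 1 $ 2 / det (h y)"
    by (simp_all add: c[of 1 1] c[of 2 2] c[of 1 2] c[of 2 1] det_2[of "vec_lambda _"] e h_sym)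
qed

lemma tr_2:
  "sf.tr y \<beta> = (h y $ 2 $ 2 * \<beta> (axis 1 1) (axis 1 1) - h y $ 1 $ 2 * \<beta> (axis 1 1) (axis 2 1)
    - h y $ 1 $ 2 * \<beta> (axis 2 1) (axis 1 1) + h y $ 1 $ 1 * \<beta> (axis 2 1) (axis 2 1)) / det (h y)"
  unfolding sf.tr_def sum_2 inv_h by (simp add: divide_inverse algebra_simps)

lemma det_h: "det (h y) = h y $ 1 $ 1 * h y $ 2 $ 2 - (h y $ 1 $ 2)\<^sup>2" "det (h y) > 0" "h y $ 1 $ 1 > 0" "h y $ 2 $ 2 > 0"
proof -
  note s = h_sym
  show d: "det (h y) = h y $ 1 $ 1 * h y $ 2 $ 2 - (h y $ 1 $ 2)\<^sup>2"
    by (simp add: det_2 s power2_eq_square)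
  show 1: "h y $ 1 $ 1 > 0" "h y $ 2 $ 2 > 0"
    using sf.pos_g[OF y, of "axis 1 1"] sf.pos_g[OF y, of "axis 2 1"] by simp_all
  \<comment> \<open>This vector is orthogonal to \<open>axis 2 1\<close>, and its squared length is
    \<open>h y $ 2 $ 2\<close> times the determinant.\<close>
  have "(h y $ 2 $ 2 *\<^sub>R axis 1 1 - h y $ 1 $ 2 *\<^sub>R axis 2 1 :: real ^ 2) $ 1 \<noteq> 0"
    using 1 by (simp add: axis_def)
  then have "metric_prod (h y) (h y $ 2 $ 2 *\<^sub>R axis 1 1 - h y $ 1 $ 2 *\<^sub>R axis 2 1)
     (h y $ 2 $ 2 *\<^sub>R axis 1 1 - h y $ 1 $ 2 *\<^sub>R axis 2 1) > 0"
    by (intro sf.pos_g[OF y]) (metis zero_index)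
  then have "h y $ 2 $ 2 * det (h y) > 0"
    unfolding d metric_prod_simps metric_prod_axis s by (simp add: algebra_simps power2_eq_square)
  then show "det (h y) > 0" using 1 by (simp add: zero_less_mult_iff)
qed

text \<open>Trace in both slots over tangent plane and normal. The mixed terms make up Ric(n, n) a
  second time, and the purely tangential double trace is twice the sectional curvature of the
  tangent plane.\<close>

lemma scalar_curvature_split:
  "scalar_curv S g (u y) = 2 * amb.Ric (u y) n n
    + 2 * amb.Rm (u y) (du (axis 1 1)) (du (axis 2 1)) (du (axis 2 1)) (du (axis 1 1)) / det (h y)"
proof -
  let ?R = "amb.Rm (u y)" and ?t = "sf.tr y"
  note a1 = amb.Rm_antisym1[OF x] and a2 = amb.Rm_antisym2[OF x] and simps = amb.Rm_simps[OF x]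
  have z1: "?R a a c d = 0" and z2: "?R a b c c = 0" for a b c d
    using a1[of a a c d] a2[of a b c c] by simp_all
  have Ric: "amb.Ric (u y) b c = ?t (\<lambda>a d. ?R (du a) b c (du d)) + ?R n b c n" for b c
    unfolding amb.Ric_def by (rule trace_split) (auto intro!: linearI simp: simps)
  have "scalar_curv S g (u y) = ?t (\<lambda>b c. amb.Ric (u y) (du b) (du c)) + amb.Ric (u y) n n"
    unfolding amb.scalar_curv_Ric[OF x] by (rule trace_split) (auto intro!: linearI simp: amb.Ric_simps[OF x])
  moreover have "?t (\<lambda>b c. amb.Ric (u y) (du b) (du c))
    = ?t (\<lambda>b c. ?t (\<lambda>a d. ?R (du a) (du b) (du c) (du d))) + ?t (\<lambda>b c. ?R n (du b) (du c) n)"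
    unfolding Ric sf.tr_def by (simp add: sum.distrib distrib_left)
  moreover have "?R n (du b) (du c) n = ?R (du b) n n (du c)" for b c
    using a1[of "du b" n n "du c"] a2[of n "du b" "du c" n] by simp
  moreover have "amb.Ric (u y) n n = ?t (\<lambda>a d. ?R (du a) n n (du d))"
    unfolding Ric by (simp add: z1)
  moreover have "?t (\<lambda>b c. ?t (\<lambda>a d. ?R (du a) (du b) (du c) (du d)))
    = 2 * ?R (du (axis 1 1)) (du (axis 2 1)) (du (axis 2 1)) (du (axis 1 1)) / det (h y)"
  proof -
    let ?p = "du (axis 1 1)" and ?q = "du (axis 2 1)"
    have "?R ?q ?p c d = - ?R ?p ?q c d" "?R ?p ?q ?p ?q = - ?R ?p ?q ?q ?p" for c d
      using a1[of ?q ?p c d] a2[of ?p ?q ?q ?p] by simp_all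
    then show ?thesis
      unfolding tr_2 using det_h(2)
      by (simp add: z1 z2 divide_simps) (simp add: det_h(1) power2_eq_square algebra_simps)
  qed
  ultimately show ?thesis by simp
qed

text \<open>In dimension 2 the squared norm is the squared trace minus twice the determinant, all
  taken relative to \<open>h\<close>, and the trace vanishes.\<close>

lemma second_form_norm:
  assumes "sf.tr y A = 0"
  shows "(\<Sum>i\<in>UNIV. \<Sum>j\<in>UNIV. \<Sum>k\<in>UNIV. \<Sum>l\<in>UNIV. matrix_inv (h y) $ i $ k * matrix_inv (h y) $ j $ l
      * A (axis i 1) (axis j 1) * A (axis k 1) (axis l 1))
    = 2 * ((A (axis 1 1) (axis 2 1))\<^sup>2 - A (axis 1 1) (axis 1 1) * A (axis 2 1) (axis 2 1)) / det (h y)" (is "?N = ?M")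
    and "2 * ((A (axis 1 1) (axis 2 1))\<^sup>2 - A (axis 1 1) (axis 1 1) * A (axis 2 1) (axis 2 1)) / det (h y) \<ge> 0"
proof -
  let ?p = "A (axis 1 1) (axis 1 1)" and ?q = "A (axis 1 1) (axis 2 1)" and ?r = "A (axis 2 1) (axis 2 1)"
  let ?E = "h y $ 1 $ 1" and ?F = "h y $ 1 $ 2" and ?G = "h y $ 2 $ 2" and ?d = "det (h y)"
  note s = h_sym and inv = inv_h
  have q: "A (axis 2 1) (axis 1 1) = ?q" by (rule A_sym)
  have H: "?G * ?p - 2 * ?F * ?q + ?E * ?r = 0"
    using assms det_h(2) unfolding tr_2 q by simp
  have "?N = (?G * ?G * ?p * ?p - 4 * ?G * ?F * ?p * ?q + 2 * ?E * ?G * ?q * ?q + 2 * ?F * ?F * ?q * ?q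
     + 2 * ?F * ?F * ?p * ?r - 4 * ?E * ?F * ?q * ?r + ?E * ?E * ?r * ?r) / (?d * ?d)"
    unfolding sum_2 inv q using det_h(2) by (simp add: field_simps)
  also have "\<dots> = ((?G * ?p - 2 * ?F * ?q + ?E * ?r)\<^sup>2 + 2 * (?E * ?G - ?F\<^sup>2) * (?q\<^sup>2 - ?p * ?r)) / (?d * ?d)"
    by (simp add: power2_eq_square algebra_simps)
  also have "\<dots> = ?M"
    unfolding H det_h(1)[symmetric] using det_h(2) by simp
  finally show "?N = ?M" .
  \<comment> \<open>The vector is chosen so that its squared length is E q^2 - 2 F p q + G p^2;
    vanishing trace replaces G p by 2 F q - E r.\<close>
  have "?E * (?q\<^sup>2 - ?p * ?r) = metric_prod (h y) (?q *\<^sub>R axis 1 1 - ?p *\<^sub>R axis 2 1) (?q *\<^sub>R axis 1 1 - ?p *\<^sub>R axis 2 1)"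
    unfolding metric_prod_simps metric_prod_axis s using H by (simp add: power2_eq_square) algebra
  also have "\<dots> \<ge> 0"
    using sf.pos_g[OF y] by (metis less_eq_real_def metric_prod_simps(9))
  finally have "?q\<^sup>2 - ?p * ?r \<ge> 0" using det_h(3) by (simp add: zero_le_mult_iff)
  then show "?M \<ge> 0" using det_h(2) by simp
qed

text \<open>The sectional curvature of the tangent plane equals K + |A|^2/2 by \<open>Gauss\<close>
  and \<open>second_form_norm\<close>; insert this into
  \<open>scalar_curvature_split\<close>.\<close>

lemma Gauss_curvature_minimal:
  assumes "sf.tr y A = 0"
  shows "amb.Ric (u y) n n = scalar_curv S g (u y) / 2 - gauss_curv D h y
    - (\<Sum>i\<in>UNIV. \<Sum>j\<in>UNIV. \<Sum>k\<in>UNIV. \<Sum>l\<in>UNIV. matrix_inv (h y) $ i $ k * matrix_inv (h y) $ j $ l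
      * A (axis i 1) (axis j 1) * A (axis k 1) (axis l 1)) / 2"
  unfolding second_form_norm(1)[OF assms] scalar_curvature_split gauss_curv_def sf.riem4_Rm[OF y] Gauss
  by (simp add: diff_divide_distrib add_divide_distrib)

text \<open>Tracing \<open>Hs_comp\<close> over the surface leaves df(n) times the mean curvature,
  which is 0. The tangential trace of the ambient Hessian is its full trace without the normal
  direction.\<close>

lemma laplacian_minimal:
  assumes "sf.tr y A = 0" and f: "smooth_on S f"
  shows "laplacian D h (\<lambda>z. f (u z)) y = laplacian S g f (u y) - amb.Hs f (u y) n n"
proof -
  have lin: "linear (\<lambda>v. dd S f v (u y))" by (rule linear_dd[OF smooth_on_differentiable[OF amb.S f x]])
  have "sf.Hs (\<lambda>z. f (u z)) y a b = amb.Hs f (u y) (du a) (du b) + A a b * dd S f n (u y)" for a b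
    unfolding Hs_comp[OF y f] K_decomp using linear_scale[OF lin] by simp
  then have "laplacian D h (\<lambda>z. f (u z)) y
    = sf.tr y (\<lambda>a b. amb.Hs f (u y) (du a) (du b)) + sf.tr y A * dd S f n (u y)"
    unfolding sf.laplacian_Hs[OF y smooth_on_compose[OF smooth_u f sub]]
    by (simp add: sf.tr_def sum.distrib distrib_left sum_distrib_left sum_distrib_right mult_ac)
  moreover have "laplacian S g f (u y) = sf.tr y (\<lambda>a b. amb.Hs f (u y) (du a) (du b)) + amb.Hs f (u y) n n"
    unfolding amb.laplacian_Hs[OF x f]
    by (rule trace_split) (auto intro!: linearI simp: amb.Hs_simps[OF x f])
  ultimately show ?thesis using assms(1) by simp
qed

end


section \<open>Restriction, gradients and conormals\<close>

text \<open>A patch \<open>loc_dom F b c\<close> may be a proper part of \<open>cimg b\<close>. This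
  lemma and those built on it move derivatives, curvature and Laplacian between the two
  domains.\<close>

lemma dd_restrict:
  fixes u :: "real ^ 'n::{finite,one} \<Rightarrow> 'b::real_normed_vector"
  assumes "openin (top_of_set half_space) S" "openin (top_of_set half_space) S'" "S' \<subseteq> S" "x \<in> S'"
    "\<And>y. y \<in> S' \<Longrightarrow> u y = w y"
  shows "dd S u v x = dd S' w v x"
proof -
  obtain O' where O: "open O'" "S' = half_space \<inter> O'" using assms(2) openin_open by blast
  have "S \<subseteq> half_space" using assms(1) openin_imp_subset by blast
  then show ?thesis
    by (intro dd_cong[OF O(1)]) (use assms(3-5) O(2) in auto)
qed

lemma christoffel_restrict:
  fixes g :: "real ^ 'n::{finite,one} \<Rightarrow> ((real, 'n) vec, 'n) vec"
  assumes "openin (top_of_set half_space) S" "openin (top_of_set half_space) S'" "S' \<subseteq> S" "x \<in> S'"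
    "\<And>y. y \<in> S' \<Longrightarrow> g y = g' y"
  shows "christoffel S g k i j x = christoffel S' g' k i j x"
proof -
  have "pd S i (\<lambda>y. g y $ j $ l) x = pd S' i (\<lambda>y. g' y $ j $ l) x" for i j l
    unfolding pd_dd by (rule dd_restrict[OF assms(1-4)]) (simp add: assms(5))
  then show ?thesis unfolding christoffel_def by (simp add: assms(4,5))
qed

lemma riem4_restrict:
  fixes g :: "real ^ 'n::{finite,one} \<Rightarrow> ((real, 'n) vec, 'n) vec"
  assumes "openin (top_of_set half_space) S" "openin (top_of_set half_space) S'" "S' \<subseteq> S" "x \<in> S'"
    "\<And>y. y \<in> S' \<Longrightarrow> g y = g' y"
  shows "riem4 S g i j k l x = riem4 S' g' i j k l x"
proof -
  note c = christoffel_restrict[OF assms(1-3) _ assms(5)]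
  have "pd S i (christoffel S g l j k) x = pd S' i (christoffel S' g' l j k) x" for i l j
    unfolding pd_dd by (rule dd_restrict[OF assms(1-4)]) (rule c)
  then show ?thesis unfolding riem4_def riem_def by (simp add: c assms(4,5))
qed

lemma gauss_curv_restrict:
  assumes "openin (top_of_set half_space) S" "openin (top_of_set half_space) S'" "S' \<subseteq> S" "x \<in> S'"
    "\<And>y. y \<in> S' \<Longrightarrow> g y = g' y"
  shows "gauss_curv S g x = gauss_curv S' g' x"
  unfolding gauss_curv_def by (simp add: riem4_restrict[OF assms] assms(4,5))

lemma laplacian_restrict:
  fixes g :: "real ^ 'n::{finite,one} \<Rightarrow> ((real, 'n) vec, 'n) vec"
  assumes "openin (top_of_set half_space) S" "openin (top_of_set half_space) S'" "S' \<subseteq> S" "x \<in> S'"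
    "\<And>y. y \<in> S' \<Longrightarrow> g y = g' y" "\<And>y. y \<in> S' \<Longrightarrow> u y = u' y"
  shows "laplacian S g u x = laplacian S' g' u' x"
proof -
  have p: "pd S i u y = pd S' i u' y" if "y \<in> S'" for i y
    unfolding pd_dd by (rule dd_restrict[OF assms(1-3) that assms(6)])
  have "pd S i (pd S j u) x = pd S' i (pd S' j u') x" for i j
    unfolding pd_dd[of _ i] by (rule dd_restrict[OF assms(1-4) p])
  then show ?thesis
    unfolding laplacian_def hessian_def
    by (simp add: p[OF assms(4)] christoffel_restrict[OF assms(1-5)] assms(4,5))
qed


section \<open>Gradients, their covariant derivatives, and continuity of the coordinate
  expressions\<close>

context metric_domain
begin

lemma ip_grad: "x \<in> S \<Longrightarrow> u differentiable (at x within S) \<Longrightarrow> metric_prod (g x) a (grad S g u x) = dd S u a x"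
  by (simp add: metric_prod_def grad_def matrix_vector_mul_assoc g_inv dd_pd inner_vec_def)

lemma cov_deriv_dd:
  assumes "x \<in> S" "Y differentiable (at x within S)"
  shows "cov_deriv S g w Y x = dd S Y w x + Gam x w (Y x)"
proof -
  have "pd S a (\<lambda>y. Y y $ k) x = dd S Y (axis a 1) x $ k" for a k
    unfolding pd_dd by (rule dd_linear_image[OF S assms bounded_linear_vec_nth])
  moreover have "dd S Y w x $ k = (\<Sum>a\<in>UNIV. w $ a * dd S Y (axis a 1) x $ k)" for k
    using dd_pd[OF assms(2), of w] by (simp add: pd_dd)
  moreover have "Gam x w (Y x) $ k = (\<Sum>a\<in>UNIV. w $ a * (\<Sum>b\<in>UNIV. christoffel S g k a b x * Y x $ b))" for k
  proof -
    have "Gam x w (Y x) = (\<Sum>a\<in>UNIV. \<Sum>b\<in>UNIV. (w $ a * Y x $ b) *\<^sub>R Gam x (axis a 1) (axis b 1))"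
      by (rule bilinear_sum_sum[OF linear_Gam[OF assms(1)]])
    then show ?thesis by (simp add: christoffel_Gam[OF assms(1)] sum_distrib_left mult_ac)
  qed
  ultimately show ?thesis
    unfolding cov_deriv_def by (simp add: vec_eq_iff sum.distrib distrib_left)
qed

lemma differentiable_grad:
  assumes x: "x \<in> S" and u: "smooth_on S u"
  shows "grad S g u differentiable (at x within S)"
proof -
  have inv: "(\<lambda>y. matrix_inv (g y) $ k $ l) differentiable (at x within S)" for k l
    by (rule differentiable_matrix_inv[OF diff_g[OF x] x pos_g])
  have p: "pd S i u differentiable (at x within S)" for i
    by (rule smooth_on_differentiable[OF S smooth_on_pd[OF S u] x])
  have "(\<lambda>y. grad S g u y $ k) differentiable (at x within S)" for k
    unfolding grad_def matrix_vector_mult_def by (simp add: inv p differentiable_mult differentiable_sum)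
  then show ?thesis
    unfolding differentiable_componentwise_within[of "grad S g u"]
    by (auto simp: Basis_vec_def inner_axis)
qed

text \<open>Differentiate \<open>ip_grad\<close> with \<open>a\<close> held fixed. The derivative of
  the metric splits by \<open>dg_L\<close> into one term for the covariant derivative of the
  gradient and one for the Hessian.\<close>

lemma ip_nabla_grad:
  assumes x: "x \<in> S" and u: "smooth_on S u"
  shows "metric_prod (g x) a (dd S (grad S g u) w x + Gam x w (grad S g u x)) = Hs u x w a"
proof -
  let ?v = "grad S g u"
  have du: "u differentiable (at z within S)" if "z \<in> S" for z by (rule smooth_on_differentiable[OF S u that])
  have "((\<lambda>z. metric_prod (g z) a (?v z)) has_derivative (\<lambda>v. metric_prod (dd S g v x) a (?v x)
      + metric_prod (g x) 0 (?v x) + metric_prod (g x) a (dd S ?v v x))) (at x within S)"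
    by (rule has_derivative_metric_prod[OF has_derivative_dd[OF diff_g[OF x]] has_derivative_const
          has_derivative_dd[OF differentiable_grad[OF x u]]])
  then have "dd S (\<lambda>z. metric_prod (g z) a (?v z)) w x
    = metric_prod (dd S g w x) a (?v x) + metric_prod (g x) a (dd S ?v w x)"
    using dd_eqI[OF S x] by (simp add: metric_prod_simps)
  moreover have "dd S (\<lambda>z. metric_prod (g z) a (?v z)) w x = dd S (dd S u a) w x"
    by (rule dd_cong_on[OF x ip_grad[OF _ du]])
  moreover have "metric_prod (dd S g w x) a (?v x) = metric_prod (g x) a (Gam x w (?v x)) + dd S u (Gam x w a) x"
    unfolding dg_L[OF x] ip_Gam[OF x, symmetric] ip_grad[OF x du[OF x], symmetric]
    by (simp add: ip_sym[OF x, of "?v x"])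
  ultimately show ?thesis unfolding Hs_def metric_prod_simps by simp
qed

text \<open>The derivative of the normalizing factor multiplies the gradient, which is orthogonal to
  \<open>n\<close>. Hence the factor acts like a constant and only the Hessian remains.\<close>

lemma cov_deriv_unit_grad:
  assumes x: "x \<in> S" and u: "smooth_on S u" and nz: "grad S g u x \<noteq> 0"
    and n: "metric_prod (g x) (grad S g u x) n = 0"
  shows "metric_prod (g x) (cov_deriv S g n
      (\<lambda>z. let v = grad S g u z in - (1 / sqrt (metric_prod (g z) v v)) *\<^sub>R v) x) n
    = - Hs u x n n / sqrt (metric_prod (g x) (grad S g u x) (grad S g u x))"
proof -
  let ?v = "grad S g u"
  let ?\<mu> = "\<lambda>z. - (1 / sqrt (metric_prod (g z) (?v z) (?v z)))"
  have pos: "metric_prod (g x) (?v x) (?v x) > 0" by (rule pos_g[OF x nz])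
  note v = has_derivative_dd[OF differentiable_grad[OF x u]]
  obtain P where P: "((\<lambda>z. metric_prod (g z) (?v z) (?v z)) has_derivative P) (at x within S)"
    using has_derivative_metric_prod[OF has_derivative_dd[OF diff_g[OF x]] v v] by blast
  have "((\<lambda>z. sqrt (metric_prod (g z) (?v z) (?v z))) has_derivative
      (\<lambda>w. P w * (inverse (sqrt (metric_prod (g x) (?v x) (?v x))) / 2))) (at x within S)"
    using DERIV_compose_FDERIV[OF DERIV_real_sqrt[OF pos] P] by simp
  then have "(\<lambda>z. sqrt (metric_prod (g z) (?v z) (?v z))) differentiable (at x within S)"
    unfolding differentiable_def by blast
  then have "(\<lambda>z. 1 / sqrt (metric_prod (g z) (?v z) (?v z))) differentiable (at x within S)"
    using pos by (intro differentiable_divide) auto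
  then have "?\<mu> differentiable (at x within S)" by (rule differentiable_minus)
  note \<mu> = has_derivative_dd[OF this]
  note X = has_derivative_scaleR[OF \<mu> v]
  have dX: "(\<lambda>z. ?\<mu> z *\<^sub>R ?v z) differentiable (at x within S)" using X differentiable_def by blast
  define W where "W = dd S ?v n x + Gam x n (?v x)"
  have "cov_deriv S g n (\<lambda>z. ?\<mu> z *\<^sub>R ?v z) x = ?\<mu> x *\<^sub>R W + dd S ?\<mu> n x *\<^sub>R ?v x"
    unfolding cov_deriv_dd[OF x dX] dd_eqI[OF S x X] Gam_simps[OF x] W_def by (simp add: algebra_simps)
  then have "metric_prod (g x) (cov_deriv S g n (\<lambda>z. ?\<mu> z *\<^sub>R ?v z) x) n = ?\<mu> x * metric_prod (g x) n W"
    by (simp only: metric_prod_simps(5,7) n ip_sym[OF x, of W n])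
  then show ?thesis unfolding W_def ip_nabla_grad[OF x u] Let_def by simp
qed

lemma continuous_on_matrix_inv: "continuous_on S (\<lambda>x. matrix_inv (g x) $ k $ l)"
  unfolding continuous_on_eq_continuous_within
  by (intro ballI differentiable_imp_continuous_within differentiable_matrix_inv[OF diff_g _ pos_g])

lemma continuous_on_christoffel: "continuous_on S (\<lambda>x. christoffel S g k i j x)"
proof -
  have "continuous_on S (\<lambda>x. Gam x (axis i 1) (axis j 1) $ k)"
    unfolding continuous_on_eq_continuous_within
    by (intro ballI continuous_component differentiable_imp_continuous_within differentiable_Gam)
  then show ?thesis using christoffel_Gam by (simp cong: continuous_on_cong)
qed

lemma continuous_on_laplacian:
  assumes u: "smooth_on S u"
  shows "continuous_on S (laplacian S g u)"
proof -
  have p: "continuous_on S (pd S i u)" and pp: "continuous_on S (pd S i (pd S j u))" for i j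
    using smooth_on_continuous[OF S] smooth_on_pd[OF S] u by blast+
  show ?thesis
    unfolding laplacian_def[abs_def] hessian_def[abs_def]
    by (intro continuous_on_sum continuous_on_mult continuous_on_diff continuous_on_matrix_inv
        continuous_on_christoffel p pp)
qed

end


text \<open>The vector in parentheses is orthogonal to the boundary direction
  \<open>axis 2 1\<close> and has squared length \<open>h $ 2 $ 2 * det h\<close>; the negative
  factor normalizes it and makes it point outward. The formula replaces the definite description and
  shows the continuous dependence on \<open>h\<close>.\<close>

lemma outward_conormal_eq:
  fixes h :: "real ^ 2 ^ 2"
  assumes sym: "transpose h = h" and pos: "\<And>v. v \<noteq> 0 \<Longrightarrow> metric_prod h v v > 0"
  shows "outward_conormal h = (- 1 / sqrt (h $ 2 $ 2 * det h)) *\<^sub>R (h $ 2 $ 2 *\<^sub>R axis 1 1 - h $ 1 $ 2 *\<^sub>R axis 2 1)"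
    and "h $ 2 $ 2 * det h > 0"
proof -
  have "h $ 2 $ 1 = transpose h $ 1 $ 2" by (simp add: transpose_def)
  then have s: "h $ 2 $ 1 = h $ 1 $ 2" using sym by simp
  have G: "h $ 2 $ 2 > 0" using pos[of "axis 2 1"] by simp
  define W :: "real ^ 2" where "W = h $ 2 $ 2 *\<^sub>R axis 1 1 - h $ 1 $ 2 *\<^sub>R axis 2 1"
  have w1: "W $ 1 = h $ 2 $ 2" and w2: "W $ 2 = - h $ 1 $ 2" by (simp_all add: W_def axis_def)
  have ww: "metric_prod h W W = h $ 2 $ 2 * det h"
    unfolding W_def metric_prod_simps metric_prod_axis det_2 s by (simp add: algebra_simps)
  have "W \<noteq> 0" using w1 G by auto
  then show d: "h $ 2 $ 2 * det h > 0" using pos[of W] unfolding ww by simp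
  have we: "metric_prod h W (axis 2 1) = 0"
    unfolding W_def metric_prod_simps metric_prod_axis s by simp
  define \<mu> where "\<mu> = - 1 / sqrt (h $ 2 $ 2 * det h)"
  define t where "t = sqrt (h $ 2 $ 2 * det h)"
  have t: "t > 0" "h $ 2 $ 2 * det h = t * t" using d unfolding t_def by simp_all
  have \<mu>: "\<mu> < 0" "\<mu> * \<mu> * (h $ 2 $ 2 * det h) = 1"
    using t(1) unfolding t(2) \<mu>_def t_def[symmetric] by simp_all
  have tan: "(\<forall>w. w $ 1 = 0 \<longrightarrow> metric_prod h v w = 0) \<longleftrightarrow> metric_prod h v (axis 2 1) = 0" for v
  proof
    assume "\<forall>w. w $ 1 = 0 \<longrightarrow> metric_prod h v w = 0"
    then show "metric_prod h v (axis 2 1) = 0" by (simp add: axis_def)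
  next
    assume *: "metric_prod h v (axis 2 1) = 0"
    show "\<forall>w. w $ 1 = 0 \<longrightarrow> metric_prod h v w = 0"
    proof (intro allI impI)
      fix w :: "real ^ 2" assume "w $ 1 = 0"
      then have "w = w $ 2 *\<^sub>R axis 2 1" by (simp add: vec_eq_iff forall_2 axis_def)
      then have "metric_prod h v w = w $ 2 * metric_prod h v (axis 2 1)"
        using metric_prod_simps(12)[of h v "w $ 2" "axis 2 1"] by simp
      then show "metric_prod h v w = 0" using * by simp
    qed
  qed
  have "outward_conormal h = \<mu> *\<^sub>R W"
    unfolding outward_conormal_def tan
  proof (rule the_equality)
    show "metric_prod h (\<mu> *\<^sub>R W) (\<mu> *\<^sub>R W) = 1 \<and> metric_prod h (\<mu> *\<^sub>R W) (axis 2 1) = 0 \<and> (\<mu> *\<^sub>R W) $ 1 < 0"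
      using \<mu> G by (simp add: metric_prod_simps(7,12) ww we w1 mult_neg_pos mult.assoc)
  next
    fix v assume v: "metric_prod h v v = 1 \<and> metric_prod h v (axis 2 1) = 0 \<and> v $ 1 < 0"
    define r where "r = v $ 1 / h $ 2 $ 2"
    have e: "v = v $ 1 *\<^sub>R axis 1 1 + v $ 2 *\<^sub>R axis 2 1" by (simp add: vec_eq_iff forall_2 axis_def)
    have "metric_prod h v (axis 2 1) = v $ 1 * h $ 1 $ 2 + v $ 2 * h $ 2 $ 2"
      by (subst e) (simp only: metric_prod_simps(5,7) metric_prod_axis)
    then have v2: "v $ 2 = - r * h $ 1 $ 2" using v G by (simp add: r_def field_simps)
    have v1: "v $ 1 = r * h $ 2 $ 2" using G by (simp add: r_def)
    have vr: "v = r *\<^sub>R W" by (simp add: vec_eq_iff forall_2 w1 w2 v1 v2)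
    have "r * r * (h $ 2 $ 2 * det h) = 1"
      using v unfolding vr by (simp add: metric_prod_simps(7,12) ww mult.assoc)
    then have "r * r = \<mu> * \<mu>" using \<mu>(2) d by (metis mult_right_cancel less_irrefl)
    moreover have "r < 0" using v G unfolding r_def by (simp add: divide_neg_pos)
    ultimately have "r = \<mu>" using \<mu>(1) by (simp add: square_eq_iff)
    then show "v = \<mu> *\<^sub>R W" using vr by simp
  qed
  then show "outward_conormal h = (- 1 / sqrt (h $ 2 $ 2 * det h)) *\<^sub>R (h $ 2 $ 2 *\<^sub>R axis 1 1 - h $ 1 $ 2 *\<^sub>R axis 2 1)"
    unfolding \<mu>_def W_def .
qed


section \<open>Charts and their inverses\<close>

lemma manifold_chart_inj: "manifold_chart T c \<Longrightarrow> inj_on (coord c) (cdom c)"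
  unfolding manifold_chart_def
  by (metis homeomorphic_imp_injective_map inf.absorb_iff2 openin_subset topspace_subtopology)

lemma param_coord: "manifold_chart T c \<Longrightarrow> p \<in> cdom c \<Longrightarrow> param c (coord c p) = p"
  unfolding param_def by (simp add: manifold_chart_inj)

lemma param_in: "y \<in> cimg c \<Longrightarrow> param c y \<in> cdom c"
  and coord_param: "y \<in> cimg c \<Longrightarrow> coord c (param c y) = y"
  unfolding param_def cimg_def by (auto intro: inv_into_into f_inv_into_f)

lemma coord_image_openin:
  assumes c: "manifold_chart T c" and V: "openin T V"
  shows "openin (top_of_set half_space) (coord c ` (V \<inter> cdom c))"
proof -
  have "open_map (subtopology T (cdom c)) (top_of_set (cimg c)) (coord c)"
    using c homeomorphic_imp_open_map unfolding manifold_chart_def by blast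
  moreover have "openin (subtopology T (cdom c)) (V \<inter> cdom c)"
    using V openin_subtopology by blast
  ultimately have "openin (top_of_set (cimg c)) (coord c ` (V \<inter> cdom c))"
    unfolding open_map_def by blast
  moreover have "openin (top_of_set half_space) (cimg c)" using c unfolding manifold_chart_def by blast
  ultimately show ?thesis by (rule openin_trans)
qed

lemma loc_dom_subset: "loc_dom F b c \<subseteq> cimg b"
  unfolding loc_dom_def cimg_def by blast


section \<open>Minimal surfaces in static vacuum spaces\<close>

text \<open>The pointwise geometry. The length measure is added in
  \<open>static_surface_length\<close>, and stability is what \<open>not_stable\<close> refutes
  there.\<close>

locale static_surface =
  fixes T :: "'a topology" and A :: "('a, 3) chart set"
    and G :: "('a, 3) chart \<Rightarrow> real ^ 3 \<Rightarrow> real ^ 3 ^ 3" and f :: "'a \<Rightarrow> real" and R c :: real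
    and TS :: "'b topology" and B :: "('b, 2) chart set" and F :: "'b \<Rightarrow> 'a"
    and N :: "('a, 3) chart \<Rightarrow> 'b \<Rightarrow> real ^ 3"
  assumes man: "riemannian_manifold T A G"
    and smooth_f: "smooth_fun A f"
    and pos_f: "p \<in> topspace T \<Longrightarrow> f p > 0"
    and scalar: "a \<in> A \<Longrightarrow> x \<in> cimg a \<Longrightarrow> scalar_curv (cimg a) (G a) x = R"
    and static: "a \<in> A \<Longrightarrow> x \<in> cimg a \<Longrightarrow> f (param a x) * ricci (cimg a) (G a) i j x
      = hessian (cimg a) (G a) (f \<circ> param a) i j x + R / 2 * f (param a x) * G a x $ i $ j"
    and lap_f: "a \<in> A \<Longrightarrow> x \<in> cimg a \<Longrightarrow>
      laplacian (cimg a) (G a) (f \<circ> param a) x + R / 2 * f (param a x) = 0"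
    and level: "level_boundary T A G f c"
    and man_S: "smooth_manifold TS B"
    and compact_S: "compact_space TS"
    and imm: "immersion TS B T A F"
    and unit_normal: "unit_normal_field TS B A G F N"
    and minimal: "minimal B A G F N"
    and free: "free_boundary TS B A G f F"
    and gauss_pos: "positive_gauss_curvature B A G F"
begin

abbreviation H :: "('b, 2) chart \<Rightarrow> real ^ 2 \<Rightarrow> real ^ 2 ^ 2" where
  "H \<equiv> induced_metric A G F"

abbreviation \<phi> :: "'b \<Rightarrow> real" where
  "\<phi> \<equiv> f \<circ> F"

lemma chart_A: "a \<in> A \<Longrightarrow> manifold_chart T a"
  using man unfolding riemannian_manifold_def smooth_manifold_def by blast

lemma chart_B: "b \<in> B \<Longrightarrow> manifold_chart TS b"
  using man_S unfolding smooth_manifold_def by blast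

lemma cdom_A: "a \<in> A \<Longrightarrow> openin T (cdom a)" and cdom_B: "b \<in> B \<Longrightarrow> openin TS (cdom b)"
  and cimg_A: "a \<in> A \<Longrightarrow> openin (top_of_set half_space) (cimg a)"
  and cimg_B: "b \<in> B \<Longrightarrow> openin (top_of_set half_space) (cimg b)"
  using chart_A chart_B unfolding manifold_chart_def by blast+

lemma in_topspace: "b \<in> B \<Longrightarrow> q \<in> cdom b \<Longrightarrow> q \<in> topspace TS"
  using cdom_B openin_subset by blast

lemma F_topspace: "q \<in> topspace TS \<Longrightarrow> F q \<in> topspace T"
  using imm unfolding immersion_def continuous_map_def by blast

lemma chart_at_A: "p \<in> topspace T \<Longrightarrow> chart_at A p \<in> A" "p \<in> topspace T \<Longrightarrow> p \<in> cdom (chart_at A p)"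
proof -
  assume "p \<in> topspace T"
  then have "\<exists>a. a \<in> A \<and> p \<in> cdom a"
    using man unfolding riemannian_manifold_def smooth_manifold_def by blast
  then have "chart_at A p \<in> A \<and> p \<in> cdom (chart_at A p)" unfolding chart_at_def by (rule someI_ex)
  then show "chart_at A p \<in> A" "p \<in> cdom (chart_at A p)" by auto
qed

lemma chart_at_B: "q \<in> topspace TS \<Longrightarrow> chart_at B q \<in> B" "q \<in> topspace TS \<Longrightarrow> q \<in> cdom (chart_at B q)"
proof -
  assume "q \<in> topspace TS"
  then have "\<exists>b. b \<in> B \<and> q \<in> cdom b"
    using man_S unfolding smooth_manifold_def by blast
  then have "chart_at B q \<in> B \<and> q \<in> cdom (chart_at B q)" unfolding chart_at_def by (rule someI_ex)
  then show "chart_at B q \<in> B" "q \<in> cdom (chart_at B q)" by auto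
qed

lemma ambient_domain:
  assumes "a \<in> A"
  shows "metric_domain (cimg a) (G a)"
  using man assms cimg_A[OF assms]
  unfolding riemannian_manifold_def riemannian_metric_def by unfold_locales auto

lemma smooth_f_param: "a \<in> A \<Longrightarrow> smooth_on (cimg a) (f \<circ> param a)"
  using smooth_f unfolding smooth_fun_def by blast

lemma loc_dom_openin:
  assumes "b \<in> B" "a \<in> A"
  shows "openin (top_of_set half_space) (loc_dom F b a)"
proof -
  have "openin TS {q \<in> topspace TS. F q \<in> cdom a}"
    using imm cdom_A[OF assms(2)] unfolding immersion_def continuous_map_def by blast
  from coord_image_openin[OF chart_B[OF assms(1)] this]
  have "openin (top_of_set half_space) (coord b ` ({q \<in> topspace TS. F q \<in> cdom a} \<inter> cdom b))" .
  moreover have "{q \<in> topspace TS. F q \<in> cdom a} \<inter> cdom b = {q \<in> cdom b. F q \<in> cdom a}"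
    using in_topspace[OF assms(1)] by blast
  ultimately show ?thesis unfolding loc_dom_def by simp
qed

lemma loc_dom_point:
  assumes "b \<in> B" "a \<in> A" "y \<in> loc_dom F b a"
  shows "param b y \<in> cdom b" "coord b (param b y) = y" "F (param b y) \<in> cdom a"
    "loc_map F b a y = coord a (F (param b y))" "loc_map F b a y \<in> cimg a"
    "param a (loc_map F b a y) = F (param b y)"
proof -
  obtain q where q: "q \<in> cdom b" "F q \<in> cdom a" "y = coord b q" using assms(3) unfolding loc_dom_def by blast
  have p: "param b y = q" unfolding q(3) by (rule param_coord[OF chart_B[OF assms(1)] q(1)])
  show "param b y \<in> cdom b" "coord b (param b y) = y" "F (param b y) \<in> cdom a" using p q by auto
  show l: "loc_map F b a y = coord a (F (param b y))" by (simp add: loc_map_def)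
  show "loc_map F b a y \<in> cimg a" unfolding l p cimg_def using q(2) by blast
  show "param a (loc_map F b a y) = F (param b y)" unfolding l p by (rule param_coord[OF chart_A[OF assms(2)] q(2)])
qed

lemma push_dd: "push F b a y v = dd (loc_dom F b a) (loc_map F b a) v y"
  by (simp add: push_def dd_def)

lemma patch:
  assumes "b \<in> B" "a \<in> A"
  shows "immersed_patch (cimg a) (G a) (loc_dom F b a) (loc_map F b a)"
proof -
  interpret metric_domain "cimg a" "G a" by (rule ambient_domain[OF assms(2)])
  have i: "smooth_on (loc_dom F b a) (loc_map F b a)" "y \<in> loc_dom F b a \<Longrightarrow> inj (push F b a y)" for y
    using imm assms unfolding immersion_def by blast+
  show ?thesis
  proof
    show "openin (top_of_set half_space) (loc_dom F b a)" by (rule loc_dom_openin[OF assms])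
    show "smooth_on (loc_dom F b a) (loc_map F b a)" by (rule i(1))
    show "loc_map F b a ` loc_dom F b a \<subseteq> cimg a" using loc_dom_point(5)[OF assms] by blast
    show "inj (\<lambda>v. dd (loc_dom F b a) (loc_map F b a) v y)" if "y \<in> loc_dom F b a" for y
      using i(2)[OF that] unfolding push_dd[abs_def] .
  qed
qed

text \<open>On the common part of the two patches the local maps differ by the transition map of the
  ambient charts, and the chain rule applies.\<close>

lemma push_change_vec:
  assumes b: "b \<in> B" and a: "a \<in> A" "a' \<in> A" and y: "y \<in> loc_dom F b a" "y \<in> loc_dom F b a'"
  shows "push F b a' y v = change_vec a a' (F (param b y)) (push F b a y v)"
proof -
  interpret P: immersed_patch "cimg a" "G a" "loc_dom F b a" "loc_map F b a" by (rule patch[OF b a(1)])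
  let ?E = "loc_dom F b a \<inter> loc_dom F b a'" and ?W = "coord a ` (cdom a \<inter> cdom a')"
  let ?\<psi> = "coord a' \<circ> param a"
  have E: "openin (top_of_set half_space) ?E" by (intro openin_Int loc_dom_openin b a)
  have W: "openin (top_of_set half_space) ?W"
    using coord_image_openin[OF chart_A[OF a(1)] cdom_A[OF a(2)]] by (simp add: Int_commute)
  have \<psi>: "smooth_on ?W ?\<psi>"
    using man a unfolding riemannian_manifold_def smooth_manifold_def by blast
  have in_W: "loc_map F b a z \<in> ?W" and eq: "loc_map F b a' z = ?\<psi> (loc_map F b a z)" if "z \<in> ?E" for z
    using loc_dom_point[OF b a(1), of z] loc_dom_point[OF b a(2), of z] that by auto
  have yE: "y \<in> ?E" using y by blast
  have du: "loc_map F b a differentiable (at y within ?E)"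
    using P.diff_u[OF y(1)] by (rule differentiable_subset) auto
  have "push F b a' y v = dd ?E (loc_map F b a') v y"
    unfolding push_dd by (rule dd_restrict[OF loc_dom_openin[OF b a(2)] E _ yE]) auto
  also have "\<dots> = dd ?E (\<lambda>z. ?\<psi> (loc_map F b a z)) v y"
    by (rule dd_cong_on[OF yE eq])
  also have "\<dots> = dd ?W ?\<psi> (dd ?E (loc_map F b a) v y) (loc_map F b a y)"
    by (rule dd_chain(1)[OF E yE du smooth_on_differentiable[OF W \<psi> in_W[OF yE]]]) (use in_W in blast)
  also have "dd ?E (loc_map F b a) v y = push F b a y v"
    unfolding push_dd by (rule dd_restrict[OF loc_dom_openin[OF b a(1)] E _ yE, symmetric]) auto
  finally show ?thesis
    unfolding change_vec_def dd_def loc_dom_point(4)[OF b a(1) y(1)] .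
qed

text \<open>\<open>induced_metric\<close> takes a separately selected ambient chart at each point,
  which is unfit for differentiation. Invariance of \<open>G\<close> under \<open>change_vec\<close>
  permits one ambient chart for the whole patch.\<close>

lemma induced_metric_chart:
  assumes b: "b \<in> B" and a: "a \<in> A" and y: "y \<in> loc_dom F b a"
  shows "H b y = (\<chi> i j. metric_prod (G a (loc_map F b a y)) (push F b a y (axis i 1)) (push F b a y (axis j 1)))"
proof -
  let ?p = "F (param b y)"
  let ?a = "chart_at A ?p"
  have "?p \<in> topspace T" using loc_dom_point(1)[OF b a y] in_topspace[OF b] F_topspace by blast
  note a' = chart_at_A[OF this]
  have y': "y \<in> loc_dom F b ?a"
    using loc_dom_point[OF b a y] a'(2) unfolding loc_dom_def by (metis (mono_tags, lifting) image_eqI mem_Collect_eq)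
  have "\<forall>c\<in>A. \<forall>c'\<in>A. \<forall>p\<in>cdom c \<inter> cdom c'. \<forall>v w. metric_prod (G c (coord c p)) v w
       = metric_prod (G c' (coord c' p)) (change_vec c c' p v) (change_vec c c' p w)"
    using man unfolding riemannian_manifold_def riemannian_metric_def by blast
  then have "metric_prod (G a (coord a ?p)) v w
    = metric_prod (G ?a (coord ?a ?p)) (change_vec a ?a ?p v) (change_vec a ?a ?p w)" for v w
    using a a' loc_dom_point(3)[OF b a y] by blast
  then have "metric_prod (G a (loc_map F b a y)) (push F b a y v) (push F b a y w)
    = metric_prod (G ?a (loc_map F b ?a y)) (push F b ?a y v) (push F b ?a y w)" for v w
    unfolding loc_dom_point(4)[OF b a y] loc_dom_point(4)[OF b a'(1) y'] push_change_vec[OF b a a'(1) y y'] .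
  then show ?thesis unfolding induced_metric_def Let_def by simp
qed

lemma cimg_point:
  assumes b: "b \<in> B" and y: "y \<in> cimg b"
  shows "chart_at A (F (param b y)) \<in> A" "y \<in> loc_dom F b (chart_at A (F (param b y)))"
proof -
  have q: "param b y \<in> cdom b" "coord b (param b y) = y" using param_in coord_param y by blast+
  have p: "F (param b y) \<in> topspace T" using q in_topspace[OF b] F_topspace by blast
  show "chart_at A (F (param b y)) \<in> A" by (rule chart_at_A[OF p])
  show "y \<in> loc_dom F b (chart_at A (F (param b y)))"
    unfolding loc_dom_def using q chart_at_A(2)[OF p] by (metis (mono_tags, lifting) image_eqI mem_Collect_eq)
qed

text \<open>The patches are relatively open and cover the image of the chart, and smoothness is
  local.\<close>

lemma smooth_on_cimg:
  assumes b: "b \<in> B" and "\<And>a. a \<in> A \<Longrightarrow> smooth_on (loc_dom F b a) u"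
  shows "smooth_on (cimg b) u"
proof (rule smooth_on_local)
  fix y assume "y \<in> cimg b"
  note a = cimg_point[OF b this]
  let ?D = "loc_dom F b (chart_at A (F (param b y)))"
  obtain U where U: "open U" "?D = half_space \<inter> U" using loc_dom_openin[OF b a(1)] openin_open by blast
  have "cimg b \<subseteq> half_space" using cimg_B[OF b] openin_imp_subset by blast
  then have "cimg b \<inter> U = ?D" using loc_dom_subset[of F b] U(2) by blast
  then have "smooth_on (cimg b \<inter> U) u" using assms(2)[OF a(1)] by simp
  then have "open U \<and> y \<in> U \<and> smooth_on (cimg b \<inter> U) u" using U a(2) by auto
  then show "\<exists>U. open U \<and> y \<in> U \<and> smooth_on (cimg b \<inter> U) u" by blast
qed

lemma H_patch:
  assumes b: "b \<in> B" and a: "a \<in> A" and y: "y \<in> loc_dom F b a"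
  shows "H b y = immersed_patch.h (G a) (loc_dom F b a) (loc_map F b a) y"
proof -
  interpret P: immersed_patch "cimg a" "G a" "loc_dom F b a" "loc_map F b a" by (rule patch[OF b a])
  show ?thesis unfolding induced_metric_chart[OF assms] P.h_def push_dd ..
qed

lemma surface_domain:
  assumes b: "b \<in> B"
  shows "metric_domain (cimg b) (H b)"
proof
  show "openin (top_of_set half_space) (cimg b)" by (rule cimg_B[OF b])
  show "smooth_on (cimg b) (H b)"
  proof (rule smooth_on_cimg[OF b])
    fix a assume a: "a \<in> A"
    interpret P: immersed_patch "cimg a" "G a" "loc_dom F b a" "loc_map F b a" by (rule patch[OF b a])
    show "smooth_on (loc_dom F b a) (H b)" by (rule smooth_on_cong[OF P.smooth_h H_patch[OF b a, symmetric]])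
  qed
next
  fix y v assume "y \<in> cimg b"
  note a = cimg_point[OF b this]
  interpret P: immersed_patch "cimg (chart_at A (F (param b y)))" "G (chart_at A (F (param b y)))"
    "loc_dom F b (chart_at A (F (param b y)))" "loc_map F b (chart_at A (F (param b y)))" by (rule patch[OF b a(1)])
  show "transpose (H b y) = H b y" unfolding H_patch[OF b a] by (rule P.sf.sym_g[OF a(2)])
  show "v \<noteq> 0 \<Longrightarrow> metric_prod (H b y) v v > 0" unfolding H_patch[OF b a] by (rule P.sf.pos_g[OF a(2)])
qed

lemma \<phi>_patch: "b \<in> B \<Longrightarrow> a \<in> A \<Longrightarrow> y \<in> loc_dom F b a \<Longrightarrow> (f \<circ> param a) (loc_map F b a y) = (\<phi> \<circ> param b) y"
  using loc_dom_point(6) by simp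

lemma smooth_\<phi>_param:
  assumes b: "b \<in> B"
  shows "smooth_on (cimg b) (\<phi> \<circ> param b)"
proof (rule smooth_on_cimg[OF b])
  fix a assume a: "a \<in> A"
  interpret P: immersed_patch "cimg a" "G a" "loc_dom F b a" "loc_map F b a" by (rule patch[OF b a])
  show "smooth_on (loc_dom F b a) (\<phi> \<circ> param b)"
    by (rule smooth_on_cong[OF smooth_on_compose[OF P.smooth_u smooth_f_param[OF a] P.sub] \<phi>_patch[OF b a]])
qed

lemma smooth_\<phi>: "smooth_fun B \<phi>"
  unfolding smooth_fun_def using smooth_\<phi>_param by blast

lemma pos_\<phi>: "q \<in> topspace TS \<Longrightarrow> \<phi> q > 0"
  using pos_f F_topspace by simp

end

text \<open>The ambient chart \<open>a\<close> below is the one selected in the definitions of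
  \<open>second_ff\<close>, \<open>ricci_normal\<close> and \<open>II_normal\<close>, so these
  unfold without a change of chart. The surface chart \<open>b\<close> stays arbitrary.\<close>

locale static_surface_point = static_surface +
  fixes b q
  assumes b: "b \<in> B" and q: "q \<in> cdom b"
begin

abbreviation "y \<equiv> coord b q"
abbreviation "a \<equiv> chart_at A (F q)"
abbreviation "n \<equiv> N a q"

lemma a: "a \<in> A" "F q \<in> cdom a"
  using chart_at_A[OF F_topspace[OF in_topspace[OF b q]]] .

lemma pq: "param b y = q"
  by (rule param_coord[OF chart_B[OF b] q])

lemma y: "y \<in> loc_dom F b a"
  unfolding loc_dom_def using q a(2) by blast

lemma uy: "loc_map F b a y = coord a (F q)"
  by (simp add: loc_map_def pq)

sublocale P: surface_point "cimg a" "G a" "loc_dom F b a" "loc_map F b a" y n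
proof -
  interpret P: immersed_patch "cimg a" "G a" "loc_dom F b a" "loc_map F b a" by (rule patch[OF b a(1)])
  have n: "metric_prod (G a (loc_map F b a y)) (N a (param b y)) (N a (param b y)) = 1"
    "metric_prod (G a (loc_map F b a y)) (push F b a y v) (N a (param b y)) = 0" for v
    using unit_normal b a(1) y unfolding unit_normal_field_def by blast+
  show "surface_point (cimg a) (G a) (loc_dom F b a) (loc_map F b a) y n"
    by unfold_locales (use y n in \<open>simp_all add: pq push_dd\<close>)
qed

lemma second_ff_A: "second_ff A G F N b i j y = P.A (axis i 1) (axis j 1)"
proof -
  have "P.amb.Gam (loc_map F b a y) (P.du (axis i 1)) (P.du (axis j 1))
    = (\<Sum>k\<in>UNIV. \<Sum>l\<in>UNIV. (P.du (axis i 1) $ k * P.du (axis j 1) $ l) *\<^sub>R P.amb.Gam (loc_map F b a y) (axis k 1) (axis l 1))"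
    by (rule bilinear_sum_sum[OF P.amb.linear_Gam[OF P.x]])
  then have "(\<chi> k. \<Sum>m\<in>UNIV. \<Sum>l\<in>UNIV. christoffel (cimg a) (G a) k m l (loc_map F b a y) * P.du (axis i 1) $ m * P.du (axis j 1) $ l)
    = P.amb.Gam (loc_map F b a y) (P.du (axis i 1)) (P.du (axis j 1))"
    by (simp add: vec_eq_iff P.amb.christoffel_Gam[OF P.x] mult_ac)
  then have "second_ff A G F N b i j y = P.ip (dd (loc_dom F b a) (dd (loc_dom F b a) (loc_map F b a) (axis j 1)) (axis i 1) y
      + P.amb.Gam (loc_map F b a y) (P.du (axis i 1)) (P.du (axis j 1))) n"
    unfolding second_ff_def Let_def pq pd_dd by simp
  then show ?thesis
    unfolding P.A_def P.K_def P.ddu_commute[OF y, of "axis j 1"] .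
qed

lemma H_h: "H b y = P.h y"
  by (rule H_patch[OF b a(1) y])

lemma y_cimg: "y \<in> cimg b"
  using q unfolding cimg_def by blast

lemma tr_A: "P.sf.tr y P.A = 0"
proof -
  have "(\<Sum>i\<in>UNIV. \<Sum>j\<in>UNIV. matrix_inv (H b y) $ i $ j * second_ff A G F N b i j y) = 0"
    using minimal b y_cimg unfolding minimal_def by blast
  then show ?thesis unfolding H_h second_ff_A P.sf.tr_def .
qed

lemma ricci_normal_Ric: "ricci_normal A G F N q = P.amb.Ric (loc_map F b a y) n n"
  unfolding ricci_normal_def Let_def uy[symmetric] by (rule P.amb.ricci_quadratic[OF P.x])

lemma f_param: "f (param a (loc_map F b a y)) = \<phi> q"
  using loc_dom_point(6)[OF b a(1) y] by (simp add: pq)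

text \<open>The static equation evaluated on the normal twice; the metric term contributes 1 because
  the normal is a unit vector.\<close>

lemma Hs_normal:
  "P.amb.Hs (f \<circ> param a) (loc_map F b a y) n n = \<phi> q * (ricci_normal A G F N q - R / 2)"
proof -
  let ?x = "loc_map F b a y"
  note sm = smooth_f_param[OF a(1)]
  have "\<phi> q * P.amb.Ric ?x n n = (\<Sum>i\<in>UNIV. \<Sum>j\<in>UNIV. \<phi> q * ricci (cimg a) (G a) i j ?x * (n $ i * n $ j))"
    unfolding P.amb.ricci_quadratic[OF P.x, symmetric] by (simp add: sum_distrib_left mult_ac)
  also have "\<dots> = (\<Sum>i\<in>UNIV. \<Sum>j\<in>UNIV. (n $ i * n $ j) *\<^sub>R P.amb.Hs (f \<circ> param a) ?x (axis i 1) (axis j 1))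
      + R / 2 * \<phi> q * (\<Sum>i\<in>UNIV. \<Sum>j\<in>UNIV. G a ?x $ i $ j * n $ i * n $ j)"
    unfolding static[OF a(1) P.x, unfolded f_param] P.amb.hessian_Hs[OF P.x sm]
    by (simp add: sum.distrib sum_distrib_left algebra_simps)
  also have "(\<Sum>i\<in>UNIV. \<Sum>j\<in>UNIV. (n $ i * n $ j) *\<^sub>R P.amb.Hs (f \<circ> param a) ?x (axis i 1) (axis j 1))
    = P.amb.Hs (f \<circ> param a) ?x n n"
    by (rule bilinear_sum_sum[symmetric]; rule linearI; simp only: P.amb.Hs_simps[OF P.x sm] real_scaleR_def)
  also have "(\<Sum>i\<in>UNIV. \<Sum>j\<in>UNIV. G a ?x $ i $ j * n $ i * n $ j) = 1"
    using P.unit_n unfolding metric_prod_sum .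
  finally have e: "\<phi> q * P.amb.Ric ?x n n = P.amb.Hs (f \<circ> param a) ?x n n + R / 2 * \<phi> q * 1" .
  have "h = p * (r - R / 2)" if "p * r = h + R / 2 * p * 1" for h p r :: real
    using that by (simp add: algebra_simps)
  from this[OF e] show ?thesis unfolding ricci_normal_Ric .
qed

text \<open>The ambient Laplacian contributes -(R/2) f and the normal Hessian f (Ric(N, N) - R/2);
  in their difference R cancels.\<close>

lemma laplacian_\<phi>:
  "laplacian (cimg b) (H b) (\<phi> \<circ> param b) y = - \<phi> q * ricci_normal A G F N q"
proof -
  have "laplacian (cimg b) (H b) (\<phi> \<circ> param b) y
    = laplacian (loc_dom F b a) P.h (\<lambda>z. (f \<circ> param a) (loc_map F b a z)) y"
    by (rule laplacian_restrict[OF cimg_B[OF b] P.D loc_dom_subset y H_patch[OF b a(1)] \<phi>_patch[OF b a(1), symmetric]])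
  also have "\<dots> = laplacian (cimg a) (G a) (f \<circ> param a) (loc_map F b a y)
     - P.amb.Hs (f \<circ> param a) (loc_map F b a y) n n"
    by (rule P.laplacian_minimal[OF tr_A smooth_f_param[OF a(1)]])
  finally show ?thesis
    using lap_f[OF a(1) P.x] unfolding Hs_normal f_param by (simp add: algebra_simps)
qed

text \<open>The gap R/2 - Ric(N, N) is K + |A|^2/2. Positivity of the Gauss curvature enters the
  proof at this point only.\<close>

lemma ricci_normal_less: "ricci_normal A G F N q < R / 2"
proof -
  have "gauss_curv (cimg b) (H b) y = gauss_curv (loc_dom F b a) P.h y"
    by (rule gauss_curv_restrict[OF cimg_B[OF b] P.D loc_dom_subset y H_patch[OF b a(1)]])
  moreover have "gauss_curv (cimg b) (H b) y > 0"
    using gauss_pos b y_cimg unfolding positive_gauss_curvature_def by blast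
  ultimately show ?thesis
    using P.Gauss_curvature_minimal[OF tr_A] P.second_form_norm[OF tr_A] scalar[OF a(1) P.x]
    unfolding ricci_normal_Ric by linarith
qed

lemma second_form_nonneg:
  "(\<Sum>i\<in>UNIV. \<Sum>j\<in>UNIV. \<Sum>k\<in>UNIV. \<Sum>l\<in>UNIV. matrix_inv (H b y) $ i $ k * matrix_inv (H b y) $ j $ l
      * second_ff A G F N b i j y * second_ff A G F N b k l y) \<ge> 0"
  unfolding H_h second_ff_A using P.second_form_norm[OF tr_A] by simp

end

context static_surface
begin

lemma surface_laplacian_\<phi>:
  assumes "q \<in> topspace TS"
  shows "surface_laplacian B A G F \<phi> q = - \<phi> q * ricci_normal A G F N q"
    and "norm2_second_ff B A G F N q \<ge> 0"
proof -
  interpret P: static_surface_point T A G f R c TS B F N "chart_at B q" q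
    by unfold_locales (rule chart_at_B[OF assms])+
  show "surface_laplacian B A G F \<phi> q = - \<phi> q * ricci_normal A G F N q"
    unfolding surface_laplacian_def Let_def by (rule P.laplacian_\<phi>)
  show "norm2_second_ff B A G F N q \<ge> 0"
    unfolding norm2_second_ff_def Let_def by (rule P.second_form_nonneg)
qed

text \<open>The length of the gradient of f at \<open>F q\<close>, in the ambient chart that
  \<open>II_normal\<close> uses. No chart of the surface occurs in it.\<close>

definition grad_norm :: "'b \<Rightarrow> real" where
  "grad_norm q = (let a = chart_at A (F q); x = coord a (F q); v = grad (cimg a) (G a) (f \<circ> param a) x in
     sqrt (metric_prod (G a x) v v))"

text \<open>A level set of a continuous function is closed, so this makes the boundary of the
  surface compact. It also places its points where the gradient of f does not vanish.\<close>

lemma mboundary_eq: "mboundary B = {q \<in> topspace TS. \<phi> q = c}"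
proof -
  have "mboundary B \<subseteq> topspace TS" unfolding mboundary_def using in_topspace by blast
  moreover have "F q \<in> mboundary A \<longleftrightarrow> q \<in> mboundary B" if "q \<in> topspace TS" for q
    using free that unfolding free_boundary_def by blast
  moreover have "mboundary A = {p \<in> topspace T. f p = c}" using level unfolding level_boundary_def by blast
  ultimately show ?thesis using F_topspace by auto
qed

end

context static_surface_point
begin

lemma boundary_point:
  assumes qb: "q \<in> mboundary B"
  shows "grad_norm q > 0"
    and "dd (cimg b) (\<phi> \<circ> param b) (outward_conormal (H b y)) y = - grad_norm q"
    and "II_normal A G f F N q = \<phi> q * (R / 2 - ricci_normal A G F N q) / grad_norm q"
proof -
  let ?x = "coord a (F q)" and ?\<nu> = "outward_conormal (H b y)" and ?u = "f \<circ> param a"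
  let ?v = "grad (cimg a) (G a) ?u ?x"
  have x: "?x \<in> cimg a" using P.x unfolding uy .
  note sm = smooth_f_param[OF a(1)]
  note du = smooth_on_differentiable[OF P.amb.S sm x]
  have "f (F q) = c" using qb unfolding mboundary_eq by simp
  then have nz: "?v \<noteq> 0"
    using level a unfolding level_boundary_def by blast
  have gn: "grad_norm q = sqrt (metric_prod (G a ?x) ?v ?v)"
    by (simp add: grad_norm_def Let_def)
  have vv: "metric_prod (G a ?x) ?v ?v > 0" by (rule P.amb.pos_g[OF x nz])
  then show pos: "grad_norm q > 0" unfolding gn by simp
  have sq: "metric_prod (G a ?x) ?v ?v = grad_norm q * grad_norm q" using vv unfolding gn by simp
  have "push F b a y ?\<nu> = minus_unit_grad G f a ?x"
    using free b a q qb unfolding free_boundary_def by blast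
  then have \<nu>: "P.du ?\<nu> = - (1 / grad_norm q) *\<^sub>R ?v"
    unfolding push_dd minus_unit_grad_def Let_def gn .
  \<comment> \<open>The conormal is tangent to the surface and by the free boundary condition
    parallel to the gradient of f. So \<open>n\<close> is orthogonal to that gradient, as
    \<open>cov_deriv_unit_grad\<close> requires.\<close>
  have "P.ip (P.du ?\<nu>) n = 0" by (rule P.normal_n)
  then have perp: "metric_prod (G a ?x) ?v n = 0"
    using pos unfolding \<nu> uy by (simp add: metric_prod_simps)
  have "dd (cimg b) (\<phi> \<circ> param b) ?\<nu> y = dd (loc_dom F b a) (\<lambda>z. ?u (loc_map F b a z)) ?\<nu> y"
    by (rule dd_restrict[OF cimg_B[OF b] P.D loc_dom_subset y \<phi>_patch[OF b a(1), symmetric]])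
  also have "\<dots> = dd (cimg a) ?u (P.du ?\<nu>) ?x"
    unfolding uy[symmetric] by (rule dd_chain(1)[OF P.D y P.diff_u[OF y] du[folded uy] P.sub])
  also have "\<dots> = metric_prod (G a ?x) (P.du ?\<nu>) ?v"
    by (rule P.amb.ip_grad[OF x du, symmetric])
  also have "\<dots> = - grad_norm q"
    unfolding \<nu> metric_prod_simps sq using pos by simp
  finally show "dd (cimg b) (\<phi> \<circ> param b) ?\<nu> y = - grad_norm q" .
  have "II_normal A G f F N q = - P.amb.Hs ?u ?x n n / grad_norm q"
    unfolding II_normal_def Let_def boundary_II_def minus_unit_grad_def[abs_def] gn
    by (rule P.amb.cov_deriv_unit_grad[OF x sm nz perp, unfolded Let_def])
  then show "II_normal A G f F N q = \<phi> q * (R / 2 - ricci_normal A G F N q) / grad_norm q"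
    using Hs_normal unfolding uy by (simp add: algebra_simps)
qed

end


section \<open>The boundary term of the stability inequality\<close>

context static_surface
begin

abbreviation M :: "'b set" where
  "M \<equiv> mboundary B"

definition integrand :: "'b \<Rightarrow> real" where
  "integrand q = \<phi> q * (conormal_deriv B A G F \<phi> q - II_normal A G f F N q * \<phi> q)"

lemma M_topspace: "M \<subseteq> topspace TS"
  unfolding mboundary_eq by blast

lemma chart_preimage_openin:
  assumes b: "b \<in> B" and O: "open O'"
  shows "openin TS {q \<in> cdom b. coord b q \<in> O'}"
proof -
  have "continuous_map (subtopology TS (cdom b)) (top_of_set (cimg b)) (coord b)"
    using chart_B[OF b] homeomorphic_imp_continuous_map unfolding manifold_chart_def by blast
  moreover have "openin (top_of_set (cimg b)) (cimg b \<inter> O')" using O by blast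
  ultimately have "openin (subtopology TS (cdom b)) {q \<in> topspace (subtopology TS (cdom b)). coord b q \<in> cimg b \<inter> O'}"
    by (rule openin_continuous_map_preimage)
  moreover have "topspace (subtopology TS (cdom b)) = cdom b"
    using in_topspace[OF b] by auto
  moreover have "{q \<in> cdom b. coord b q \<in> cimg b \<inter> O'} = {q \<in> cdom b. coord b q \<in> O'}"
    unfolding cimg_def by blast
  ultimately show ?thesis using cdom_B[OF b] openin_open_subtopology by metis
qed

text \<open>The surface carries an abstract topology, so continuity has to be read off in charts.
  Each chart yields an open set that cuts out its part of a preimage in \<open>X\<close>, and their
  union cuts out the whole preimage.\<close>

lemma continuous_map_chartwise:
  fixes u :: "'b \<Rightarrow> real"
  assumes X: "X \<subseteq> topspace TS"
    and u: "\<And>b. b \<in> B \<Longrightarrow> continuous_on (coord b ` (X \<inter> cdom b)) (\<lambda>y. u (param b y))"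
  shows "continuous_map (subtopology TS X) euclidean u"
  unfolding continuous_map_def
proof (intro conjI allI impI)
  fix U :: "real set" assume U: "openin euclidean U"
  have "\<exists>V. openin TS V \<and> V \<inter> X = {q \<in> X \<inter> cdom b. u q \<in> U}" if b: "b \<in> B" for b
  proof -
    let ?Y = "coord b ` (X \<inter> cdom b)"
    have "openin (top_of_set ?Y) (?Y \<inter> (\<lambda>y. u (param b y)) -` U)"
      using u[OF b] U continuous_openin_preimage_gen by (metis open_openin)
    then obtain O' where O: "open O'" "?Y \<inter> (\<lambda>y. u (param b y)) -` U = ?Y \<inter> O'"
      using openin_open by blast
    have "q \<in> X \<and> u q \<in> U \<longleftrightarrow> q \<in> X \<and> coord b q \<in> O'" if "q \<in> cdom b" for q
    proof (cases "q \<in> X")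
      case True
      then have y: "coord b q \<in> ?Y" using that by blast
      have "coord b q \<in> ?Y \<inter> (\<lambda>y. u (param b y)) -` U \<longleftrightarrow> coord b q \<in> ?Y \<inter> O'" by (simp only: O(2))
      then show ?thesis using y True param_coord[OF chart_B[OF b] that] by simp
    qed simp
    then have "{q \<in> cdom b. coord b q \<in> O'} \<inter> X = {q \<in> X \<inter> cdom b. u q \<in> U}" by blast
    then show ?thesis using chart_preimage_openin[OF b O(1)] by blast
  qed
  then obtain V where V: "\<And>b. b \<in> B \<Longrightarrow> openin TS (V b)"
      "\<And>b. b \<in> B \<Longrightarrow> V b \<inter> X = {q \<in> X \<inter> cdom b. u q \<in> U}"
    by metis
  have "(\<Union>b\<in>B. V b) \<inter> X = (\<Union>b\<in>B. {q \<in> X \<inter> cdom b. u q \<in> U})"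
    using V(2) by blast
  also have "\<dots> = {q \<in> topspace (subtopology TS X). u q \<in> U}"
    using X chart_at_B by fastforce
  finally have "(\<Union>b\<in>B. V b) \<inter> X = {q \<in> topspace (subtopology TS X). u q \<in> U}" .
  moreover have "openin TS (\<Union>b\<in>B. V b)" using V(1) by blast
  ultimately show "openin (subtopology TS X) {q \<in> topspace (subtopology TS X). u q \<in> U}"
    unfolding openin_subtopology by metis
qed auto

lemma compactin_M: "compactin TS M"
proof -
  have "continuous_map (subtopology TS (topspace TS)) euclidean \<phi>"
  proof (rule continuous_map_chartwise)
    fix b assume b: "b \<in> B"
    have "continuous_on (cimg b) (\<phi> \<circ> param b)"
      by (rule smooth_on_continuous[OF cimg_B[OF b] smooth_\<phi>_param[OF b]])
    then show "continuous_on (coord b ` (topspace TS \<inter> cdom b)) (\<lambda>y. \<phi> (param b y))"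
      unfolding o_def by (rule continuous_on_subset) (auto simp: cimg_def)
  qed auto
  then have "continuous_map TS euclidean \<phi>" by (simp only: subtopology_topspace)
  from closedin_continuous_map_preimage[OF this, of "{c}"]
  have "closedin TS {q \<in> topspace TS. \<phi> q \<in> {c}}" by simp
  then show ?thesis
    using closedin_compact_space[OF compact_S] unfolding mboundary_eq by simp
qed

lemma outward_conormal_H:
  assumes b: "b \<in> B" and y: "y \<in> cimg b"
  shows "outward_conormal (H b y) = (- 1 / sqrt (H b y $ 2 $ 2 * det (H b y))) *\<^sub>R
      (H b y $ 2 $ 2 *\<^sub>R axis 1 1 - H b y $ 1 $ 2 *\<^sub>R axis 2 1)"
    and "H b y $ 2 $ 2 * det (H b y) > 0"
proof -
  interpret metric_domain "cimg b" "H b" by (rule surface_domain[OF b])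
  show "outward_conormal (H b y) = (- 1 / sqrt (H b y $ 2 $ 2 * det (H b y))) *\<^sub>R
      (H b y $ 2 $ 2 *\<^sub>R axis 1 1 - H b y $ 1 $ 2 *\<^sub>R axis 2 1)"
    "H b y $ 2 $ 2 * det (H b y) > 0"
    using outward_conormal_eq[OF sym_g[OF y] pos_g[OF y]] by blast+
qed

text \<open>The chart \<open>chart_at A (F q)\<close> depends on \<open>q\<close> in an uncontrolled way. The right hand sides below involve
  a fixed chart of the surface only; this yields the continuity of the boundary integrand.\<close>

lemma boundary_values:
  assumes b: "b \<in> B" and q: "q \<in> M" "q \<in> cdom b"
  shows "grad_norm q > 0"
    and "grad_norm q = - dd (cimg b) (\<phi> \<circ> param b) (outward_conormal (H b (coord b q))) (coord b q)"
    and "ricci_normal A G F N q = - laplacian (cimg b) (H b) (\<phi> \<circ> param b) (coord b q) / \<phi> q"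
    and "integrand q = - \<phi> q * (grad_norm q + (\<phi> q)\<^sup>2 * (R / 2 - ricci_normal A G F N q) / grad_norm q)"
    and "integrand q < 0"
proof -
  interpret P: static_surface_point T A G f R c TS B F N b q
    by unfold_locales (rule b q)+
  have qT: "q \<in> topspace TS" using q M_topspace by blast
  \<comment> \<open>\<open>conormal_deriv\<close> is evaluated in \<open>chart_at B q\<close>, while
    the claims concern \<open>b\<close>. The two charts are linked by \<open>grad_norm\<close>,
    which depends on neither.\<close>
  interpret P': static_surface_point T A G f R c TS B F N "chart_at B q" q
    by unfold_locales (rule chart_at_B[OF qT])+
  note \<phi>pos = pos_\<phi>[OF qT]
  show gn: "grad_norm q > 0" by (rule P.boundary_point(1)[OF q(1)])
  show "grad_norm q = - dd (cimg b) (\<phi> \<circ> param b) (outward_conormal (H b (coord b q))) (coord b q)"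
    using P.boundary_point(2)[OF q(1)] by simp
  show "ricci_normal A G F N q = - laplacian (cimg b) (H b) (\<phi> \<circ> param b) (coord b q) / \<phi> q"
    unfolding P.laplacian_\<phi> using \<phi>pos by (simp del: o_apply)
  have conormal: "conormal_deriv B A G F \<phi> q = - grad_norm q"
    using P'.boundary_point(2)[OF q(1)] unfolding conormal_deriv_def Let_def dd_def .
  have "p * (- g - p * s / g * p) = - p * (g + p\<^sup>2 * s / g)" for p g s :: real
    by (simp add: power2_eq_square algebra_simps)
  then show eq: "integrand q = - \<phi> q * (grad_norm q + (\<phi> q)\<^sup>2 * (R / 2 - ricci_normal A G F N q) / grad_norm q)"
    unfolding integrand_def P.boundary_point(3)[OF q(1)] conormal .
  have "(\<phi> q)\<^sup>2 * (R / 2 - ricci_normal A G F N q) / grad_norm q > 0"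
    using P.ricci_normal_less \<phi>pos gn by (simp del: o_apply)
  then have "grad_norm q + (\<phi> q)\<^sup>2 * (R / 2 - ricci_normal A G F N q) / grad_norm q > 0"
    using gn by linarith
  then show "integrand q < 0" unfolding eq using \<phi>pos by (simp add: mult_pos_pos del: o_apply)
qed

lemma continuous_map_integrand: "continuous_map (subtopology TS M) euclidean integrand"
proof (rule continuous_map_chartwise[OF M_topspace])
  fix b assume b: "b \<in> B"
  interpret metric_domain "cimg b" "H b" by (rule surface_domain[OF b])
  let ?X = "coord b ` (M \<inter> cdom b)"
  have sub: "?X \<subseteq> cimg b" unfolding cimg_def by blast
  note sm = smooth_\<phi>_param[OF b]
  have \<phi>: "continuous_on ?X (\<lambda>y. \<phi> (param b y))"
    using continuous_on_subset[OF smooth_on_continuous[OF S sm] sub] unfolding o_def .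
  have g: "continuous_on ?X (\<lambda>y. H b y $ i $ j)" for i j
    by (intro continuous_on_component continuous_on_subset[OF smooth_on_continuous[OF S smooth_g] sub])
  have p: "continuous_on ?X (pd (cimg b) i (\<phi> \<circ> param b))" for i
    by (rule continuous_on_subset[OF smooth_on_continuous[OF S smooth_on_pd[OF S sm]] sub])
  have l: "continuous_on ?X (laplacian (cimg b) (H b) (\<phi> \<circ> param b))"
    by (rule continuous_on_subset[OF continuous_on_laplacian[OF sm] sub])
  have pt: "param b y \<in> M" "param b y \<in> cdom b" "coord b (param b y) = y" if "y \<in> ?X" for y
    using that param_coord[OF chart_B[OF b]] by auto
  define \<mu> where "\<mu> y = - 1 / sqrt (H b y $ 2 $ 2 * det (H b y))" for y
  have \<mu>: "continuous_on ?X \<mu>"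
    unfolding \<mu>_def
  proof (rule continuous_on_divide[OF continuous_on_const])
    show "continuous_on ?X (\<lambda>y. sqrt (H b y $ 2 $ 2 * det (H b y)))"
      unfolding det_2 by (intro continuous_on_real_sqrt continuous_on_mult continuous_on_diff g)
    show "\<forall>y\<in>?X. sqrt (H b y $ 2 $ 2 * det (H b y)) \<noteq> 0"
    proof
      fix y assume "y \<in> ?X"
      from real_sqrt_gt_zero[OF outward_conormal_H(2)[OF b subsetD[OF sub this]]]
      show "sqrt (H b y $ 2 $ 2 * det (H b y)) \<noteq> 0" by (rule less_imp_neq[THEN not_sym])
    qed
  qed
  \<comment> \<open>The negative conormal derivative of \<phi>, written out with the explicit
    conormal. In this form its continuity is visible, and it equals \<open>grad_norm\<close> along
    the boundary.\<close>
  define w where "w y = - (\<mu> y * H b y $ 2 $ 2 * pd (cimg b) 1 (\<phi> \<circ> param b) y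
      - \<mu> y * H b y $ 1 $ 2 * pd (cimg b) 2 (\<phi> \<circ> param b) y)" for y
  have w: "continuous_on ?X w"
    unfolding w_def by (intro continuous_on_minus continuous_on_diff continuous_on_mult \<mu> g p)
  have gw: "grad_norm (param b y) = w y" if y: "y \<in> ?X" for y
  proof -
    have yc: "y \<in> cimg b" using y sub by blast
    have lin: "linear (\<lambda>v. dd (cimg b) (\<phi> \<circ> param b) v y)"
      by (rule linear_dd[OF smooth_on_differentiable[OF S sm yc]])
    have "grad_norm (param b y) = - dd (cimg b) (\<phi> \<circ> param b) (outward_conormal (H b y)) y"
      using boundary_values(2)[OF b pt(1,2)[OF y]] unfolding pt(3)[OF y] .
    also have "\<dots> = w y"
      unfolding outward_conormal_H(1)[OF b yc] w_def pd_dd \<mu>_def[symmetric]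
        linear_scale[OF lin] linear_diff[OF lin] by (simp add: algebra_simps)
    finally show ?thesis .
  qed
  have r: "ricci_normal A G F N (param b y) = - laplacian (cimg b) (H b) (\<phi> \<circ> param b) y / \<phi> (param b y)"
    if y: "y \<in> ?X" for y
    using boundary_values(3)[OF b pt(1,2)[OF y]] unfolding pt(3)[OF y] .
  have "continuous_on ?X (\<lambda>y. - \<phi> (param b y) * (w y + (\<phi> (param b y))\<^sup>2 *
      (R / 2 - - laplacian (cimg b) (H b) (\<phi> \<circ> param b) y / \<phi> (param b y)) / w y))"
  proof (intro continuous_on_mult continuous_on_minus continuous_on_add continuous_on_divide continuous_on_diff
      continuous_on_power continuous_on_const \<phi> w l ballI)
    fix y assume y: "y \<in> ?X"
    show "w y \<noteq> 0" using boundary_values(1)[OF b pt(1,2)[OF y]] gw[OF y] by simp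
    show "\<phi> (param b y) \<noteq> 0" using pos_\<phi>[of "param b y"] pt(1)[OF y] M_topspace by force
  qed simp
  then show "continuous_on ?X (\<lambda>y. integrand (param b y))"
    by (rule continuous_on_eq) (use boundary_values(4)[OF b pt(1,2)] in \<open>simp add: gw r del: o_apply\<close>)
qed

end

section \<open>The length measure of the boundary and the sign of the boundary integral\<close>

lemma dist_vector_0: "dist (vector [0, s] :: real ^ 2) (vector [0, t]) = \<bar>s - t\<bar>"
proof -
  have "vector [0, s] - vector [0, t] = ((s - t) *\<^sub>R axis 2 1 :: real ^ 2)"
    by (simp add: vec_eq_iff forall_2 axis_def)
  then show ?thesis by (simp add: dist_norm)
qed

locale static_surface_length = static_surface +
  fixes \<tau> :: "'b measure"
  assumes length: "boundary_length_measure TS B (induced_metric A G F) \<tau>"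
begin

lemma space_\<tau>: "space \<tau> = M"
  using length unfolding boundary_length_measure_def by blast

lemma sets_\<tau>: "openin TS U \<Longrightarrow> U \<inter> M \<in> sets \<tau>"
  using length unfolding boundary_length_measure_def by (auto intro: sigma_sets.Basic)

lemma emeasure_\<tau>:
  "b \<in> B \<Longrightarrow> E \<in> sets \<tau> \<Longrightarrow> E \<subseteq> cdom b \<Longrightarrow> emeasure \<tau> E =
    (\<integral>\<^sup>+ s. ennreal (sqrt (H b (vector [0, s]) $ 2 $ 2)) * indicator (coord b ` E) (vector [0, s]) \<partial>lborel)"
  using length unfolding boundary_length_measure_def by blast

text \<open>Bounds the density of the length measure near a point on both sides: the upper bound
  yields local finiteness, the lower bound positive length.\<close>

lemma H22_near:
  assumes b: "b \<in> B" and y: "y \<in> cimg b"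
  obtains d where "d > 0" "\<And>z. z \<in> cimg b \<Longrightarrow> dist z y < d \<Longrightarrow>
    H b y $ 2 $ 2 / 2 < H b z $ 2 $ 2 \<and> H b z $ 2 $ 2 < 2 * H b y $ 2 $ 2"
    "H b y $ 2 $ 2 > 0"
proof -
  interpret metric_domain "cimg b" "H b" by (rule surface_domain[OF b])
  have pos: "H b y $ 2 $ 2 > 0" using pos_g[OF y, of "axis 2 1"] by simp
  have "continuous_on (cimg b) (\<lambda>z. H b z $ 2 $ 2)"
    by (intro continuous_on_component smooth_on_continuous[OF S smooth_g])
  then obtain d where d: "d > 0" "\<And>z. z \<in> cimg b \<Longrightarrow> dist z y < d \<Longrightarrow>
      dist (H b z $ 2 $ 2) (H b y $ 2 $ 2) < H b y $ 2 $ 2 / 2"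
    using y pos unfolding continuous_on_iff by (meson half_gt_zero)
  have "H b y $ 2 $ 2 / 2 < H b z $ 2 $ 2 \<and> H b z $ 2 $ 2 < 2 * H b y $ 2 $ 2"
    if "z \<in> cimg b" "dist z y < d" for z
    using d(2)[OF that] pos unfolding dist_real_def by linarith
  then show ?thesis using that d(1) pos by blast
qed

text \<open>In the chart a small piece of the boundary lies over an interval of length 2d, on which
  the density is at most \<open>?C\<close>.\<close>

lemma locally_finite_\<tau>:
  assumes q: "q \<in> M"
  shows "\<exists>U. openin TS U \<and> q \<in> U \<and> emeasure \<tau> (U \<inter> M) < \<infinity>"
proof -
  have qT: "q \<in> topspace TS" using q M_topspace by blast
  define b where "b = chart_at B q"
  have b: "b \<in> B" "q \<in> cdom b" using chart_at_B[OF qT] by (simp_all add: b_def)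
  let ?y = "coord b q"
  have "?y \<in> cimg b" using b(2) unfolding cimg_def by blast
  from H22_near[OF b(1) this] obtain d where d: "d > 0" "\<And>z. z \<in> cimg b \<Longrightarrow> dist z ?y < d \<Longrightarrow>
    H b ?y $ 2 $ 2 / 2 < H b z $ 2 $ 2 \<and> H b z $ 2 $ 2 < 2 * H b ?y $ 2 $ 2" by metis
  define U where "U = {p \<in> cdom b. coord b p \<in> ball ?y d}"
  have U: "openin TS U" unfolding U_def by (rule chart_preimage_openin[OF b(1) open_ball])
  let ?C = "sqrt (2 * H b ?y $ 2 $ 2)"
  let ?I = "{?y $ 2 - d..?y $ 2 + d}"
  have "emeasure \<tau> (U \<inter> M) = (\<integral>\<^sup>+ s. ennreal (sqrt (H b (vector [0, s]) $ 2 $ 2))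
      * indicator (coord b ` (U \<inter> M)) (vector [0, s]) \<partial>lborel)"
    by (rule emeasure_\<tau>[OF b(1) sets_\<tau>[OF U]]) (auto simp: U_def)
  also have "\<dots> \<le> (\<integral>\<^sup>+ s. ennreal ?C * indicator ?I s \<partial>lborel)"
  proof (rule nn_integral_mono)
    fix s :: real
    show "ennreal (sqrt (H b (vector [0, s]) $ 2 $ 2)) * indicator (coord b ` (U \<inter> M)) (vector [0, s])
      \<le> ennreal ?C * indicator ?I s"
    proof (cases "vector [0, s] \<in> coord b ` (U \<inter> M)")
      case True
      then have z: "vector [0, s] \<in> cimg b" "dist (vector [0, s]) ?y < d"
        unfolding U_def cimg_def by (auto simp: dist_commute)
      have "\<bar>s - ?y $ 2\<bar> \<le> norm (vector [0, s] - ?y)"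
        using component_le_norm_cart[of "vector [0, s] - ?y" 2] by simp
      then have "s \<in> ?I" using z(2) by (auto simp: dist_norm abs_le_iff)
      moreover have "sqrt (H b (vector [0, s]) $ 2 $ 2) \<le> ?C"
        using d(2)[OF z] by simp
      ultimately show ?thesis by (simp add: True ennreal_leI)
    qed simp
  qed
  also have "\<dots> = ennreal ?C * emeasure lborel ?I"
    by (rule nn_integral_cmult_indicator) simp
  also have "\<dots> < \<infinity>"
    using d(1) by (simp add: ennreal_mult_less_top)
  finally show ?thesis using U b(2) d(1) by (intro exI[of _ U]) (auto simp: U_def)
qed

text \<open>Compactness of the boundary leaves finitely many of the neighbourhoods of finite
  length.\<close>

lemma finite_measure_\<tau>: "finite_measure \<tau>"
proof
  obtain U where U: "\<And>q. q \<in> M \<Longrightarrow> openin TS (U q) \<and> q \<in> U q \<and> emeasure \<tau> (U q \<inter> M) < \<infinity>"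
    using locally_finite_\<tau> by metis
  have "\<exists>\<F>. finite \<F> \<and> \<F> \<subseteq> U ` M \<and> M \<subseteq> \<Union>\<F>"
    by (rule compactinD[OF compactin_M]) (use U in auto)
  then obtain \<F> where \<F>: "finite \<F>" "\<F> \<subseteq> U ` M" "M \<subseteq> \<Union>\<F>" by blast
  obtain Q where Q: "Q \<subseteq> M" "finite Q" "\<F> = U ` Q"
    using finite_subset_image[OF \<F>(1,2)] by blast
  have UQ: "U q \<inter> M \<in> sets \<tau>" "emeasure \<tau> (U q \<inter> M) < \<infinity>" if "q \<in> Q" for q
    using U[of q] sets_\<tau>[of "U q"] that Q(1) by auto
  have "emeasure \<tau> M \<le> emeasure \<tau> (\<Union>q\<in>Q. U q \<inter> M)"
    by (intro emeasure_mono sets.finite_UN Q(2) UQ(1)) (use \<F>(3) Q(3) in auto)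
  also have "\<dots> \<le> (\<Sum>q\<in>Q. emeasure \<tau> (U q \<inter> M))"
    by (rule emeasure_subadditive_finite[OF Q(2)]) (use UQ(1) in auto)
  also have "\<dots> < \<infinity>"
    using Q(2) UQ(2) by (simp add: ennreal_sum_less_top)
  finally show "emeasure \<tau> (space \<tau>) \<noteq> \<infinity>" by (simp add: space_\<tau>)
qed

text \<open>The image of the chart is relatively open in the half-space, so near a boundary point it
  contains an interval of the line bounding the half-space; the density there is bounded
  below.\<close>

lemma emeasure_\<tau>_pos: "emeasure \<tau> (space \<tau>) \<noteq> 0"
proof -
  obtain q where "q \<in> M" using free unfolding free_boundary_def by blast
  \<comment> \<open>This chart is taken from \<open>mboundary_def\<close> because it comes with a
    vanishing first coordinate at \<open>q\<close>.\<close>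
  then obtain b where b: "b \<in> B" "q \<in> cdom b" "coord b q $ 1 = 0" unfolding mboundary_def by blast
  let ?y = "coord b q"
  define s0 where "s0 = ?y $ 2"
  have y: "?y = vector [0, s0]" using b(3) by (simp add: vec_eq_iff forall_2 s0_def)
  have yc: "?y \<in> cimg b" using b(2) unfolding cimg_def by blast
  from H22_near[OF b(1) yc] obtain d where d: "d > 0" "\<And>z. z \<in> cimg b \<Longrightarrow> dist z ?y < d \<Longrightarrow>
    H b ?y $ 2 $ 2 / 2 < H b z $ 2 $ 2 \<and> H b z $ 2 $ 2 < 2 * H b ?y $ 2 $ 2" "H b ?y $ 2 $ 2 > 0" by metis
  obtain O' where O: "open O'" "cimg b = half_space \<inter> O'" using cimg_B[OF b(1)] openin_open by blast
  then obtain e where e: "e > 0" "ball ?y e \<subseteq> O'" using yc openE by blast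
  \<comment> \<open>Within \<open>d\<close> the density is controlled, within \<open>e\<close> the
    segment stays in the image of the chart.\<close>
  define r where "r = min d e"
  have r: "r > 0" using d(1) e(1) by (simp add: r_def)
  let ?C = "sqrt (H b ?y $ 2 $ 2 / 2)" and ?E = "cdom b \<inter> M"
  have E: "?E \<in> sets \<tau>" by (rule sets_\<tau>[OF cdom_B[OF b(1)]])
  have in_E: "vector [0, s] \<in> coord b ` ?E" "vector [0, s] \<in> cimg b" "dist (vector [0, s]) ?y < d"
    if "s \<in> {s0 - r<..<s0 + r}" for s
  proof -
    have dist: "dist (vector [0, s]) ?y < r" unfolding y dist_vector_0 using that by auto
    then show "dist (vector [0, s]) ?y < d" by (simp add: r_def)
    have "vector [0, s] \<in> ball ?y e" using dist by (simp add: r_def dist_commute)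
    then show z: "vector [0, s] \<in> cimg b" using e(2) unfolding O(2) half_space_def by auto
    have "param b (vector [0, s]) \<in> ?E"
      using param_in[OF z] coord_param[OF z] b(1) unfolding mboundary_def by auto
    then show "vector [0, s] \<in> coord b ` ?E" using coord_param[OF z] by (metis image_eqI)
  qed
  have "0 < ennreal (?C * (2 * r))" using d(3) r by simp
  also have "ennreal (?C * (2 * r)) = ennreal ?C * emeasure lborel {s0 - r<..<s0 + r}"
    using r d(3) by (simp add: ennreal_mult)
  also have "\<dots> = (\<integral>\<^sup>+ s. ennreal ?C * indicator {s0 - r<..<s0 + r} s \<partial>lborel)"
    by (rule nn_integral_cmult_indicator[symmetric]) simp
  also have "\<dots> \<le> (\<integral>\<^sup>+ s. ennreal (sqrt (H b (vector [0, s]) $ 2 $ 2)) * indicator (coord b ` ?E) (vector [0, s]) \<partial>lborel)"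
  proof (rule nn_integral_mono)
    fix s :: real
    show "ennreal ?C * indicator {s0 - r<..<s0 + r} s
      \<le> ennreal (sqrt (H b (vector [0, s]) $ 2 $ 2)) * indicator (coord b ` ?E) (vector [0, s])"
    proof (cases "s \<in> {s0 - r<..<s0 + r}")
      case True
      have "?C \<le> sqrt (H b (vector [0, s]) $ 2 $ 2)"
        using d(2)[OF in_E(2,3)[OF True]] by simp
      then show ?thesis using True in_E(1)[OF True] by (simp add: ennreal_leI)
    qed simp
  qed
  also have "\<dots> = emeasure \<tau> ?E"
    by (rule emeasure_\<tau>[OF b(1) E, symmetric]) simp
  also have "\<dots> \<le> emeasure \<tau> (space \<tau>)" by (rule emeasure_space)
  finally show ?thesis by simp
qed

text \<open>Without integrability the integral would be 0 by convention and carry no sign. A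
  continuous function on the compact boundary is bounded, and the length is finite.\<close>

lemma integrable_integrand: "integrable \<tau> integrand"
proof -
  interpret finite_measure \<tau> by (rule finite_measure_\<tau>)
  have "integrand \<in> borel_measurable \<tau>"
  proof (rule borel_measurableI)
    fix U :: "real set" assume "open U"
    then have "openin (subtopology TS M) {q \<in> topspace (subtopology TS M). integrand q \<in> U}"
      by (intro openin_continuous_map_preimage[OF continuous_map_integrand]) simp
    then obtain V where "openin TS V" "{q \<in> topspace (subtopology TS M). integrand q \<in> U} = V \<inter> M"
      unfolding openin_subtopology by blast
    moreover have "{q \<in> topspace (subtopology TS M). integrand q \<in> U} = integrand -` U \<inter> space \<tau>"
      using M_topspace unfolding space_\<tau> by auto
    ultimately show "integrand -` U \<inter> space \<tau> \<in> sets \<tau>" by (metis sets_\<tau>)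
  qed
  moreover have "compact (integrand ` M)"
  proof -
    have "compactin (subtopology TS M) M"
      using compactin_M by (simp add: compactin_subtopology)
    then show ?thesis
      using image_compactin[OF _ continuous_map_integrand] by simp
  qed
  then obtain C where "\<And>q. q \<in> M \<Longrightarrow> norm (integrand q) \<le> C"
    using compact_imp_bounded bounded_iff by (metis image_eqI)
  then have "AE q in \<tau>. norm (integrand q) \<le> C" by (intro AE_I2) (simp add: space_\<tau>)
  ultimately show ?thesis using integrable_const_bound by blast
qed

lemma integral_integrand_neg: "(\<integral>q. integrand q \<partial>\<tau>) < 0"
proof -
  interpret finite_measure \<tau> by (rule finite_measure_\<tau>)
  have "integrand q < 0" if "q \<in> space \<tau>" for q
  proof -
    have "q \<in> M" using that by (simp add: space_\<tau>)
    then show ?thesis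
      using boundary_values(5)[of "chart_at B q" q] chart_at_B[of q] M_topspace by blast
  qed
  then have "(\<integral>q. integrand q \<partial>\<tau>) < (\<integral>q. 0 \<partial>\<tau>)"
    by (intro integral_less_AE_space integrable_integrand integrable_zero AE_I2 emeasure_\<tau>_pos)
  then show ?thesis by simp
qed

lemma not_stable:
  assumes "area_measure TS B (induced_metric A G F) \<sigma>"
  shows "\<not> stable B A G f F N \<sigma> \<tau>"
proof
  assume "stable B A G f F N \<sigma> \<tau>"
  then have "- (\<integral>q. \<phi> q * (surface_laplacian B A G F \<phi> q
      + (ricci_normal A G F N q + norm2_second_ff B A G F N q) * \<phi> q) \<partial>\<sigma>)
    + (\<integral>q. integrand q \<partial>\<tau>) \<ge> 0"
    using smooth_\<phi> unfolding stable_def integrand_def by blast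
  moreover have "(\<integral>q. \<phi> q * (surface_laplacian B A G F \<phi> q
      + (ricci_normal A G F N q + norm2_second_ff B A G F N q) * \<phi> q) \<partial>\<sigma>) \<ge> 0"
  \<comment> \<open>The rule has no integrability premise: a non-integrable integrand has integral
    0, which is also admissible here.\<close>
  proof (rule Bochner_Integration.integral_nonneg)
    fix q assume "q \<in> space \<sigma>"
    then have q: "q \<in> topspace TS" using assms unfolding area_measure_def by simp
    have "\<phi> q * (surface_laplacian B A G F \<phi> q + (ricci_normal A G F N q + norm2_second_ff B A G F N q) * \<phi> q)
      = (\<phi> q)\<^sup>2 * norm2_second_ff B A G F N q"
      unfolding surface_laplacian_\<phi>(1)[OF q] by (simp add: algebra_simps power2_eq_square del: o_apply)
    then show "\<phi> q * (surface_laplacian B A G F \<phi> q + (ricci_normal A G F N q + norm2_second_ff B A G F N q) * \<phi> q) \<ge> 0"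
      using surface_laplacian_\<phi>(2)[OF q] by simp
  qed
  ultimately show False using integral_integrand_neg by linarith
qed

end

theorem corollary1p17:
  fixes T :: "'a topology"
    and A :: "('a, 3) chart set"
    and G :: "('a, 3) chart \<Rightarrow> real ^ 3 \<Rightarrow> real ^ 3 ^ 3"
    and f :: "'a \<Rightarrow> real"
    and \<rho> c :: real
  assumes "static_vacuum_space T A G f \<rho>"
    and "harmonic_curvature A G"
    and "level_boundary T A G f c"
  shows "\<not> (\<exists>(TS :: 'b topology) (B :: ('b, 2) chart set) (F :: 'b \<Rightarrow> 'a)
              (N :: ('a, 3) chart \<Rightarrow> 'b \<Rightarrow> real ^ 3) (\<sigma> :: 'b measure) (\<tau> :: 'b measure).
            smooth_manifold TS B \<and> compact_space TS \<and>
            immersion TS B T A F \<and>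
            unit_normal_field TS B A G F N \<and>
            minimal B A G F N \<and>
            free_boundary TS B A G f F \<and>
            area_measure TS B (induced_metric A G F) \<sigma> \<and>
            boundary_length_measure TS B (induced_metric A G F) \<tau> \<and>
            stable B A G f F N \<sigma> \<tau> \<and>
            positive_gauss_curvature B A G F)"
proof
  assume "\<exists>(TS :: 'b topology) (B :: ('b, 2) chart set) (F :: 'b \<Rightarrow> 'a)
              (N :: ('a, 3) chart \<Rightarrow> 'b \<Rightarrow> real ^ 3) (\<sigma> :: 'b measure) (\<tau> :: 'b measure).
            smooth_manifold TS B \<and> compact_space TS \<and>
            immersion TS B T A F \<and>
            unit_normal_field TS B A G F N \<and>
            minimal B A G F N \<and>
            free_boundary TS B A G f F \<and>
            area_measure TS B (induced_metric A G F) \<sigma> \<and>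
            boundary_length_measure TS B (induced_metric A G F) \<tau> \<and>
            stable B A G f F N \<sigma> \<tau> \<and>
            positive_gauss_curvature B A G F"
  then obtain TS :: "'b topology" and B :: "('b, 2) chart set" and F :: "'b \<Rightarrow> 'a"
      and N :: "('a, 3) chart \<Rightarrow> 'b \<Rightarrow> real ^ 3" and \<sigma> \<tau> :: "'b measure"
    where surface: "smooth_manifold TS B" "compact_space TS" "immersion TS B T A F" "unit_normal_field TS B A G F N"
      "minimal B A G F N" "free_boundary TS B A G f F"
      "positive_gauss_curvature B A G F"
      and \<sigma>: "area_measure TS B (induced_metric A G F) \<sigma>"
      and \<tau>: "boundary_length_measure TS B (induced_metric A G F) \<tau>"
      and stable: "stable B A G f F N \<sigma> \<tau>"
    by (elim exE conjE) (rule that)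
  obtain R where static: "riemannian_manifold T A G" "smooth_fun A f" "\<forall>p\<in>topspace T. f p > 0"
    "\<forall>c\<in>A. \<forall>x\<in>cimg c.
         scalar_curv (cimg c) (G c) x = R \<and>
         (\<forall>i j. f (param c x) * ricci (cimg c) (G c) i j x
            = hessian (cimg c) (G c) (f \<circ> param c) i j x + R / 2 * f (param c x) * G c x $ i $ j) \<and>
         laplacian (cimg c) (G c) (f \<circ> param c) x + R / 2 * f (param c x) = 0"
    using assms(1) unfolding static_vacuum_space_def by (elim exE conjE) (rule that)
  interpret static_surface_length T A G f R c TS B F N \<tau>
    by unfold_locales (use static assms(3) surface \<tau> in blast)+
  show False using not_stable[OF \<sigma>] stable by blast
qed

end
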